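(* Let $D\subset\mathbb{R}^n$ be a bounded connected open set with Lipschitz boundary. There exists a modulus of continuity $\sigma_D$ defined on the interval $[0,|D|]$, depending only on the domain $D$, such that the following hold. (i) For any $f\in L^\infty(D)$ with $\|f\|_\infty>0$, the weak solution $u\in H^1_0(D)$ of $-\Delta u=f$ in $D$, $u=0$ on $\partial D$, satisfies $$\|u\|_\infty\le \|f\|_\infty\,\sigma_D\!\left(\frac{\|f\|_1}{\|f\|_\infty}\right).$$ (ii) For any values $a$, $b$ with $b>0$ and $0<a\le b|D|$, there exists a function $f\in L^\infty(D)$ with $f\ge 0$ a.e. in $D$, $\|f\|_1=a$ and $\|f\|_\infty=b$, for which the inequality in (i) is an equality.
   Context: $|D|$ is the Lebesgue measure of $D$; $\|\cdot\|_p$ denotes the norm of $L^p(D)$. A modulus of continuity on $[0,|D|]$ is a continuous nondecreasing function $\sigma\colon[0,|D|]\to[0,\infty)$ with $\sigma(0)=0$. *)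

theory Defs
  imports "HOL-Analysis.Analysis" "HOL-Probability.Essential_Supremum"
begin

text \<open>
  Functions on \<open>D\<close> are represented by total functions; only their values on \<open>D\<close> matter, since
  every integral, norm and a.e. statement is taken with respect to \<open>lebesgue_on D\<close>.
\<close>

text \<open>
  Near each boundary point, and in suitably rotated coordinates whose last axis is \<open>e\<close>, the set
  \<open>D\<close> is the region above the graph of a Lipschitz function on the hyperplane orthogonal to \<open>e\<close>;
  the point \<open>x - (x \<bullet> e) e\<close> is the orthogonal projection of \<open>x\<close> to that hyperplane.
\<close>
definition lipschitz_boundary :: "(real^'n) set \<Rightarrow> bool" where
  "lipschitz_boundary D \<longleftrightarrow>
     (\<forall>p \<in> frontier D. \<exists>r e L \<gamma>. r > 0 \<and> norm e = 1 \<and> L-lipschitz_on {y. y \<bullet> e = 0} \<gamma> \<and>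
        D \<inter> ball p r = {x \<in> ball p r. x \<bullet> e > \<gamma> (x - (x \<bullet> e) *\<^sub>R e)})"

definition modulus_of_continuity_on :: "real \<Rightarrow> (real \<Rightarrow> real) \<Rightarrow> bool" where
  "modulus_of_continuity_on m \<sigma> \<longleftrightarrow>
     continuous_on {0..m} \<sigma> \<and> mono_on {0..m} \<sigma> \<and> (\<forall>t\<in>{0..m}. 0 \<le> \<sigma> t) \<and> \<sigma> 0 = 0"

definition L1_norm :: "(real^'n) set \<Rightarrow> (real^'n \<Rightarrow> real) \<Rightarrow> real" where
  "L1_norm D f = (LINT x|lebesgue_on D. \<bar>f x\<bar>)"

definition Linf :: "(real^'n) set \<Rightarrow> (real^'n \<Rightarrow> real) set" where
  "Linf D = {f \<in> borel_measurable (lebesgue_on D). esssup (lebesgue_on D) (\<lambda>x. ereal \<bar>f x\<bar>) < \<infinity>}"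

text \<open>Meaningful for members of \<open>Linf D\<close> only, as \<open>real_of_ereal \<infinity> = 0\<close>.\<close>
definition Linf_norm :: "(real^'n) set \<Rightarrow> (real^'n \<Rightarrow> real) \<Rightarrow> real" where
  "Linf_norm D f = real_of_ereal (esssup (lebesgue_on D) (\<lambda>x. ereal \<bar>f x\<bar>))"

definition L2 :: "(real^'n) set \<Rightarrow> (real^'n \<Rightarrow> 'b::euclidean_space) set" where
  "L2 D = {f \<in> borel_measurable (lebesgue_on D). integrable (lebesgue_on D) (\<lambda>x. (norm (f x))\<^sup>2)}"

definition partial_deriv :: "'n \<Rightarrow> (real^'n \<Rightarrow> real) \<Rightarrow> real^'n \<Rightarrow> real" where
  "partial_deriv i f x = frechet_derivative f (at x) (axis i 1)"

fun Ck :: "nat \<Rightarrow> (real^'n \<Rightarrow> real) \<Rightarrow> bool" where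
  "Ck 0 f \<longleftrightarrow> continuous_on UNIV f"
| "Ck (Suc k) f \<longleftrightarrow> f differentiable_on UNIV \<and> (\<forall>i. Ck k (partial_deriv i f))"

definition test_functions :: "(real^'n) set \<Rightarrow> (real^'n \<Rightarrow> real) set" where
  "test_functions D =
     {\<phi>. (\<forall>k. Ck k \<phi>) \<and> compact (closure {x. \<phi> x \<noteq> 0}) \<and> closure {x. \<phi> x \<noteq> 0} \<subseteq> D}"

definition locally_integrable :: "(real^'n) set \<Rightarrow> (real^'n \<Rightarrow> 'b::euclidean_space) \<Rightarrow> bool" where
  "locally_integrable D f \<longleftrightarrow> (\<forall>K. compact K \<and> K \<subseteq> D \<longrightarrow> integrable (lebesgue_on K) f)"

definition has_weak_gradient ::
    "(real^'n) set \<Rightarrow> (real^'n \<Rightarrow> real) \<Rightarrow> (real^'n \<Rightarrow> real^'n) \<Rightarrow> bool" where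
  "has_weak_gradient D u g \<longleftrightarrow> locally_integrable D u \<and> locally_integrable D g \<and>
     (\<forall>\<phi>\<in>test_functions D. \<forall>i.
        (LINT x|lebesgue_on D. u x * partial_deriv i \<phi> x) = - (LINT x|lebesgue_on D. g x $ i * \<phi> x))"

text \<open>
  On an open set, weak gradients are unique up to null sets, so for \<open>u\<close> having a weak gradient
  the choice of representative is immaterial below.
\<close>
definition weak_grad :: "(real^'n) set \<Rightarrow> (real^'n \<Rightarrow> real) \<Rightarrow> real^'n \<Rightarrow> real^'n" where
  "weak_grad D u = (SOME g. has_weak_gradient D u g)"

definition H1 :: "(real^'n) set \<Rightarrow> (real^'n \<Rightarrow> real) set" where
  "H1 D = {u \<in> L2 D. \<exists>g \<in> L2 D. has_weak_gradient D u g}"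

definition H1_norm :: "(real^'n) set \<Rightarrow> (real^'n \<Rightarrow> real) \<Rightarrow> real" where
  "H1_norm D u =
     sqrt ((LINT x|lebesgue_on D. (u x)\<^sup>2) + (LINT x|lebesgue_on D. (norm (weak_grad D u x))\<^sup>2))"

text \<open>The closure of the test functions in \<open>H1 D\<close>.\<close>
definition H10 :: "(real^'n) set \<Rightarrow> (real^'n \<Rightarrow> real) set" where
  "H10 D = {u \<in> H1 D. \<exists>\<phi> :: nat \<Rightarrow> real^'n \<Rightarrow> real.
     (\<forall>k. \<phi> k \<in> test_functions D) \<and> (\<lambda>k. H1_norm D (\<lambda>x. u x - \<phi> k x)) \<longlonglongrightarrow> 0}"

text \<open>Weak solutions of \<open>-\<Delta>u = f\<close> in \<open>D\<close>, \<open>u = 0\<close> on the boundary.\<close>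
definition weak_solution :: "(real^'n) set \<Rightarrow> (real^'n \<Rightarrow> real) \<Rightarrow> (real^'n \<Rightarrow> real) \<Rightarrow> bool" where
  "weak_solution D f u \<longleftrightarrow> u \<in> H10 D \<and>
     (\<forall>v\<in>H10 D. (LINT x|lebesgue_on D. weak_grad D u x \<bullet> weak_grad D v x) =
                 (LINT x|lebesgue_on D. f x * v x))"

end

theory Submission
  imports Defs
begin

text \<open>
  Extend the solution with right hand side \<open>0 \<le> f \<le> 1\<close> by zero outside \<open>D\<close>. The extension
  \<open>u \<ge> 0\<close> satisfies \<open>-\<Delta>u \<le> f\<close> in the whole space (lemma \<open>wsol_subsolution\<close>): the
  function \<open>(u - t \<psi>)\<^sup>+\<close> is an admissible competitor in Dirichlet's principle for
  every smooth \<open>\<psi> \<ge> 0\<close>, whether or not \<open>\<psi>\<close> vanishes on the boundary, and \<open>t \<rightarrow> 0\<close> gives the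
  inequality. Hence an average of \<open>u\<close> against a radial kernel of scale below \<open>r\<close> exceeds the one of
  scale \<open>r\<close> by at most \<open>O(r\<^sup>2)\<close> (\<open>ker_average_mono\<close>), and so the essential supremum of \<open>u\<close> is
  bounded by the averages of scale \<open>r\<close> plus \<open>O(r\<^sup>2)\<close>. For fixed \<open>r\<close> these averages are continuous in
  the mean square norm, so the inequality turns mean square convergence of solutions into bounds for
  their sup norms.

  The modulus is the best possible one: \<open>\<sigma>(t)\<close> is the supremum of the sup norms of the solutions
  whose right hand sides have values in \<open>[0,1]\<close> and integral \<open>t\<close>. It is finite and tends to \<open>0\<close> with
  \<open>t\<close> because averages of a fixed scale are controlled by the Poincare inequality. It is monotone
  by the maximum principle, which is again a truncation argument. Multiplying a right hand side by
  \<open>s/t\<close> shows \<open>\<sigma>(s) \<ge> (s/t) \<sigma>(t)\<close> for \<open>s \<le> t\<close>; together with monotonicity this is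
  continuity away from \<open>0\<close>. For general \<open>f\<close> both \<open>u\<close> and \<open>-u\<close> lie below the solution for \<open>\<bar>f\<bar>\<close>,
  and the first assertion follows by scaling.

  For the second assertion the supremum has to be attained. Take a maximising sequence of solutions
  \<open>u\<^sub>n\<close> and points \<open>x\<^sub>n\<close> at which small averages nearly reach the supremum. By the
  inequality above the averages of every larger scale at \<open>x\<^sub>n\<close> are large as well, and after
  passing to a subsequence \<open>x\<^sub>n \<rightarrow> x\<^sub>0\<close>, so the averages at \<open>x\<^sub>0\<close> are
  large (\<open>concentration_point\<close>). These are linear conditions on the right hand side; they define
  decreasing convex sets, whose elements of almost minimal norm converge in the mean to a maximiser
  (\<open>opt_modulus_attained\<close>). A maximiser may stay below a constant less than \<open>1\<close>; it is then a
  proper convex combination of competitors of which one has sup norm \<open>1\<close>, and convexity of the norm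
  makes that one a maximiser too (\<open>opt_modulus_attained_norm_1\<close>).
\<close>

section \<open>Smooth functions\<close>

definition smooth :: "(real^'n \<Rightarrow> real) \<Rightarrow> bool" where
  "smooth f \<longleftrightarrow> (\<forall>k. Ck k f)"

lemma Ck_differentiable: "Ck (Suc k) f \<Longrightarrow> f differentiable (at x)"
  by (auto simp: differentiable_on_def)

lemma Ck_decreasing: "Ck (Suc k) f \<Longrightarrow> Ck k f"
proof (induction k arbitrary: f)
  case 0
  then show ?case by (auto intro: differentiable_imp_continuous_on)
next
  case (Suc k)
  then show ?case by (metis Ck.simps(2))
qed

lemma partial_deriv_eq:
  assumes "(f has_derivative f') (at x)" shows "partial_deriv i f x = f' (axis i 1)"
  using frechet_derivative_at[OF assms] by (simp add: partial_deriv_def)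

lemma partial_deriv_has_derivative:
  assumes "f differentiable (at x)"
  shows "(f has_derivative (\<lambda>h. \<Sum>i\<in>UNIV. h $ i * partial_deriv i f x)) (at x)"
proof -
  let ?F = "frechet_derivative f (at x)"
  have D: "(f has_derivative ?F) (at x)"
    using assms frechet_derivative_works by blast
  then have lin: "linear ?F" by (rule has_derivative_linear)
  have "?F h = (\<Sum>i\<in>UNIV. h $ i * partial_deriv i f x)" for h
  proof -
    have "?F h = ?F (\<Sum>i\<in>UNIV. (h $ i) *\<^sub>R axis i 1)"
      using basis_expansion[of h] by (simp add: scalar_mult_eq_scaleR)
    also have "\<dots> = (\<Sum>i\<in>UNIV. (h $ i) *\<^sub>R ?F (axis i 1))"
      using lin by (simp add: linear_sum linear_scale)
    finally show ?thesis by (simp add: partial_deriv_def)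
  qed
  then show ?thesis using D by presburger
qed

lemma partial_deriv_const [simp]: "partial_deriv i (\<lambda>x. c) = (\<lambda>x. 0)"
  by (rule ext, subst partial_deriv_eq, rule has_derivative_const) simp

lemma partial_deriv_nth: "partial_deriv i (\<lambda>x. x $ j) = (\<lambda>x. if i = j then 1 else 0)"
  by (rule ext, subst partial_deriv_eq[where f'="\<lambda>x. x $ j"])
     (auto intro!: bounded_linear_imp_has_derivative bounded_linear_vec_nth simp: axis_def)

lemma sum_axis: "(\<Sum>i\<in>UNIV. axis j (1::real) $ i * c i) = c j"
proof -
  have "(\<Sum>i\<in>UNIV. axis j (1::real) $ i * c i) = (\<Sum>i\<in>UNIV. if i = j then c i else 0)"
    by (intro sum.cong) (auto simp: axis_def)
  then show ?thesis by simp
qed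

lemma partial_deriv_add:
  assumes "f differentiable (at x)" "g differentiable (at x)"
  shows "partial_deriv i (\<lambda>x. f x + g x) x = partial_deriv i f x + partial_deriv i g x"
  using has_derivative_add[OF assms[THEN partial_deriv_has_derivative]]
  by (subst partial_deriv_eq, assumption) (simp add: sum_axis)

lemma partial_deriv_mult:
  assumes "f differentiable (at x)" "g differentiable (at x)"
  shows "partial_deriv i (\<lambda>x. f x * g x) x = f x * partial_deriv i g x + partial_deriv i f x * g x"
  using has_derivative_mult[OF assms[THEN partial_deriv_has_derivative]]
  by (subst partial_deriv_eq, assumption) (simp add: sum_axis)

lemma partial_deriv_chain:
  assumes "(F has_real_derivative F') (at (f x))" "f differentiable (at x)"
  shows "partial_deriv i (\<lambda>x. F (f x)) x = F' * partial_deriv i f x"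
proof -
  have "((\<lambda>x. F (f x)) has_derivative
      (\<lambda>h. F' * (\<Sum>i\<in>UNIV. h $ i * partial_deriv i f x))) (at x)"
    using has_derivative_compose[OF partial_deriv_has_derivative[OF assms(2)]
        assms(1)[unfolded has_field_derivative_def]] by simp
  from partial_deriv_eq[OF this] show ?thesis by (simp add: sum_axis)
qed

lemma Ck_const: "Ck k (\<lambda>x. c)"
  by (induction k arbitrary: c) auto

lemma Ck_nth: "Ck k (\<lambda>x::real^'n. x $ j)"
proof (cases k)
  case (Suc m)
  have "(\<lambda>x::real^'n. x $ j) differentiable_on UNIV"
    by (simp add: differentiable_on_def bounded_linear_imp_differentiable bounded_linear_vec_nth)
  then show ?thesis by (simp add: Suc partial_deriv_nth Ck_const)
qed (simp add: continuous_on_component)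

lemma Ck_add: "Ck k f \<Longrightarrow> Ck k g \<Longrightarrow> Ck k (\<lambda>x. f x + g x)"
proof (induction k arbitrary: f g)
  case (Suc k)
  have "partial_deriv i (\<lambda>x. f x + g x) = (\<lambda>x. partial_deriv i f x + partial_deriv i g x)" for i
    using Suc.prems[THEN Ck_differentiable] by (auto simp: partial_deriv_add)
  then show ?case using Suc by (auto simp: differentiable_on_def)
qed (auto intro: continuous_intros)

lemma Ck_mult: "Ck k f \<Longrightarrow> Ck k g \<Longrightarrow> Ck k (\<lambda>x. f x * g x)"
proof (induction k arbitrary: f g)
  case (Suc k)
  have "partial_deriv i (\<lambda>x. f x * g x) = (\<lambda>x. f x * partial_deriv i g x + partial_deriv i f x * g x)" for i
    using Suc.prems[THEN Ck_differentiable] by (auto simp: partial_deriv_mult)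
  then show ?case using Suc Suc.prems[THEN Ck_decreasing]
    by (auto simp: differentiable_on_def intro!: Ck_add)
qed (auto intro: continuous_intros)

lemma Ck_diff: "Ck k f \<Longrightarrow> Ck k g \<Longrightarrow> Ck k (\<lambda>x. f x - g x)"
  using Ck_add[OF _ Ck_mult[OF Ck_const[of k "-1"]], of f g] by simp

text \<open>The powers of \<open>1/s\<close> are included because the derivative of a member is a combination of
  members with higher powers. The decay at the origin is faster than every power, so all members are
  smooth across \<open>0\<close>; every cut-off function below is built from them.\<close>
definition flat_exp :: "nat \<Rightarrow> real \<Rightarrow> real" where
  "flat_exp m s = (if s > 0 then exp (- 1 / s) / s ^ m else 0)"

lemma flat_exp_nonneg: "0 \<le> flat_exp m s"
  by (simp add: flat_exp_def)

text \<open>The exponential series dominates each of its terms.\<close>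
lemma flat_exp_bound: "flat_exp m s \<le> fact m"
proof (cases "s > 0")
  case True
  have "(1/s) ^ m / fact m \<le> exp (1/s)"
    using exp_lower_Taylor_quadratic True
  proof -
    have "summable (\<lambda>n. (1/s) ^ n /\<^sub>R fact n)" by (rule summable_exp_generic)
    then have "(\<Sum>n\<in>{m}. (1/s) ^ n /\<^sub>R fact n) \<le> (\<Sum>n. (1/s) ^ n /\<^sub>R fact n)"
      by (rule sum_le_suminf) (use True in auto)
    then show ?thesis by (simp add: exp_def divide_inverse mult.commute)
  qed
  then show ?thesis using True
    by (simp add: flat_exp_def exp_minus field_simps)
qed (simp add: flat_exp_def)

lemma flat_exp_abs_bound: "\<bar>flat_exp m s\<bar> \<le> fact m"
  using flat_exp_bound flat_exp_nonneg by simp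

lemma flat_exp_le_power: "flat_exp m s \<le> fact (m + k) * \<bar>s\<bar> ^ k"
proof (cases "s > 0")
  case True
  have "flat_exp (m + k) s * s ^ k \<le> fact (m + k) * s ^ k"
    using True flat_exp_bound by (intro mult_right_mono) auto
  then show ?thesis using True by (simp add: flat_exp_def power_add)
qed (simp add: flat_exp_def)

lemma flat_exp_deriv:
  "(flat_exp m has_real_derivative (flat_exp (m + 2) s - real m * flat_exp (m + 1) s)) (at s)"
proof -
  consider "s > 0" | "s < 0" | "s = 0" by linarith
  then show ?thesis
  proof cases
    case 1
    have eq: "\<forall>\<^sub>F x in nhds s. exp (- 1 / x) / x ^ m = flat_exp m x"
      using eventually_nhds_in_open[of "{0<..}" s] 1
      by (auto elim!: eventually_mono simp: flat_exp_def)
    have "((\<lambda>x. exp (- 1 / x) / x ^ m) has_real_derivative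
        (flat_exp (m + 2) s - real m * flat_exp (m + 1) s)) (at s)"
      using 1 by (auto intro!: derivative_eq_intros simp: flat_exp_def divide_simps)
        (cases m; simp add: algebra_simps power2_eq_square)
    then show ?thesis using eq by (subst (asm) DERIV_cong_ev[OF refl _ refl, where g="flat_exp m"]) auto
  next
    case 2
    have "\<forall>\<^sub>F x in nhds s. 0 = flat_exp m x"
      using eventually_nhds_in_open[of "{..<0}" s] 2
      by (auto elim!: eventually_mono simp: flat_exp_def)
    then have "((\<lambda>x::real. 0) has_real_derivative 0) (at s) \<longleftrightarrow> (flat_exp m has_real_derivative 0) (at s)"
      by (intro DERIV_cong_ev) auto
    then show ?thesis using 2 by (simp add: flat_exp_def)
  next
    case 3
    have "((\<lambda>h. flat_exp m h / h) \<longlongrightarrow> 0) (at 0)"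
    proof (rule Lim_null_comparison)
      show "\<forall>\<^sub>F h in at 0. norm (flat_exp m h / h) \<le> fact (m + 2) * \<bar>h\<bar>"
      proof (intro always_eventually allI)
        fix h :: real
        have "flat_exp m h \<le> (fact (m + 2) * \<bar>h\<bar>) * \<bar>h\<bar>"
          using flat_exp_le_power[of m h 2] by (simp only: power2_eq_square mult.assoc)
        then show "norm (flat_exp m h / h) \<le> fact (m + 2) * \<bar>h\<bar>"
          by (cases "h = 0") (simp_all add: flat_exp_nonneg abs_div divide_le_eq del: fact_Suc)
      qed
      show "((\<lambda>h. fact (m + 2) * \<bar>h\<bar>) \<longlongrightarrow> (0::real)) (at 0)"
        by (auto intro!: tendsto_eq_intros)
    qed
    then show ?thesis using 3 by (simp add: DERIV_def flat_exp_def)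
  qed
qed

lemma flat_exp_continuous: "continuous_on UNIV (flat_exp m)"
  by (meson DERIV_continuous_on flat_exp_deriv has_field_derivative_at_within)

lemma Ck_flat_exp: "Ck k f \<Longrightarrow> Ck k (\<lambda>x. flat_exp m (f x))"
proof (induction k arbitrary: f m)
  case 0
  then show ?case by (auto intro: continuous_on_compose2[OF flat_exp_continuous])
next
  case (Suc k)
  have d: "f differentiable (at x)" for x using Suc.prems by (rule Ck_differentiable)
  have "partial_deriv i (\<lambda>x. flat_exp m (f x)) =
     (\<lambda>x. (flat_exp (m + 2) (f x) + (- real m) * flat_exp (m + 1) (f x)) * partial_deriv i f x)" for i
    using partial_deriv_chain[OF flat_exp_deriv d] by auto
  moreover have "(\<lambda>x. flat_exp m (f x)) differentiable_on UNIV"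
    unfolding differentiable_on_def
  proof
    fix x
    show "(\<lambda>x. flat_exp m (f x)) differentiable (at x within UNIV)"
      using has_derivative_compose[OF partial_deriv_has_derivative[OF d[of x]]
          flat_exp_deriv[of m "f x", unfolded has_field_derivative_def]]
      by (auto simp: differentiable_def)
  qed
  ultimately show ?case
    using Suc.prems Suc.IH[OF Ck_decreasing[OF Suc.prems]]
    by (auto intro!: Ck_mult Ck_diff Ck_const)
qed

lemma smooth_const: "smooth (\<lambda>x. c)" by (simp add: smooth_def Ck_const)
lemma smooth_nth: "smooth (\<lambda>x. x $ i)" by (simp add: smooth_def Ck_nth)
lemma smooth_add: "smooth f \<Longrightarrow> smooth g \<Longrightarrow> smooth (\<lambda>x. f x + g x)" by (simp add: smooth_def Ck_add)
lemma smooth_mult: "smooth f \<Longrightarrow> smooth g \<Longrightarrow> smooth (\<lambda>x. f x * g x)" by (simp add: smooth_def Ck_mult)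
lemma smooth_flat_exp: "smooth f \<Longrightarrow> smooth (\<lambda>x. flat_exp m (f x))" by (simp add: smooth_def Ck_flat_exp)
lemma smooth_cmult: "smooth f \<Longrightarrow> smooth (\<lambda>x. c * f x)" by (intro smooth_mult smooth_const)
lemma smooth_diff: "smooth f \<Longrightarrow> smooth g \<Longrightarrow> smooth (\<lambda>x. f x - g x)"
  by (simp add: smooth_def Ck_diff)
lemma smooth_sum: "(\<And>i. i \<in> I \<Longrightarrow> smooth (f i)) \<Longrightarrow> smooth (\<lambda>x. \<Sum>i\<in>I. f i x)"
  by (induction I rule: infinite_finite_induct) (auto intro: smooth_const smooth_add)
lemma smooth_prod: "(\<And>i. i \<in> I \<Longrightarrow> smooth (f i)) \<Longrightarrow> smooth (\<lambda>x. \<Prod>i\<in>I. f i x)"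
  by (induction I rule: infinite_finite_induct) (auto intro: smooth_const smooth_mult)
lemma smooth_partial_deriv: "smooth f \<Longrightarrow> smooth (partial_deriv i f)"
  unfolding smooth_def by (metis Ck.simps(2))
lemma smooth_differentiable: "smooth f \<Longrightarrow> f differentiable (at x)"
  unfolding smooth_def by (blast intro: Ck_differentiable)
lemma smooth_continuous: "smooth f \<Longrightarrow> continuous_on S f"
  unfolding smooth_def by (metis Ck.simps(1) continuous_on_subset subset_UNIV)
lemma smooth_measurable: "smooth f \<Longrightarrow> f \<in> borel_measurable borel"
  using smooth_continuous borel_measurable_continuous_onI by blast

lemma smooth_norm_diff_sq: "smooth (\<lambda>y. (norm (y - x))\<^sup>2)"
proof -
  have "(\<lambda>y. (norm (y - x))\<^sup>2) = (\<lambda>y. \<Sum>i\<in>UNIV. (y $ i - x $ i) * (y $ i - x $ i))"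
    by (auto simp: power2_norm_eq_inner inner_vec_def)
  then show ?thesis by (auto intro!: smooth_sum smooth_mult smooth_diff smooth_nth smooth_const)
qed

lemma partial_deriv_norm_diff_sq: "partial_deriv i (\<lambda>y. (norm (y - x))\<^sup>2) y = 2 * (y $ i - x $ i)"
proof -
  have "((\<lambda>y. (y - x) \<bullet> (y - x)) has_derivative (\<lambda>h. (y - x) \<bullet> h + h \<bullet> (y - x))) (at y)"
    by (auto intro!: derivative_eq_intros)
  from partial_deriv_eq[OF this] show ?thesis
    by (simp add: power2_norm_eq_inner inner_axis inner_axis')
qed

definition grad :: "(real^'n \<Rightarrow> real) \<Rightarrow> real^'n \<Rightarrow> real^'n" where
  "grad f x = (\<chi> i. partial_deriv i f x)"

lemma grad_nth [simp]: "grad f x $ i = partial_deriv i f x" by (simp add: grad_def)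

lemma grad_continuous: "smooth f \<Longrightarrow> continuous_on S (grad f)"
  unfolding grad_def
  by (intro continuous_on_vec_lambda smooth_continuous smooth_partial_deriv)

lemma grad_chain:
  assumes "(F has_real_derivative F') (at (f x))" "smooth f"
  shows "grad (\<lambda>x. F (f x)) x = F' *\<^sub>R grad f x"
  using partial_deriv_chain[OF assms(1) smooth_differentiable[OF assms(2)]] by (simp add: vec_eq_iff)

lemma grad_linear:
  assumes "smooth f" "smooth g"
  shows "grad (\<lambda>x. a * f x + b * g x) x = a *\<^sub>R grad f x + b *\<^sub>R grad g x"
proof -
  have "((\<lambda>x. a * f x + b * g x) has_derivative
     (\<lambda>h. a * (\<Sum>i\<in>UNIV. h $ i * partial_deriv i f x) + b * (\<Sum>i\<in>UNIV. h $ i * partial_deriv i g x))) (at x)"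
    using assms by (intro has_derivative_add has_derivative_mult_right
        partial_deriv_has_derivative smooth_differentiable)
  from partial_deriv_eq[OF this] show ?thesis
    by (simp add: vec_eq_iff sum_axis)
qed

section \<open>Test functions and integration by parts\<close>

lemma test_smooth: "\<phi> \<in> test_functions D \<Longrightarrow> smooth \<phi>"
  by (simp add: test_functions_def smooth_def)

lemma test_functionsI:
  assumes "smooth \<eta>" "compact K" "K \<subseteq> D" "\<And>x. x \<notin> K \<Longrightarrow> \<eta> x = 0"
  shows "\<eta> \<in> test_functions D"
proof -
  have "closure {x. \<eta> x \<noteq> 0} \<subseteq> K"
    using assms by (intro closure_minimal compact_imp_closed) auto
  moreover from this have "compact (closure {x. \<eta> x \<noteq> 0})"
    using assms(2) by (metis closed_closure compact_Int_closed inf.absorb2)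
  ultimately show ?thesis using assms by (auto simp: test_functions_def smooth_def)
qed

lemma test_support:
  assumes "\<phi> \<in> test_functions D"
  obtains K where "compact K" "K \<subseteq> D" "\<And>x. x \<notin> K \<Longrightarrow> \<phi> x = 0" "\<And>x i. x \<notin> K \<Longrightarrow> partial_deriv i \<phi> x = 0"
proof -
  define K where "K = closure {x. \<phi> x \<noteq> 0}"
  have K: "compact K" "K \<subseteq> D" "closed K"
    using assms by (simp_all add: K_def test_functions_def)
  have 0: "\<phi> x = 0" if "x \<notin> K" for x
    using that closure_subset[of "{x. \<phi> x \<noteq> 0}"] unfolding K_def by blast
  have "partial_deriv i \<phi> x = 0" if "x \<notin> K" for x i
  proof -
    have "(\<phi> has_derivative (\<lambda>h. 0)) (at x)"
    proof (rule has_derivative_transform_within_open[of "\<lambda>x. 0" _ _ _ "- K"])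
      show "0 = \<phi> y" if "y \<in> - K" for y using 0 that by simp
    qed (use that K(3) in \<open>auto simp: open_Compl\<close>)
    then show ?thesis by (simp add: partial_deriv_eq)
  qed
  then show ?thesis using 0 K that by blast
qed

lemma test_outside: "\<phi> \<in> test_functions D \<Longrightarrow> x \<notin> D \<Longrightarrow> \<phi> x = 0"
  by (meson subsetD test_support)

lemma test_partial_deriv:
  assumes "\<phi> \<in> test_functions D" shows "partial_deriv i \<phi> \<in> test_functions D"
  by (rule test_support[OF assms], rule test_functionsI)
     (auto intro: smooth_partial_deriv test_smooth[OF assms])

lemma test_mult_smooth:
  assumes "\<phi> \<in> test_functions D" "smooth \<eta>" shows "(\<lambda>x. \<phi> x * \<eta> x) \<in> test_functions D"
  by (rule test_support[OF assms(1)], rule test_functionsI)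
     (auto intro: smooth_mult test_smooth[OF assms(1)] assms)

lemma test_linear:
  assumes "\<phi> \<in> test_functions D" "\<eta> \<in> test_functions D"
  shows "(\<lambda>x. a * \<phi> x + b * \<eta> x) \<in> test_functions D"
proof -
  obtain K where "compact K" "K \<subseteq> D" "\<And>x. x \<notin> K \<Longrightarrow> \<phi> x = 0"
    using test_support[OF assms(1)] by metis
  moreover obtain L where "compact L" "L \<subseteq> D" "\<And>x. x \<notin> L \<Longrightarrow> \<eta> x = 0"
    using test_support[OF assms(2)] by metis
  ultimately show ?thesis
    by (intro test_functionsI[of _ "K \<union> L"])
       (auto intro!: smooth_add smooth_cmult test_smooth[OF assms(1)] test_smooth[OF assms(2)])
qed

lemma test_zero: "(\<lambda>x. 0) \<in> test_functions D"
  by (rule test_functionsI[of _ "{}"]) (auto intro: smooth_const)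

lemma test_diff:
  assumes "\<phi> \<in> test_functions D" "\<eta> \<in> test_functions D"
  shows "(\<lambda>x. \<phi> x - \<eta> x) \<in> test_functions D"
  using test_linear[OF assms, of 1 "-1"] by simp

lemma grad_test_linear:
  "\<phi> \<in> test_functions D \<Longrightarrow> \<eta> \<in> test_functions D \<Longrightarrow>
    grad (\<lambda>x. a * \<phi> x + b * \<eta> x) x = a *\<^sub>R grad \<phi> x + b *\<^sub>R grad \<eta> x"
  by (intro grad_linear test_smooth)

lemma grad_test_diff:
  "\<phi> \<in> test_functions D \<Longrightarrow> \<eta> \<in> test_functions D \<Longrightarrow>
    grad (\<lambda>x. \<phi> x - \<eta> x) x = grad \<phi> x - grad \<eta> x"
  using grad_test_linear[of \<phi> D \<eta> 1 "-1" x] by simp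

lemma test_bounded:
  assumes "\<phi> \<in> test_functions D" obtains B where "0 \<le> B" "\<And>x. \<bar>\<phi> x\<bar> \<le> B"
proof -
  obtain K where K: "compact K" "\<And>x. x \<notin> K \<Longrightarrow> \<phi> x = 0"
    using test_support[OF assms] by metis
  have "bounded (\<phi> ` K)"
    using K smooth_continuous[OF test_smooth[OF assms]]
    by (intro compact_imp_bounded compact_continuous_image) auto
  then obtain B where B: "\<And>x. x \<in> K \<Longrightarrow> \<bar>\<phi> x\<bar> \<le> B" by (auto simp: bounded_iff)
  show ?thesis
  proof
    show "\<bar>\<phi> x\<bar> \<le> max 0 B" for x using B[of x] K(2)[of x] by (cases "x \<in> K") auto
  qed simp
qed

lemma test_integrable_lborel:
  assumes "\<phi> \<in> test_functions D" shows "integrable lborel \<phi>"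
proof -
  obtain K where K: "compact K" "\<And>x. x \<notin> K \<Longrightarrow> \<phi> x = 0"
    using test_support[OF assms] by metis
  have "integrable lborel (\<lambda>x. indicator K x *\<^sub>R \<phi> x)"
    using K smooth_continuous[OF test_smooth[OF assms]] by (intro borel_integrable_compact) auto
  also have "(\<lambda>x. indicator K x *\<^sub>R \<phi> x) = \<phi>" using K by (intro ext) (auto simp: indicator_def)
  finally show ?thesis .
qed

lemma borel_measurable_lebesgue_on:
  "f \<in> borel_measurable borel \<Longrightarrow> f \<in> borel_measurable (lebesgue_on S)"
  by (intro measurable_restrict_space1) (simp add: measurable_completion)

lemma integral_lebesgue_on_eq_lborel:
  fixes f :: "real^'n \<Rightarrow> real"
  assumes "D \<in> sets lebesgue" "f \<in> borel_measurable borel" "\<And>x. x \<notin> D \<Longrightarrow> f x = 0"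
  shows "(LINT x|lebesgue_on D. f x) = (LINT x|lborel. f x)"
proof -
  have "(LINT x|lebesgue_on D. f x) = (LINT x|lebesgue. indicator D x *\<^sub>R f x)"
    using assms by (intro integral_restrict_space) auto
  also have "(\<lambda>x. indicator D x *\<^sub>R f x) = f" using assms by (intro ext) (auto simp: indicator_def)
  finally show ?thesis using assms by (simp add: integral_completion)
qed

lemma DERIV_along_axis:
  assumes "smooth \<phi>"
  shows "((\<lambda>t. \<phi> (x + t *\<^sub>R axis i 1)) has_real_derivative partial_deriv i \<phi> (x + t *\<^sub>R axis i 1)) (at t)"
proof -
  have "((\<lambda>t. x + t *\<^sub>R axis i (1::real)) has_derivative (\<lambda>h. h *\<^sub>R axis i 1)) (at t)"
    by (auto intro!: derivative_eq_intros)
  from has_derivative_compose[OF this partial_deriv_has_derivative[OF smooth_differentiable[OF assms]]]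
  show ?thesis
    by (simp add: has_field_derivative_def sum_axis sum_distrib_left[symmetric] mult.assoc mult_commute_abs)
qed

text \<open>Translation invariance makes the integral of every difference quotient vanish.\<close>
lemma integral_partial_deriv_lborel:
  assumes \<phi>: "\<phi> \<in> test_functions D"
  shows "(LINT x|lborel. partial_deriv i \<phi> x) = 0"
proof -
  let ?e = "axis i (1::real)"
  define h where "h k = 1 / real (Suc k)" for k
  define q where "q k x = (\<phi> (x + h k *\<^sub>R ?e) - \<phi> x) / h k" for k x
  have h: "h k > 0" "h k \<le> 1" for k by (auto simp: h_def)
  have h0: "h \<longlonglongrightarrow> 0" unfolding h_def using LIMSEQ_Suc[OF lim_1_over_n] by simp
  have sm: "smooth \<phi>" using \<phi> by (rule test_smooth)
  have [measurable]: "\<phi> \<in> borel_measurable borel" using sm by (rule smooth_measurable)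
  have [measurable]: "partial_deriv i \<phi> \<in> borel_measurable borel"
    using sm by (intro smooth_measurable smooth_partial_deriv)
  obtain B where B: "0 \<le> B" "\<And>x. \<bar>partial_deriv i \<phi> x\<bar> \<le> B"
    using test_bounded[OF test_partial_deriv[OF \<phi>]] by metis
  obtain K where K: "compact K" "\<And>x. x \<notin> K \<Longrightarrow> \<phi> x = 0"
    using test_support[OF \<phi>] by metis
  obtain R where R: "\<And>x. x \<in> K \<Longrightarrow> norm x \<le> R"
    using compact_imp_bounded[OF K(1)] by (auto simp: bounded_iff)
  have bound: "norm (q k x) \<le> B * indicator (cball 0 (R + 1)) x" for k x
  proof (cases "x \<in> cball 0 (R + 1)")
    case True
    obtain z where "\<phi> (x + h k *\<^sub>R ?e) - \<phi> (x + 0 *\<^sub>R ?e) = (h k - 0) * partial_deriv i \<phi> (x + z *\<^sub>R ?e)"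
      using MVT2[where f="\<lambda>t. \<phi> (x + t *\<^sub>R ?e)" and f'="\<lambda>t. partial_deriv i \<phi> (x + t *\<^sub>R ?e)",
          OF h(1)[of k]]
        DERIV_along_axis[OF sm] by blast
    then have "q k x = partial_deriv i \<phi> (x + z *\<^sub>R ?e)"
      using h(1)[of k] by (simp add: q_def)
    then show ?thesis using B True by simp
  next
    case False
    have "norm x \<le> norm (x + h k *\<^sub>R ?e) + norm (h k *\<^sub>R ?e)"
      by (metis add_diff_cancel_right' norm_triangle_ineq4)
    then have "norm x \<le> norm (x + h k *\<^sub>R ?e) + 1" using h[of k] by (simp add: norm_axis_1)
    then have "x + h k *\<^sub>R ?e \<notin> K" "x \<notin> K" using False R[of x] R[of "x + h k *\<^sub>R ?e"] by auto
    then show ?thesis using K(2) B(1) by (simp add: q_def)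
  qed
  have "(\<lambda>k. LINT x|lborel. q k x) \<longlonglongrightarrow> (LINT x|lborel. partial_deriv i \<phi> x)"
  proof (rule integral_dominated_convergence)
    show "integrable lborel (\<lambda>x. B * indicator (cball 0 (R + 1)) x :: real)"
      by (intro integrable_mult_right integrable_real_indicator) (auto intro: emeasure_bounded_finite[unfolded infinity_ennreal_def])
    show "AE x in lborel. (\<lambda>k. q k x) \<longlonglongrightarrow> partial_deriv i \<phi> x"
    proof (rule AE_I2)
      fix x
      have "((\<lambda>t. (\<phi> (x + t *\<^sub>R ?e) - \<phi> x) / t) \<longlongrightarrow> partial_deriv i \<phi> x) (at 0)"
        using DERIV_along_axis[OF sm, of x i 0] by (simp add: DERIV_def)
      then show "(\<lambda>k. q k x) \<longlonglongrightarrow> partial_deriv i \<phi> x"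
        unfolding q_def using h(1) h0
        by (auto simp: tendsto_at_iff_sequentially comp_def less_imp_neq[symmetric])
    qed
  qed (use bound in \<open>auto simp: q_def\<close>)
  moreover have "(LINT x|lborel. q k x) = 0" for k
  proof -
    have int: "integrable lborel \<phi>" using \<phi> by (rule test_integrable_lborel)
    have eq: "distr lborel borel ((+) (h k *\<^sub>R ?e)) = lborel" by (rule lborel_distr_plus)
    have "integrable (distr lborel borel ((+) (h k *\<^sub>R ?e))) \<phi>" using int eq by simp
    then have i2: "integrable lborel (\<lambda>x. \<phi> (x + h k *\<^sub>R ?e))"
      by (subst (asm) integrable_distr_eq) (auto simp: add.commute)
    have "(LINT x|lborel. \<phi> x) = (LINT x|distr lborel borel ((+) (h k *\<^sub>R ?e)). \<phi> x)"
      using eq by simp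
    also have "\<dots> = (LINT x|lborel. \<phi> (x + h k *\<^sub>R ?e))"
      by (subst integral_distr) (auto simp: add.commute)
    finally show ?thesis using int i2 by (simp add: q_def)
  qed
  ultimately show ?thesis by (simp add: LIMSEQ_const_iff)
qed

lemma integral_partial_deriv:
  assumes "\<phi> \<in> test_functions D" "D \<in> sets lebesgue"
  shows "(LINT x|lebesgue_on D. partial_deriv i \<phi> x) = 0"
  using assms test_partial_deriv[OF assms(1), of i]
  by (subst integral_lebesgue_on_eq_lborel)
     (auto simp: integral_partial_deriv_lborel intro: test_outside smooth_measurable test_smooth)

lemma test_integrable:
  assumes "\<phi> \<in> test_functions D" and S: "S \<in> sets lebesgue"
  shows "integrable (lebesgue_on S) \<phi>"
proof -
  have "integrable lebesgue \<phi>"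
    using test_integrable_lborel[OF assms(1)] by (rule integrable_completion[THEN iffD2, rotated])
      (use smooth_measurable[OF test_smooth[OF assms(1)]] in simp)
  then have "integrable lebesgue (\<lambda>x. indicator S x *\<^sub>R \<phi> x)"
    using S by (intro integrable_mult_indicator)
  then show ?thesis using S by (simp add: integrable_restrict_space)
qed

lemma integration_by_parts:
  assumes "\<phi> \<in> test_functions D" "smooth \<eta>" and D: "D \<in> sets lebesgue"
  shows "(LINT x|lebesgue_on D. partial_deriv i \<phi> x * \<eta> x) = - (LINT x|lebesgue_on D. \<phi> x * partial_deriv i \<eta> x)"
proof -
  have i1: "integrable (lebesgue_on D) (\<lambda>x. partial_deriv i \<phi> x * \<eta> x)"
    using assms by (intro test_integrable[OF test_mult_smooth[OF test_partial_deriv]])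
  have i2: "integrable (lebesgue_on D) (\<lambda>x. \<phi> x * partial_deriv i \<eta> x)"
    using assms by (intro test_integrable[OF test_mult_smooth] smooth_partial_deriv)
  have "partial_deriv i (\<lambda>x. \<phi> x * \<eta> x) = (\<lambda>x. \<phi> x * partial_deriv i \<eta> x + partial_deriv i \<phi> x * \<eta> x)"
    using assms(2) test_smooth[OF assms(1)] by (intro ext partial_deriv_mult smooth_differentiable)
  with integral_partial_deriv[OF test_mult_smooth[OF assms(1,2)] D, of i] i1 i2 show ?thesis
    by simp
qed

section \<open>Square-integrable functions\<close>

definition sq_int :: "'a measure \<Rightarrow> ('a \<Rightarrow> 'b::euclidean_space) \<Rightarrow> bool" where
  "sq_int M f \<longleftrightarrow> f \<in> borel_measurable M \<and> integrable M (\<lambda>x. (norm (f x))\<^sup>2)"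

definition L2_norm :: "'a measure \<Rightarrow> ('a \<Rightarrow> 'b::euclidean_space) \<Rightarrow> real" where
  "L2_norm M f = sqrt (LINT x|M. (norm (f x))\<^sup>2)"

lemma L2_eq_sq_int: "f \<in> L2 D \<longleftrightarrow> sq_int (lebesgue_on D) f"
  by (simp add: L2_def sq_int_def)

lemma sq_int_measurable: "sq_int M f \<Longrightarrow> f \<in> borel_measurable M"
  by (simp add: sq_int_def)

lemma L2_norm_nonneg [simp]: "0 \<le> L2_norm M f"
  by (simp add: L2_norm_def)

lemma L2_norm_sq: "(L2_norm M f)\<^sup>2 = (LINT x|M. (norm (f x))\<^sup>2)"
  by (simp add: L2_norm_def)

lemma sq_int_inner:
  assumes "sq_int M f" "sq_int M g" shows "integrable M (\<lambda>x. f x \<bullet> g x)"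
proof (rule Bochner_Integration.integrable_bound)
  show "integrable M (\<lambda>x. (norm (f x))\<^sup>2 + (norm (g x))\<^sup>2)"
    using assms by (auto simp: sq_int_def)
  show "(\<lambda>x. f x \<bullet> g x) \<in> borel_measurable M"
    using assms by (auto simp: sq_int_def)
  have "\<bar>a \<bullet> b\<bar> \<le> (norm a)\<^sup>2 + (norm b)\<^sup>2" for a b :: 'b
  proof -
    have "\<bar>a \<bullet> b\<bar> \<le> norm a * norm b" by (rule Cauchy_Schwarz_ineq2)
    also have "\<dots> \<le> (norm a)\<^sup>2 + (norm b)\<^sup>2"
      using sum_squares_bound[of "norm a" "norm b"] mult_nonneg_nonneg[OF norm_ge_zero[of a] norm_ge_zero[of b]]
      by linarith
    finally show ?thesis .
  qed
  then show "AE x in M. norm (f x \<bullet> g x) \<le> norm ((norm (f x))\<^sup>2 + (norm (g x))\<^sup>2)" by simp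
qed

lemma sq_int_linear:
  assumes "sq_int M f" "sq_int M g" shows "sq_int M (\<lambda>x. a *\<^sub>R f x + b *\<^sub>R g x)"
proof -
  have "integrable M (\<lambda>x. a\<^sup>2 * (f x \<bullet> f x) + 2 * a * b * (f x \<bullet> g x) + b\<^sup>2 * (g x \<bullet> g x))"
    using assms by (intro Bochner_Integration.integrable_add integrable_mult_right sq_int_inner)
  moreover have "(norm (a *\<^sub>R f x + b *\<^sub>R g x))\<^sup>2 =
      a\<^sup>2 * (f x \<bullet> f x) + 2 * a * b * (f x \<bullet> g x) + b\<^sup>2 * (g x \<bullet> g x)" for x
    unfolding power2_norm_eq_inner
    by (simp add: inner_add_left inner_add_right inner_commute power2_eq_square algebra_simps)
  ultimately show ?thesis using assms by (auto simp: sq_int_def)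
qed

lemma sq_int_diff: "sq_int M f \<Longrightarrow> sq_int M g \<Longrightarrow> sq_int M (\<lambda>x. f x - g x)"
  using sq_int_linear[of M f g 1 "-1"] by simp
lemma sq_int_scale: "sq_int M f \<Longrightarrow> sq_int M (\<lambda>x. a *\<^sub>R f x)"
  using sq_int_linear[of M f f a 0] by simp

lemma L2_norm_linear_sq:
  assumes "sq_int M f" "sq_int M g"
  shows "(L2_norm M (\<lambda>x. a *\<^sub>R f x + b *\<^sub>R g x))\<^sup>2 =
    a\<^sup>2 * (L2_norm M f)\<^sup>2 + 2 * a * b * (LINT x|M. f x \<bullet> g x) + b\<^sup>2 * (L2_norm M g)\<^sup>2"
proof -
  have "(norm (a *\<^sub>R f x + b *\<^sub>R g x))\<^sup>2 =
      a\<^sup>2 * (f x \<bullet> f x) + 2 * a * b * (f x \<bullet> g x) + b\<^sup>2 * (g x \<bullet> g x)" for x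
    unfolding power2_norm_eq_inner
    by (simp add: inner_add_left inner_add_right inner_commute power2_eq_square algebra_simps)
  then show ?thesis using assms sq_int_inner[OF assms] sq_int_inner[OF assms(1,1)] sq_int_inner[OF assms(2,2)]
    by (simp add: L2_norm_sq power2_norm_eq_inner)
qed

lemma L2_norm_diff_sq:
  assumes "sq_int M f" "sq_int M g"
  shows "(L2_norm M (\<lambda>x. f x - g x))\<^sup>2 =
    (L2_norm M f)\<^sup>2 - 2 * (LINT x|M. f x \<bullet> g x) + (L2_norm M g)\<^sup>2"
  using L2_norm_linear_sq[OF assms, of 1 "-1"] by simp

lemma Cauchy_Schwarz_L2:
  assumes "sq_int M f" "sq_int M g"
  shows "\<bar>LINT x|M. f x \<bullet> g x\<bar> \<le> L2_norm M f * L2_norm M g"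
proof -
  let ?A = "(L2_norm M f)\<^sup>2" and ?B = "(L2_norm M g)\<^sup>2" and ?C = "LINT x|M. f x \<bullet> g x"
  have q: "0 \<le> t\<^sup>2 * ?A + 2 * t * ?C + ?B" for t
    using zero_le_power2[of "L2_norm M (\<lambda>x. t *\<^sub>R f x + 1 *\<^sub>R g x)"]
    unfolding L2_norm_linear_sq[OF assms] by simp
  have "?C\<^sup>2 \<le> ?A * ?B"
  proof (cases "?A = 0")
    case True
    have "?C = 0"
    proof (rule ccontr)
      assume "?C \<noteq> 0"
      then have "2 * ((- ?B - 1) / (2 * ?C)) * ?C = - ?B - 1" by simp
      then show False using q[of "(- ?B - 1) / (2 * ?C)"] unfolding True by linarith
    qed
    then show ?thesis using True by simp
  next
    case False
    then have A: "?A > 0" by (simp add: zero_less_power2)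
    have "0 \<le> (- ?C / ?A)\<^sup>2 * ?A + 2 * (- ?C / ?A) * ?C + ?B" by (rule q)
    also have "\<dots> = ?B - ?C\<^sup>2 / ?A" using A by (simp add: field_simps power2_eq_square)
    finally show ?thesis using A by (simp add: field_simps)
  qed
  then have "\<bar>?C\<bar> \<le> sqrt (?A * ?B)" by (metis real_sqrt_abs real_sqrt_le_iff)
  then show ?thesis using L2_norm_nonneg[of M f] L2_norm_nonneg[of M g] by (simp add: real_sqrt_mult)
qed

lemma L2_norm_triangle:
  assumes "sq_int M f" "sq_int M g"
  shows "L2_norm M (\<lambda>x. f x + g x) \<le> L2_norm M f + L2_norm M g"
proof -
  have "(L2_norm M (\<lambda>x. f x + g x))\<^sup>2 \<le> (L2_norm M f + L2_norm M g)\<^sup>2"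
    using L2_norm_linear_sq[OF assms, of 1 1] Cauchy_Schwarz_L2[OF assms]
    by (simp add: power2_sum)
  then show ?thesis using L2_norm_nonneg by (meson add_nonneg_nonneg power2_le_imp_le)
qed

lemma L2_norm_scale: "L2_norm M (\<lambda>x. a *\<^sub>R f x) = \<bar>a\<bar> * L2_norm M f"
  by (simp add: L2_norm_def power_mult_distrib real_sqrt_mult)

lemma L2_norm_minus_commute: "L2_norm M (\<lambda>x. f x - g x) = L2_norm M (\<lambda>x. g x - f x)"
  by (simp add: L2_norm_def norm_minus_commute)

lemma L2_norm_triangle_diff:
  assumes "sq_int M f" "sq_int M g" "sq_int M h"
  shows "L2_norm M (\<lambda>x. f x - h x) \<le> L2_norm M (\<lambda>x. f x - g x) + L2_norm M (\<lambda>x. g x - h x)"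
  using L2_norm_triangle[OF sq_int_diff[OF assms(1,2)] sq_int_diff[OF assms(2,3)]] by simp

lemma L2_norm_AE_cong:
  assumes "AE x in M. f x = g x" "f \<in> borel_measurable M" "g \<in> borel_measurable M"
  shows "L2_norm M f = L2_norm M g"
  unfolding L2_norm_def using assms
  by (intro arg_cong[where f=sqrt] integral_cong_AE) auto

lemma sq_int_AE_cong:
  assumes "AE x in M. f x = g x" "g \<in> borel_measurable M" "sq_int M f"
  shows "sq_int M g"
  using assms unfolding sq_int_def
  by (auto intro!: integrable_cong_AE_imp[where g="\<lambda>x. (norm (f x))\<^sup>2"])

lemma L2_norm_0_AE:
  assumes "sq_int M f" "L2_norm M f = 0" shows "AE x in M. f x = 0"
proof -
  have "(LINT x|M. (norm (f x))\<^sup>2) = 0" using assms(2) by (simp add: L2_norm_def)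
  then have "AE x in M. (norm (f x))\<^sup>2 = 0"
    using assms(1) by (subst (asm) integral_nonneg_eq_0_iff_AE) (auto simp: sq_int_def)
  then show ?thesis by simp
qed

lemma sq_int_bounded:
  assumes "finite_measure M" "f \<in> borel_measurable M" "AE x in M. norm (f x) \<le> B"
  shows "sq_int M f"
  unfolding sq_int_def
proof
  interpret finite_measure M by fact
  have "AE x in M. norm ((norm (f x))\<^sup>2) \<le> B\<^sup>2"
    using assms(3) by eventually_elim (auto intro: power_mono)
  then show "integrable M (\<lambda>x. (norm (f x))\<^sup>2)"
    using assms(2) by (intro integrable_const_bound[of _ "B\<^sup>2"]) auto
qed (use assms in auto)

lemma sq_int_integrable:
  fixes f :: "'a \<Rightarrow> 'b::euclidean_space"
  assumes "finite_measure M" "sq_int M f"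
  shows "integrable M f" "(LINT x|M. norm (f x)) \<le> sqrt (measure M (space M)) * L2_norm M f"
proof -
  interpret finite_measure M by fact
  have n: "sq_int M (\<lambda>x. norm (f x))" using assms(2) by (auto simp: sq_int_def)
  have 1: "sq_int M (\<lambda>x. 1::real)" by (simp add: sq_int_def)
  have "integrable M (\<lambda>x. 1 \<bullet> norm (f x))" using 1 n by (rule sq_int_inner)
  then show "integrable M f"
    using assms(2) by (simp add: sq_int_def integrable_norm_iff)
  have "(LINT x|M. 1 \<bullet> norm (f x)) \<le> L2_norm M (\<lambda>x. 1::real) * L2_norm M (\<lambda>x. norm (f x))"
    using Cauchy_Schwarz_L2[OF 1 n] by linarith
  then show "(LINT x|M. norm (f x)) \<le> sqrt (measure M (space M)) * L2_norm M f"
    by (simp add: L2_norm_def)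
qed

definition L2_lim :: "'a measure \<Rightarrow> (nat \<Rightarrow> 'a \<Rightarrow> 'b::euclidean_space) \<Rightarrow> ('a \<Rightarrow> 'b) \<Rightarrow> bool" where
  "L2_lim M F f \<longleftrightarrow> (\<forall>k. sq_int M (F k)) \<and> sq_int M f \<and> (\<lambda>k. L2_norm M (\<lambda>x. F k x - f x)) \<longlonglongrightarrow> 0"

lemma L2_lim_const: "sq_int M f \<Longrightarrow> L2_lim M (\<lambda>k. f) f"
  by (simp add: L2_lim_def L2_norm_def)

lemma L2_lim_linear:
  assumes "L2_lim M F f" "L2_lim M G g"
  shows "L2_lim M (\<lambda>k x. a *\<^sub>R F k x + b *\<^sub>R G k x) (\<lambda>x. a *\<^sub>R f x + b *\<^sub>R g x)"
proof -
  have F: "sq_int M (F k)" "sq_int M (G k)" and f: "sq_int M f" "sq_int M g" for k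
    using assms by (auto simp: L2_lim_def)
  have "(\<lambda>k. L2_norm M (\<lambda>x. (a *\<^sub>R F k x + b *\<^sub>R G k x) - (a *\<^sub>R f x + b *\<^sub>R g x))) \<longlonglongrightarrow> 0"
  proof (rule real_tendsto_sandwich[OF _ _ tendsto_const])
    have "L2_norm M (\<lambda>x. (a *\<^sub>R F k x + b *\<^sub>R G k x) - (a *\<^sub>R f x + b *\<^sub>R g x))
       \<le> \<bar>a\<bar> * L2_norm M (\<lambda>x. F k x - f x) + \<bar>b\<bar> * L2_norm M (\<lambda>x. G k x - g x)" for k
    proof -
      have "(\<lambda>x. (a *\<^sub>R F k x + b *\<^sub>R G k x) - (a *\<^sub>R f x + b *\<^sub>R g x)) =
        (\<lambda>x. a *\<^sub>R (F k x - f x) + b *\<^sub>R (G k x - g x))" by (auto simp: algebra_simps)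
      then show ?thesis
        using L2_norm_triangle[OF sq_int_scale[where a=a, OF sq_int_diff[OF F(1) f(1)]]
              sq_int_scale[where a=b, OF sq_int_diff[OF F(2) f(2)]]] by (simp add: L2_norm_scale)
    qed
    then show "\<forall>\<^sub>F k in sequentially. L2_norm M (\<lambda>x. (a *\<^sub>R F k x + b *\<^sub>R G k x) - (a *\<^sub>R f x + b *\<^sub>R g x))
       \<le> \<bar>a\<bar> * L2_norm M (\<lambda>x. F k x - f x) + \<bar>b\<bar> * L2_norm M (\<lambda>x. G k x - g x)" by simp
    show "(\<lambda>k. \<bar>a\<bar> * L2_norm M (\<lambda>x. F k x - f x) + \<bar>b\<bar> * L2_norm M (\<lambda>x. G k x - g x)) \<longlonglongrightarrow> 0"
      using assms by (auto simp: L2_lim_def intro!: tendsto_eq_intros)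
  qed (simp add: L2_norm_nonneg)
  then show ?thesis using F f by (auto simp: L2_lim_def intro: sq_int_linear)
qed

lemma L2_lim_diff: "L2_lim M F f \<Longrightarrow> L2_lim M G g \<Longrightarrow> L2_lim M (\<lambda>k x. F k x - G k x) (\<lambda>x. f x - g x)"
  using L2_lim_linear[of M F f G g 1 "-1"] by simp

lemma L2_lim_norm:
  assumes "L2_lim M F f" shows "(\<lambda>k. L2_norm M (F k)) \<longlonglongrightarrow> L2_norm M f"
proof (rule Lim_transform2[OF tendsto_const], rule Lim_null_comparison)
  have F: "sq_int M (F k)" and f: "sq_int M f" for k using assms by (auto simp: L2_lim_def)
  have "\<bar>L2_norm M f - L2_norm M (F k)\<bar> \<le> L2_norm M (\<lambda>x. F k x - f x)" for k
    using L2_norm_triangle[OF f sq_int_diff[OF F f], of k] L2_norm_triangle[OF F sq_int_diff[OF f F], of k k]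
    by (simp add: L2_norm_minus_commute[of M f])
  then show "\<forall>\<^sub>F k in sequentially. norm (L2_norm M f - L2_norm M (F k)) \<le> L2_norm M (\<lambda>x. F k x - f x)"
    by simp
qed (use assms in \<open>simp add: L2_lim_def\<close>)

lemma L2_lim_inner:
  assumes "L2_lim M F f" "L2_lim M G g"
  shows "(\<lambda>k. LINT x|M. F k x \<bullet> G k x) \<longlonglongrightarrow> (LINT x|M. f x \<bullet> g x)"
proof -
  have F: "sq_int M (F k)" "sq_int M (G k)" and f: "sq_int M f" "sq_int M g" for k
    using assms by (auto simp: L2_lim_def)
  have *: "(LINT x|M. F k x \<bullet> G k x) =
     ((L2_norm M (\<lambda>x. 1 *\<^sub>R F k x + 1 *\<^sub>R G k x))\<^sup>2 - (L2_norm M (F k))\<^sup>2 - (L2_norm M (G k))\<^sup>2) / 2" for k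
    using L2_norm_linear_sq[OF F, of 1 k 1] by simp
  have **: "(LINT x|M. f x \<bullet> g x) =
     ((L2_norm M (\<lambda>x. 1 *\<^sub>R f x + 1 *\<^sub>R g x))\<^sup>2 - (L2_norm M f)\<^sup>2 - (L2_norm M g)\<^sup>2) / 2"
    using L2_norm_linear_sq[OF f, of 1 1] by simp
  show ?thesis unfolding * **
    by (intro tendsto_intros L2_lim_norm L2_lim_linear assms) auto
qed

text \<open>Riesz and Fischer's theorem: a subsequence with summable increments converges almost
  everywhere, and Fatou's lemma identifies the limit in the mean.\<close>
lemma L2_complete:
  fixes F :: "nat \<Rightarrow> 'a \<Rightarrow> 'b::euclidean_space"
  assumes M: "finite_measure M" and F: "\<And>k. sq_int M (F k)"
    and C: "\<And>e. 0 < e \<Longrightarrow> \<exists>N. \<forall>m\<ge>N. \<forall>n\<ge>N. L2_norm M (\<lambda>x. F m x - F n x) < e"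
  obtains f where "L2_lim M F f"
proof -
  interpret finite_measure M by fact
  have [measurable]: "F k \<in> borel_measurable M" for k using F by (simp add: sq_int_def)
  have "\<exists>N. \<forall>m\<ge>N. \<forall>n\<ge>N. L2_norm M (\<lambda>x. F m x - F n x) < (1/2) ^ k" for k
    by (rule C) simp
  then obtain N where N: "\<And>k m n. m \<ge> N k \<Longrightarrow> n \<ge> N k \<Longrightarrow> L2_norm M (\<lambda>x. F m x - F n x) < (1/2) ^ k"
    by metis
  define s where "s k = Max (N ` {..k}) + k" for k
  have sN: "s k \<ge> N k" for k unfolding s_def by (intro trans_le_add1 Max_ge) auto
  have s_mono: "s k \<le> s (Suc k)" for k unfolding s_def by (intro add_mono Max_mono) auto
  have s_ge: "k \<le> s k" for k by (simp add: s_def)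
  have d: "L2_norm M (\<lambda>x. F (s (Suc k)) x - F (s k) x) < (1/2) ^ k" for k
    by (intro N) (use sN s_mono in \<open>auto intro: order_trans\<close>)
  let ?g = "\<lambda>k x. norm (F (s (Suc k)) x - F (s k) x)"
  let ?c = "sqrt (measure M (space M))"
  have gi: "integrable M (?g k)" "(LINT x|M. ?g k x) \<le> ?c * (1/2) ^ k" for k
  proof -
    note sq = sq_int_diff[OF F[of "s (Suc k)"] F[of "s k"]]
    show "integrable M (?g k)" using sq_int_integrable(1)[OF M sq] by simp
    have "(LINT x|M. ?g k x) \<le> ?c * L2_norm M (\<lambda>x. F (s (Suc k)) x - F (s k) x)"
      by (rule sq_int_integrable(2)[OF M sq])
    also have "\<dots> \<le> ?c * (1/2) ^ k" using d[of k] by (intro mult_left_mono) auto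
    finally show "(LINT x|M. ?g k x) \<le> ?c * (1/2) ^ k" .
  qed
  have "(\<integral>\<^sup>+ x. (\<Sum>k. ennreal (?g k x)) \<partial>M) = (\<Sum>k. \<integral>\<^sup>+ x. ennreal (?g k x) \<partial>M)"
    by (intro nn_integral_suminf) auto
  also have "\<dots> = (\<Sum>k. ennreal (LINT x|M. ?g k x))"
    using gi(1) by (simp add: nn_integral_eq_integral)
  also have "\<dots> \<le> (\<Sum>k. ennreal (?c * (1/2) ^ k))"
    using gi(2) by (intro suminf_le) (auto intro: ennreal_leI)
  also have "\<dots> = ennreal (\<Sum>k. ?c * (1/2) ^ k)"
    by (intro suminf_ennreal2) (auto intro!: summable_mult summable_geometric)
  also have "\<dots> < \<infinity>" by simp
  finally have "(\<integral>\<^sup>+ x. (\<Sum>k. ennreal (?g k x)) \<partial>M) \<noteq> \<infinity>" by auto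
  then have "AE x in M. (\<Sum>k. ennreal (?g k x)) \<noteq> \<infinity>"
    by (intro nn_integral_PInf_AE) auto
  then have ae: "AE x in M. convergent (\<lambda>k. F (s k) x)"
  proof eventually_elim
    case (elim x)
    then have "summable (\<lambda>k. ?g k x)"
      by (intro summable_suminf_not_top) auto
    then have "summable (\<lambda>k. F (s (Suc k)) x - F (s k) x)" by (rule summable_norm_cancel)
    moreover have "(\<lambda>n. \<Sum>k<n. F (s (Suc k)) x - F (s k) x) = (\<lambda>n. F (s n) x - F (s 0) x)"
      by (rule ext) (rule sum_lessThan_telescope)
    ultimately show ?case by (simp add: summable_iff_convergent convergent_diff_const_right_iff)
  qed
  define f where "f x = lim (\<lambda>k. F (s k) x)" for x
  have [measurable]: "f \<in> borel_measurable M"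
    unfolding f_def by (intro borel_measurable_lim_metric) auto
  have lim: "AE x in M. (\<lambda>k. F (s k) x) \<longlonglongrightarrow> f x"
    using ae by eventually_elim (simp add: f_def convergent_LIMSEQ_iff)
  have key: "sq_int M (\<lambda>x. F n x - f x) \<and> L2_norm M (\<lambda>x. F n x - f x) \<le> (1/2) ^ k" if n: "n \<ge> N k" for n k
  proof -
    have "(\<integral>\<^sup>+ x. ennreal ((norm (F n x - f x))\<^sup>2) \<partial>M) =
        (\<integral>\<^sup>+ x. liminf (\<lambda>j. ennreal ((norm (F n x - F (s j) x))\<^sup>2)) \<partial>M)"
    proof (rule nn_integral_cong_AE)
      show "AE x in M. ennreal ((norm (F n x - f x))\<^sup>2) = liminf (\<lambda>j. ennreal ((norm (F n x - F (s j) x))\<^sup>2))"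
        using lim
      proof eventually_elim
        case (elim x)
        have "(\<lambda>j. ennreal ((norm (F n x - F (s j) x))\<^sup>2)) \<longlonglongrightarrow> ennreal ((norm (F n x - f x))\<^sup>2)"
          by (intro tendsto_intros elim)
        then show ?case by (rule lim_imp_Liminf[OF trivial_limit_sequentially, symmetric])
      qed
    qed
    also have "\<dots> \<le> liminf (\<lambda>j. \<integral>\<^sup>+ x. ennreal ((norm (F n x - F (s j) x))\<^sup>2) \<partial>M)"
      by (intro nn_integral_liminf) auto
    also have "\<dots> \<le> ennreal (((1/2) ^ k)\<^sup>2)"
    proof (rule Liminf_le)
      have "(\<integral>\<^sup>+ x. ennreal ((norm (F n x - F (s j) x))\<^sup>2) \<partial>M) \<le> ennreal (((1/2) ^ k)\<^sup>2)" if "j \<ge> N k" for j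
      proof -
        have "(\<integral>\<^sup>+ x. ennreal ((norm (F n x - F (s j) x))\<^sup>2) \<partial>M) = ennreal ((L2_norm M (\<lambda>x. F n x - F (s j) x))\<^sup>2)"
          using sq_int_diff[OF F F] by (simp add: sq_int_def nn_integral_eq_integral L2_norm_sq)
        also have "\<dots> \<le> ennreal (((1/2) ^ k)\<^sup>2)"
          using N[OF n, of "s j"] that s_ge[of j] L2_norm_nonneg by (intro ennreal_leI power_mono) auto
        finally show ?thesis .
      qed
      then show "\<forall>\<^sub>F j in sequentially. (\<integral>\<^sup>+ x. ennreal ((norm (F n x - F (s j) x))\<^sup>2) \<partial>M) \<le> ennreal (((1/2) ^ k)\<^sup>2)"
        by (auto simp: eventually_sequentially)
    qed simp
    finally have le: "(\<integral>\<^sup>+ x. ennreal ((norm (F n x - f x))\<^sup>2) \<partial>M) \<le> ennreal (((1/2) ^ k)\<^sup>2)" .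
    then have int: "integrable M (\<lambda>x. (norm (F n x - f x))\<^sup>2)"
      by (intro integrableI_nonneg) (auto intro: le_less_trans)
    have "(LINT x|M. (norm (F n x - f x))\<^sup>2) \<le> ((1/2) ^ k)\<^sup>2"
      using le int by (subst (asm) nn_integral_eq_integral) (auto simp: ennreal_le_iff)
    then have "L2_norm M (\<lambda>x. F n x - f x) \<le> (1/2) ^ k"
      unfolding L2_norm_def by (intro real_le_lsqrt) auto
    then show ?thesis using int by (simp add: sq_int_def)
  qed
  have "sq_int M f" using sq_int_diff[OF F[of "N 0"] conjunct1[OF key[of 0 "N 0"]]] by simp
  moreover have "(\<lambda>k. L2_norm M (\<lambda>x. F k x - f x)) \<longlonglongrightarrow> 0"
  proof (rule LIMSEQ_I)
    fix r :: real assume "0 < r"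
    then obtain k where "(1/2) ^ k < r" using real_arch_pow_inv[of r "1/2"] by auto
    then have "\<forall>n\<ge>N k. norm (L2_norm M (\<lambda>x. F n x - f x) - 0) < r"
      using key L2_norm_nonneg by (smt (verit) real_norm_def)
    then show "\<exists>no. \<forall>n\<ge>no. norm (L2_norm M (\<lambda>x. F n x - f x) - 0) < r" by blast
  qed
  ultimately show ?thesis using that F by (auto simp: L2_lim_def)
qed

section \<open>Uniqueness of weak gradients\<close>

lemma integrable_lebesgue_on_subset:
  fixes f :: "real^'n \<Rightarrow> 'b::euclidean_space"
  assumes "integrable (lebesgue_on D) f" "K \<subseteq> D" "K \<in> sets lebesgue" "D \<in> sets lebesgue"
  shows "integrable (lebesgue_on K) f"
proof -
  have "integrable lebesgue (\<lambda>x. indicator D x *\<^sub>R f x)"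
    using assms by (subst (asm) integrable_restrict_space) auto
  then have "integrable lebesgue (\<lambda>x. indicator K x *\<^sub>R (indicator D x *\<^sub>R f x))"
    using assms(3) by (rule integrable_mult_indicator[rotated])
  also have "(\<lambda>x. indicator K x *\<^sub>R (indicator D x *\<^sub>R f x)) = (\<lambda>x. indicator K x *\<^sub>R f x)"
    using assms(2) by (intro ext) (auto simp: indicator_def)
  finally show ?thesis using assms(3) by (subst integrable_restrict_space) auto
qed

lemma locally_integrable_times_test:
  assumes f: "locally_integrable D f" and \<phi>: "\<phi> \<in> test_functions D" and D: "D \<in> sets lebesgue"
  shows "integrable (lebesgue_on D) (\<lambda>x. f x * \<phi> x)"
proof -
  obtain K where K: "compact K" "K \<subseteq> D" "\<And>x. x \<notin> K \<Longrightarrow> \<phi> x = 0"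
    using test_support[OF \<phi>] by metis
  have Ks: "K \<in> sets lebesgue" using K(1) by (simp add: borel_compact)
  obtain B where B: "\<And>x. \<bar>\<phi> x\<bar> \<le> B" using test_bounded[OF \<phi>] by metis
  have fK: "integrable (lebesgue_on K) f" using f K by (simp add: locally_integrable_def)
  have "integrable (lebesgue_on K) (\<lambda>x. f x * \<phi> x)"
  proof (rule Bochner_Integration.integrable_bound)
    show "integrable (lebesgue_on K) (\<lambda>x. B * \<bar>f x\<bar>)" using fK by simp
    show "(\<lambda>x. f x * \<phi> x) \<in> borel_measurable (lebesgue_on K)"
      using fK borel_measurable_lebesgue_on[OF smooth_measurable[OF test_smooth[OF \<phi>]]] by auto
    show "AE x in lebesgue_on K. norm (f x * \<phi> x) \<le> norm (B * \<bar>f x\<bar>)"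
      using B abs_ge_zero[THEN order_trans, OF B]
      by (intro AE_I2) (auto simp: abs_mult mult.commute intro!: mult_right_mono)
  qed
  then have "integrable lebesgue (\<lambda>x. indicator K x *\<^sub>R (f x * \<phi> x))"
    using Ks by (subst (asm) integrable_restrict_space) auto
  also have "(\<lambda>x. indicator K x *\<^sub>R (f x * \<phi> x)) = (\<lambda>x. indicator D x *\<^sub>R (f x * \<phi> x))"
    using K by (intro ext) (auto simp: indicator_def)
  finally show ?thesis using D by (subst integrable_restrict_space) auto
qed

lemma flat_exp_0_lim: "(\<lambda>k. flat_exp 0 (real (Suc k) * s)) \<longlonglongrightarrow> (if 0 < s then 1 else 0)"
proof (cases "0 < s")
  case True
  have "(\<lambda>k. exp (- (inverse (real (Suc k)) / s))) \<longlonglongrightarrow> exp (- (0 / s))"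
    using True by (intro tendsto_intros LIMSEQ_inverse_real_of_nat) auto
  moreover have "flat_exp 0 (real (Suc k) * s) = exp (- (inverse (real (Suc k)) / s))" for k
    using True by (simp add: flat_exp_def zero_less_mult_iff divide_simps)
  ultimately show ?thesis using True by simp
qed (auto simp: flat_exp_def zero_less_mult_iff intro!: tendsto_eventually always_eventually)

lemma flat_exp_0_le_1: "flat_exp 0 s \<le> 1"
  using flat_exp_bound[of 0 s] by simp

text \<open>The function \<open>flat_exp 0 (k s)\<close> tends to the indicator of \<open>s > 0\<close> as \<open>k\<close> grows; multiply
  these over the faces of the box.\<close>
lemma test_functions_approx_box:
  fixes a b :: "real^'n"
  assumes "cbox a b \<subseteq> D"
  obtains \<phi> where "\<And>k::nat. \<phi> k \<in> test_functions D" "\<And>k x. 0 \<le> \<phi> k x" "\<And>k x. \<phi> k x \<le> indicator (cbox a b) x"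
    "\<And>x. (\<lambda>k. \<phi> k x) \<longlonglongrightarrow> indicator (box a b) x"
proof
  define \<phi> where "\<phi> k x = (\<Prod>i\<in>UNIV. flat_exp 0 (real (Suc k) * (x $ i - a $ i)) * flat_exp 0 (real (Suc k) * (b $ i - x $ i)))"
    for k and x :: "real^'n"
  have 0: "\<phi> k x = 0" if "x \<notin> cbox a b" for k x
  proof -
    obtain i where "x $ i < a $ i \<or> b $ i < x $ i" using \<open>x \<notin> cbox a b\<close> by (auto simp: mem_box_cart not_le)
    then have "flat_exp 0 (real (Suc k) * (x $ i - a $ i)) * flat_exp 0 (real (Suc k) * (b $ i - x $ i)) = 0"
      by (auto simp: flat_exp_def zero_less_mult_iff)
    then show ?thesis unfolding \<phi>_def by (intro prod_zero) auto
  qed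
  have "smooth (\<phi> k)" for k
    unfolding \<phi>_def by (intro smooth_prod smooth_mult smooth_flat_exp smooth_diff smooth_nth smooth_const)
  then show "\<phi> k \<in> test_functions D" for k
    using 0 assms by (intro test_functionsI[of _ "cbox a b"]) auto
  show "0 \<le> \<phi> k x" for k x
    unfolding \<phi>_def by (intro prod_nonneg ballI mult_nonneg_nonneg flat_exp_nonneg)
  have "\<phi> k x \<le> 1" for k x
    unfolding \<phi>_def by (intro prod_le_1 conjI mult_nonneg_nonneg mult_le_one flat_exp_nonneg flat_exp_0_le_1)
  then show "\<phi> k x \<le> indicator (cbox a b) x" for k x
    using 0[of x k] by (auto simp: indicator_def)
  show "(\<lambda>k. \<phi> k x) \<longlonglongrightarrow> indicator (box a b) x" for x
  proof -
    have "(\<lambda>k. \<phi> k x) \<longlonglongrightarrow> (\<Prod>i\<in>UNIV. (if 0 < x $ i - a $ i then 1 else 0) * (if 0 < b $ i - x $ i then 1 else 0))"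
      unfolding \<phi>_def by (intro tendsto_prod tendsto_mult flat_exp_0_lim)
    also have "(\<Prod>i\<in>UNIV. (if 0 < x $ i - a $ i then 1 else 0) * (if 0 < b $ i - x $ i then 1 else 0)) = (indicator (box a b) x :: real)"
    proof (cases "x \<in> box a b")
      case True
      then show ?thesis by (simp add: mem_box_cart)
    next
      case False
      then obtain i where "\<not> (a $ i < x $ i \<and> x $ i < b $ i)" by (auto simp: mem_box_cart)
      then have "(\<Prod>i\<in>UNIV. (if 0 < x $ i - a $ i then 1 else 0) * (if 0 < b $ i - x $ i then 1 else 0)) = (0::real)"
        by (intro prod_zero) auto
      then show ?thesis using False by simp
    qed
    finally show ?thesis .
  qed
qed

text \<open>Boxes form an intersection-stable generator of the Borel sets, and vanishing of the integral
  passes to complements and disjoint unions.\<close>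
lemma AE_zero_if_box_integrals_zero:
  fixes h :: "real^'n \<Rightarrow> real"
  assumes h: "integrable lebesgue h" and z: "\<And>a b. (LINT x|lebesgue. indicator (box a b) x * h x) = 0"
  shows "AE x in lebesgue. h x = 0"
proof -
  obtain h' where h'[measurable]: "h' \<in> borel_measurable lborel" and ae: "AE x in lborel. h x = h' x"
    using completion_ex_borel_measurable_real[OF borel_measurable_integrable[OF h]] by auto
  have ae': "AE x in lebesgue. h x = h' x" using ae by (rule AE_completion)
  have "integrable lebesgue h'"
    by (rule integrable_cong_AE_imp[OF h _ ae']) (simp add: measurable_completion)
  then have int: "integrable lborel h'" by (subst (asm) integrable_completion) auto
  have z': "(LINT x:box a b|lborel. h' x) = 0" for a b
  proof -
    have "(LINT x:box a b|lborel. h' x) = (LINT x|lebesgue. indicator (box a b) x * h' x)"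
      unfolding set_lebesgue_integral_def by (subst integral_completion) auto
    also have "\<dots> = (LINT x|lebesgue. indicator (box a b) x * h x)"
    proof (rule integral_cong_AE)
      show "(\<lambda>x. indicator (box a b) x * h' x) \<in> borel_measurable lebesgue"
        by (intro borel_measurable_times borel_measurable_indicator) (auto simp: measurable_completion)
      show "(\<lambda>x. indicator (box a b) x * h x) \<in> borel_measurable lebesgue"
        by (rule borel_measurable_times[OF borel_measurable_indicator borel_measurable_integrable[OF h]]) auto
      show "AE x in lebesgue. indicator (box a b) x * h' x = indicator (box a b) x * h x"
        using ae' by eventually_elim simp
    qed
    finally show ?thesis using z by simp
  qed
  have si: "set_integrable lborel A h'" if "A \<in> sets borel" for A
    using integrable_mult_indicator[of A lborel h'] int that by (simp add: set_integrable_def)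
  have whole: "(LINT x|lborel. h' x) = 0"
  proof -
    have "(\<lambda>k. LINT x|lborel. indicator (box (-(\<chi> i. real k)) (\<chi> i. real k)) x *\<^sub>R h' x) \<longlonglongrightarrow> (LINT x|lborel. h' x)"
    proof (rule integral_dominated_convergence[where w="\<lambda>x. \<bar>h' x\<bar>"])
      show "AE x in lborel. (\<lambda>k. indicator (box (-(\<chi> i. real k)) (\<chi> i. real k)) x *\<^sub>R h' x) \<longlonglongrightarrow> h' x"
      proof (rule AE_I2)
        fix x :: "real^'n"
        obtain N :: nat where "norm x < real N" using reals_Archimedean2 by blast
        then have "x \<in> box (-(\<chi> i. real k)) (\<chi> i. real k)" if "k \<ge> N" for k
          using component_le_norm_cart[of x] that by (auto simp: mem_box_cart) (smt (verit) of_nat_le_iff)+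
        then show "(\<lambda>k. indicator (box (-(\<chi> i. real k)) (\<chi> i. real k)) x *\<^sub>R h' x) \<longlonglongrightarrow> h' x"
          by (intro tendsto_eventually eventually_sequentiallyI[of N]) simp
      qed
    qed (use int in \<open>auto simp: indicator_def\<close>)
    then show ?thesis using z' by (simp add: set_lebesgue_integral_def LIMSEQ_const_iff)
  qed
  let ?G = "range (\<lambda>(a, b). box a b :: (real^'n) set)"
  have "(LINT x:A|lborel. h' x) = 0" if "A \<in> sets borel" for A
  proof -
    have A: "A \<in> sigma_sets UNIV ?G" using that by (subst (asm) borel_eq_box) simp
    have bor: "B \<in> sets borel" if "B \<in> sigma_sets UNIV ?G" for B
      using that by (subst borel_eq_box) simp
    have "Int_stable ?G" by (auto simp: Int_stable_def box_Int_box)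
    moreover have "?G \<subseteq> Pow UNIV" by simp
    ultimately show ?thesis using A
    proof (induction rule: sigma_sets_induct_disjoint)
      case (compl B)
      have "(LINT x:-B|lborel. h' x) + (LINT x:B|lborel. h' x) = (LINT x:(- B) \<union> B|lborel. h' x)"
        using si bor[OF compl(1)] by (intro set_integral_Un[symmetric]) auto
      also have "\<dots> = 0" using whole by (simp add: set_lebesgue_integral_def)
      finally show ?case using compl by (simp add: Compl_eq_Diff_UNIV)
    next
      case (union B)
      have "B i \<in> sets lborel" for i using union(2) bor by auto
      then have "(LINT x:(\<Union>i. B i)|lborel. h' x) = (\<Sum>i. (LINT x:(B i)|lborel. h' x))"
        using union(1) si by (intro lebesgue_integral_countable_add) (auto simp: disjoint_family_on_def)
      then show ?case using union(3) by simp
    qed (use z' in \<open>auto simp: set_lebesgue_integral_def\<close>)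
  qed
  then have "AE x in lborel. h' x = 0"
    using int by (intro density_unique_real) (auto simp: set_lebesgue_integral_def)
  then have "AE x in lebesgue. h' x = 0" by (rule AE_completion)
  with ae' show ?thesis by eventually_elim simp
qed

text \<open>The fundamental lemma of the calculus of variations, by approximation of box indicators.\<close>
lemma AE_zero_if_orthogonal_to_test_functions:
  fixes h :: "real^'n \<Rightarrow> real"
  assumes D: "open D" and h: "locally_integrable D h"
    and z: "\<And>\<phi>. \<phi> \<in> test_functions D \<Longrightarrow> (LINT x|lebesgue_on D. h x * \<phi> x) = 0"
  shows "AE x in lebesgue_on D. h x = 0"
proof -
  have Ds: "D \<in> sets lebesgue" using D by simp
  have box0: "(LINT x|lebesgue. indicator (box a b) x * h x) = 0" if ab: "cbox a b \<subseteq> D" for a b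
  proof -
    obtain \<phi> where \<phi>: "\<And>k::nat. \<phi> k \<in> test_functions D" "\<And>k x. 0 \<le> \<phi> k x"
      "\<And>k x. \<phi> k x \<le> indicator (cbox a b) x" "\<And>x. (\<lambda>k. \<phi> k x) \<longlonglongrightarrow> indicator (box a b) x"
      using test_functions_approx_box[OF ab] by metis
    have \<phi>m: "\<phi> k \<in> borel_measurable lebesgue" for k
      using smooth_measurable[OF test_smooth[OF \<phi>(1)]] by (simp add: measurable_completion)
    have "integrable (lebesgue_on (cbox a b)) h"
      using h ab by (simp add: locally_integrable_def)
    then have int: "integrable lebesgue (\<lambda>x. indicator (cbox a b) x * h x)"
      by (subst (asm) integrable_restrict_space) auto
    then have hm: "(\<lambda>x. indicator (cbox a b) x * h x) \<in> borel_measurable lebesgue"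
      by (rule borel_measurable_integrable)
    have m: "(\<lambda>x. indicator (box a b) x * (indicator (cbox a b) x * h x)) \<in> borel_measurable lebesgue"
      by (rule borel_measurable_times[OF borel_measurable_indicator hm]) auto
    have e: "indicator (box a b) x * (indicator (cbox a b) x * h x) = indicator (box a b) x * h x" for x
      using box_subset_cbox[of a b] by (auto simp: indicator_def)
    have 0: "\<phi> k x = 0" if "x \<notin> cbox a b" for k x using \<phi>(2,3)[of k x] that by simp
    then have eq: "\<phi> k x * h x = \<phi> k x * (indicator (cbox a b) x * h x)" for k x
      by (cases "x \<in> cbox a b") auto
    have "(\<lambda>k. LINT x|lebesgue. \<phi> k x * h x) \<longlonglongrightarrow> (LINT x|lebesgue. indicator (box a b) x * h x)"
    proof (rule integral_dominated_convergence)
      show "integrable lebesgue (\<lambda>x. \<bar>indicator (cbox a b) x * h x\<bar>)" using int by simp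
      show "(\<lambda>x. \<phi> k x * h x) \<in> borel_measurable lebesgue" for k
        unfolding eq by (rule borel_measurable_times[OF \<phi>m hm])
      show "(\<lambda>x. indicator (box a b) x * h x) \<in> borel_measurable lebesgue" using m unfolding e .
      show "AE x in lebesgue. (\<lambda>k. \<phi> k x * h x) \<longlonglongrightarrow> indicator (box a b) x * h x"
        by (intro AE_I2 tendsto_intros \<phi>)
      show "AE x in lebesgue. norm (\<phi> k x * h x) \<le> \<bar>indicator (cbox a b) x * h x\<bar>" for k
        using \<phi>(2,3) by (intro AE_I2) (auto simp: abs_mult intro!: mult_right_mono)
    qed
    moreover have "(LINT x|lebesgue. \<phi> k x * h x) = 0" for k
    proof -
      have "(LINT x|lebesgue. \<phi> k x * h x) = (LINT x|lebesgue. indicator D x *\<^sub>R (h x * \<phi> k x))"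
        using test_outside[OF \<phi>(1)] by (intro Bochner_Integration.integral_cong) (auto simp: indicator_def)
      also have "\<dots> = 0" using z[OF \<phi>(1)] Ds by (subst (asm) integral_restrict_space) auto
      finally show ?thesis .
    qed
    ultimately show ?thesis by (simp add: LIMSEQ_const_iff)
  qed
  have ae: "AE x in lebesgue. x \<in> cbox a b \<longrightarrow> h x = 0" if ab: "cbox a b \<subseteq> D" for a b
  proof -
    have "integrable (lebesgue_on (cbox a b)) h"
      using h ab by (simp add: locally_integrable_def)
    then have "integrable lebesgue (\<lambda>x. indicator (box a b) x *\<^sub>R (indicator (cbox a b) x * h x))"
      by (intro integrable_mult_indicator) (auto simp: integrable_restrict_space)
    also have "(\<lambda>x. indicator (box a b) x *\<^sub>R (indicator (cbox a b) x * h x)) = (\<lambda>x. indicator (box a b) x * h x)"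
      using box_subset_cbox[of a b] by (intro ext) (auto simp: indicator_def)
    finally have "AE x in lebesgue. indicator (box a b) x * h x = 0"
    proof (rule AE_zero_if_box_integrals_zero)
      fix c d
      obtain p q where pq: "box c d \<inter> box a b = box p q" using box_Int_box by blast
      have "(LINT x|lebesgue. indicator (box c d) x * (indicator (box a b) x * h x)) =
        (LINT x|lebesgue. indicator (box p q) x * h x)"
        unfolding pq[symmetric] by (simp add: indicator_inter_arith mult.assoc)
      also have "\<dots> = 0"
      proof (cases "box p q = {}")
        case False
        then have "cbox p q \<subseteq> closure (box a b)"
          using pq by (metis Int_lower2 closure_box closure_mono)
        also have "\<dots> \<subseteq> D" using ab by (meson box_subset_cbox closed_cbox closure_minimal order_trans)
        finally show ?thesis by (rule box0)
      qed simp
      finally show "(LINT x|lebesgue. indicator (box c d) x * (indicator (box a b) x * h x)) = 0" .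
    qed
    moreover have "AE x in lebesgue. x \<notin> cbox a b - box a b"
      using negligible_frontier_interval[of a b] by (intro AE_not_in) (simp add: negligible_iff_null_sets)
    ultimately show ?thesis by eventually_elim (auto simp: indicator_def split: if_splits)
  qed
  obtain \<D> where \<D>: "countable \<D>" "\<And>X. X \<in> \<D> \<Longrightarrow> \<exists>a b. X = cbox a b" "\<Union>\<D> = D"
    using open_countable_Union_open_cbox[OF D] by metis
  have "AE x in lebesgue. x \<in> X \<longrightarrow> h x = 0" if "X \<in> \<D>" for X
    using \<D>(2)[OF that] ae \<D>(3) that by blast
  then have "AE x in lebesgue. \<forall>X\<in>\<D>. x \<in> X \<longrightarrow> h x = 0" 
    using AE_ball_countable[OF \<D>(1), of "\<lambda>x X. x \<in> X \<longrightarrow> h x = 0"] by blast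
  then have "AE x in lebesgue. x \<in> D \<longrightarrow> h x = 0"
    by eventually_elim (use \<D>(3) in auto)
  then show ?thesis using Ds by (simp add: AE_restrict_space_iff)
qed

lemma locally_integrable_nth: "locally_integrable D g \<Longrightarrow> locally_integrable D (\<lambda>x. g x $ i)"
  unfolding locally_integrable_def
  using integrable_bounded_linear[OF bounded_linear_vec_nth] by blast

lemma weak_gradient_unique:
  assumes D: "open D" and g: "has_weak_gradient D u g" and g': "has_weak_gradient D u g'"
  shows "AE x in lebesgue_on D. g x = g' x"
proof -
  have Ds: "D \<in> sets lebesgue" using D by simp
  have "AE x in lebesgue_on D. g x $ i - g' x $ i = 0" for i
  proof (rule AE_zero_if_orthogonal_to_test_functions[OF D])
    have li: "locally_integrable D (\<lambda>x. g x $ i)" "locally_integrable D (\<lambda>x. g' x $ i)"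
      using g g' by (auto simp: has_weak_gradient_def intro: locally_integrable_nth)
    then show "locally_integrable D (\<lambda>x. g x $ i - g' x $ i)"
      by (auto simp: locally_integrable_def)
    fix \<phi> assume \<phi>: "\<phi> \<in> test_functions D"
    then show "(LINT x|lebesgue_on D. (g x $ i - g' x $ i) * \<phi> x) = 0"
      using g g' locally_integrable_times_test[OF li(1) \<phi> Ds] locally_integrable_times_test[OF li(2) \<phi> Ds]
      by (simp add: has_weak_gradient_def left_diff_distrib)
  qed
  then have "AE x in lebesgue_on D. \<forall>i\<in>UNIV. g x $ i - g' x $ i = 0"
    by (intro AE_finite_allI) auto
  then show ?thesis by eventually_elim (simp add: vec_eq_iff)
qed

text \<open>The weak gradient is an arbitrary choice among almost everywhere equal functions, so its
  measurability comes from completeness of Lebesgue measure.\<close>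
lemma lebesgue_on_measurable_AE_cong:
  fixes f g :: "real^'n \<Rightarrow> 'b::euclidean_space"
  assumes f: "f \<in> borel_measurable (lebesgue_on D)" and ae: "AE x in lebesgue_on D. f x = g x"
    and D: "D \<in> sets lebesgue"
  shows "g \<in> borel_measurable (lebesgue_on D)"
proof -
  have "(\<lambda>x. if x \<in> D then f x else 0) \<in> borel_measurable lebesgue"
    using f D by (simp add: borel_measurable_if)
  moreover have "AE x in lebesgue. (if x \<in> D then f x else 0) = (if x \<in> D then g x else 0)"
    using ae D by (simp add: AE_restrict_space_iff) 
  ultimately have "(\<lambda>x. if x \<in> D then g x else 0) \<in> borel_measurable lebesgue"
    by (rule borel_measurable_AE)
  then show ?thesis using D by (simp add: borel_measurable_if)
qed

section \<open>The Dirichlet problem\<close>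

lemma L2_norm_mono:
  assumes "AE x in M. norm (f x) \<le> c * norm (g x)" "0 \<le> c" "f \<in> borel_measurable M" "sq_int M g"
  shows "sq_int M f" "L2_norm M f \<le> c * L2_norm M g"
proof -
  have le: "AE x in M. (norm (f x))\<^sup>2 \<le> c\<^sup>2 * (norm (g x))\<^sup>2"
    using assms(1) by eventually_elim (metis norm_ge_zero power_mono power_mult_distrib)
  have int: "integrable M (\<lambda>x. c\<^sup>2 * (norm (g x))\<^sup>2)" using assms(4) by (simp add: sq_int_def)
  then show sq: "sq_int M f"
    unfolding sq_int_def using assms(3) le
    by (auto intro!: Bochner_Integration.integrable_bound[OF int])
  have "(LINT x|M. (norm (f x))\<^sup>2) \<le> (LINT x|M. c\<^sup>2 * (norm (g x))\<^sup>2)"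
    using sq int le by (intro integral_mono_AE) (auto simp: sq_int_def)
  then have "(L2_norm M f)\<^sup>2 \<le> (c * L2_norm M g)\<^sup>2"
    by (simp add: L2_norm_sq power_mult_distrib)
  then show "L2_norm M f \<le> c * L2_norm M g"
    by (rule power2_le_imp_le) (simp add: assms(2))
qed

lemma L2_lim_nonneg:
  fixes F :: "nat \<Rightarrow> 'a \<Rightarrow> real"
  assumes F: "L2_lim M F f" and nn: "\<And>k. AE x in M. 0 \<le> F k x"
  shows "AE x in M. 0 \<le> f x"
proof -
  have sq: "sq_int M (F k)" "sq_int M f" for k using F by (auto simp: L2_lim_def)
  have m: "(\<lambda>x. min (f x) 0) \<in> borel_measurable M" using sq(2) by (auto simp: sq_int_def)
  have le: "AE x in M. norm (min (f x) 0) \<le> 1 * norm (F k x - f x)" for k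
    using nn[of k] by eventually_elim auto
  note mono = L2_norm_mono[OF le _ m sq_int_diff[OF sq]]
  have "L2_norm M (\<lambda>x. min (f x) 0) \<le> 0"
  proof (rule LIMSEQ_le_const)
    show "(\<lambda>k. L2_norm M (\<lambda>x. F k x - f x)) \<longlonglongrightarrow> 0" using F by (simp add: L2_lim_def)
    show "\<exists>N. \<forall>n\<ge>N. L2_norm M (\<lambda>x. min (f x) 0) \<le> L2_norm M (\<lambda>x. F n x - f x)"
      using mono(2) by auto
  qed
  then have "AE x in M. min (f x) 0 = 0"
    using mono(1) by (intro L2_norm_0_AE order_antisym) simp_all
  then show ?thesis by eventually_elim (simp add: min_def split: if_splits)
qed

lemma has_weak_gradient_diff:
  assumes D: "D \<in> sets lebesgue" and u: "has_weak_gradient D u g" and v: "has_weak_gradient D v h"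
  shows "has_weak_gradient D (\<lambda>x. u x - v x) (\<lambda>x. g x - h x)"
proof -
  have li: "locally_integrable D u" "locally_integrable D v" "locally_integrable D g" "locally_integrable D h"
    using u v by (auto simp: has_weak_gradient_def)
  have "(LINT x|lebesgue_on D. (u x - v x) * partial_deriv i \<phi> x)
      = - (LINT x|lebesgue_on D. (g x - h x) $ i * \<phi> x)" if \<phi>: "\<phi> \<in> test_functions D" for \<phi> i
    using u v \<phi> locally_integrable_times_test[OF li(1) test_partial_deriv[OF \<phi>] D, of i]
      locally_integrable_times_test[OF li(2) test_partial_deriv[OF \<phi>] D, of i]
      locally_integrable_times_test[OF locally_integrable_nth[OF li(3)] \<phi> D, of i]
      locally_integrable_times_test[OF locally_integrable_nth[OF li(4)] \<phi> D, of i]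
    by (simp add: has_weak_gradient_def left_diff_distrib)
  moreover have "locally_integrable D (\<lambda>x. u x - v x)" "locally_integrable D (\<lambda>x. g x - h x)"
    using li by (auto simp: locally_integrable_def)
  ultimately show ?thesis by (simp add: has_weak_gradient_def)
qed

lemma nonneg_if_quadratic_nonneg:
  fixes a b :: real
  assumes "\<And>t. 0 < t \<Longrightarrow> 0 \<le> t * a + t\<^sup>2 * b"
  shows "0 \<le> a"
proof (rule tendsto_lowerbound)
  show "((\<lambda>t. a + t * b) \<longlongrightarrow> a) (at_right 0)" by (auto intro!: tendsto_eq_intros)
  show "\<forall>\<^sub>F t in at_right 0. 0 \<le> a + t * b"
    unfolding eventually_at_right_field
  proof (intro exI[of _ 1] conjI allI impI)
    fix t :: real assume "0 < t"
    then have "0 \<le> t * (a + t * b)" using assms[of t] by (simp add: power2_eq_square algebra_simps)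
    then show "0 \<le> a + t * b" using \<open>0 < t\<close> by (simp add: zero_le_mult_iff)
  qed simp
qed simp

text \<open>A substitute for the positive part that keeps test functions smooth and compactly supported. It
  vanishes for \<open>s \<le> 0\<close>, and a truncation does not increase the gradient because the slope
  lies between \<open>0\<close> and \<open>1\<close>.\<close>
definition smooth_pos_part :: "real \<Rightarrow> real \<Rightarrow> real" where
  "smooth_pos_part \<epsilon> s = s * flat_exp 0 (1 / \<epsilon> * s)"

lemma smooth_pos_part:
  assumes "0 < \<epsilon>"
  shows "0 \<le> smooth_pos_part \<epsilon> s" "s - \<epsilon> \<le> smooth_pos_part \<epsilon> s" "s \<le> 0 \<Longrightarrow> smooth_pos_part \<epsilon> s = 0"
proof -
  show "s \<le> 0 \<Longrightarrow> smooth_pos_part \<epsilon> s = 0" "0 \<le> smooth_pos_part \<epsilon> s"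
    using assms by (auto simp: smooth_pos_part_def flat_exp_def zero_less_divide_iff)
  show "s - \<epsilon> \<le> smooth_pos_part \<epsilon> s"
  proof (cases "0 < s")
    case True
    have "s * (1 + (- (\<epsilon> / s))) \<le> s * exp (- (\<epsilon> / s))"
      using True by (intro mult_left_mono exp_ge_add_one_self) auto
    moreover have "s * (1 + (- (\<epsilon> / s))) = s - \<epsilon>" using True by (simp add: field_simps)
    moreover have "smooth_pos_part \<epsilon> s = s * exp (- (\<epsilon> / s))"
      using True assms by (simp add: smooth_pos_part_def flat_exp_def)
    ultimately show ?thesis by simp
  qed (use assms in \<open>simp add: smooth_pos_part_def flat_exp_def zero_less_divide_iff\<close>)
qed

lemma smooth_pos_part_deriv:
  assumes "0 < \<epsilon>"
  obtains d where "(smooth_pos_part \<epsilon> has_real_derivative d) (at s)" "\<bar>d\<bar> \<le> 1"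
proof
  let ?\<tau> = "1 / \<epsilon> * s"
  \<comment> \<open>For \<open>s > 0\<close> and \<open>q = \<epsilon> / s\<close> this is \<open>exp (- q) * (1 + q)\<close>.\<close>
  let ?d = "flat_exp 0 ?\<tau> + ?\<tau> * flat_exp 2 ?\<tau>"
  have "((\<lambda>s. s * flat_exp 0 (1 / \<epsilon> * s)) has_real_derivative
      1 * flat_exp 0 ?\<tau> + s * ((flat_exp (0 + 2) ?\<tau> - real 0 * flat_exp (0 + 1) ?\<tau>) * (1 / \<epsilon>))) (at s)"
    by (rule derivative_eq_intros refl DERIV_chain'[OF _ flat_exp_deriv] DERIV_cmult_Id)+ (simp add: mult.commute)
  then show "(smooth_pos_part \<epsilon> has_real_derivative ?d) (at s)"
    unfolding smooth_pos_part_def[abs_def] by (simp add: mult.commute mult.left_commute numeral_2_eq_2)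
  show "\<bar>?d\<bar> \<le> 1"
  proof (cases "0 < ?\<tau>")
    case True
    have "?d = exp (- (1 / ?\<tau>)) * (1 + 1 / ?\<tau>)"
      using True by (simp add: flat_exp_def power2_eq_square algebra_simps)
    also have "\<dots> \<le> exp (- (1 / ?\<tau>)) * exp (1 / ?\<tau>)"
      by (intro mult_left_mono exp_ge_add_one_self) auto
    also have "\<dots> = 1" by (simp add: exp_minus)
    finally have "?d \<le> 1" .
    moreover have "0 \<le> ?d" by (intro add_nonneg_nonneg flat_exp_nonneg mult_nonneg_nonneg[OF less_imp_le[OF True]])
    ultimately show ?thesis by linarith
  qed (simp add: flat_exp_def)
qed

lemma smooth_smooth_pos_part: "smooth f \<Longrightarrow> smooth (\<lambda>x. smooth_pos_part \<epsilon> (f x))"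
  unfolding smooth_pos_part_def by (intro smooth_mult smooth_flat_exp smooth_cmult)

lemma norm_grad_smooth_pos_part_le:
  assumes "0 < \<epsilon>" "smooth f"
  shows "norm (grad (\<lambda>x. smooth_pos_part \<epsilon> (f x)) x) \<le> norm (grad f x)"
proof -
  obtain d where d: "(smooth_pos_part \<epsilon> has_real_derivative d) (at (f x))" "\<bar>d\<bar> \<le> 1"
    using smooth_pos_part_deriv[OF assms(1)] by blast
  show ?thesis using d(2) grad_chain[OF d(1) assms(2)] by (simp add: mult_left_le_one_le)
qed

locale bounded_domain =
  fixes D :: "(real^'n) set"
  assumes bounded_D: "bounded D" and open_D: "open D"
begin

abbreviation M where "M \<equiv> lebesgue_on D"

lemma D_sets [simp]: "D \<in> sets lebesgue" using open_D by simp

lemma D_lmeasurable: "D \<in> lmeasurable" using bounded_D open_D by (rule lmeasurable_open)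

lemma finite_M: "finite_measure M" using D_lmeasurable by (rule finite_measure_lebesgue_on)

sublocale finite_measure M by (rule finite_M)

lemma measure_M: "measure M (space M) = measure lebesgue D"
  by (simp add: measure_restrict_space)

lemma continuous_sq_int:
  fixes f :: "real^'n \<Rightarrow> 'b::euclidean_space"
  assumes "continuous_on UNIV f" shows "sq_int M f"
proof -
  have "compact (closure D)" using bounded_D by (simp add: compact_closure)
  then have "bounded (f ` closure D)"
    using assms by (intro compact_imp_bounded compact_continuous_image) (auto intro: continuous_on_subset)
  then obtain B where "\<And>x. x \<in> D \<Longrightarrow> norm (f x) \<le> B"
    using closure_subset[of D] by (auto simp: bounded_iff)
  then show ?thesis
    using assms by (intro sq_int_bounded[OF finite_M, of _ B] borel_measurable_lebesgue_on
        borel_measurable_continuous_onI AE_I2) auto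
qed

lemma smooth_sq_int: "smooth f \<Longrightarrow> sq_int M f" "smooth f \<Longrightarrow> sq_int M (grad f)"
  by (intro continuous_sq_int smooth_continuous grad_continuous; assumption)+

lemma test_sq_int: "\<phi> \<in> test_functions D \<Longrightarrow> sq_int M \<phi>" "\<phi> \<in> test_functions D \<Longrightarrow> sq_int M (grad \<phi>)"
  by (simp_all add: smooth_sq_int test_smooth)

lemma sq_int_const: "sq_int M (\<lambda>x. c)" by (intro continuous_sq_int continuous_intros)

lemma sq_int_locally_integrable: "sq_int M f \<Longrightarrow> locally_integrable D f"
  unfolding locally_integrable_def
  by (auto intro!: integrable_lebesgue_on_subset[OF sq_int_integrable(1)[OF finite_M]] simp: borel_compact)

text \<open>A limit of test functions together with the limit of their gradients, both in the mean:
  the elements of \<open>H10 D\<close> with their weak gradients.\<close>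
definition h10 :: "(real^'n \<Rightarrow> real) \<Rightarrow> (real^'n \<Rightarrow> real^'n) \<Rightarrow> bool" where
  "h10 u g \<longleftrightarrow> (\<exists>\<phi>. (\<forall>k. \<phi> k \<in> test_functions D) \<and> L2_lim M \<phi> u \<and> L2_lim M (\<lambda>k. grad (\<phi> k)) g)"

lemma h10_sq_int: "h10 u g \<Longrightarrow> sq_int M u" "h10 u g \<Longrightarrow> sq_int M g"
  by (auto simp: h10_def L2_lim_def)

lemma h10_test: "\<phi> \<in> test_functions D \<Longrightarrow> h10 \<phi> (grad \<phi>)"
  unfolding h10_def by (intro exI[of _ "\<lambda>k. \<phi>"]) (simp add: L2_lim_const test_sq_int)

lemma h10_linear:
  assumes "h10 u g" "h10 v h"
  shows "h10 (\<lambda>x. a * u x + b * v x) (\<lambda>x. a *\<^sub>R g x + b *\<^sub>R h x)"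
proof -
  obtain \<phi> \<eta> where
    \<phi>: "\<And>k. \<phi> k \<in> test_functions D" "L2_lim M \<phi> u" "L2_lim M (\<lambda>k. grad (\<phi> k)) g" and
    \<eta>: "\<And>k. \<eta> k \<in> test_functions D" "L2_lim M \<eta> v" "L2_lim M (\<lambda>k. grad (\<eta> k)) h"
    using assms unfolding h10_def by metis
  have "grad (\<lambda>x. a * \<phi> k x + b * \<eta> k x) = (\<lambda>x. a *\<^sub>R grad (\<phi> k) x + b *\<^sub>R grad (\<eta> k) x)" for k
    using \<phi>(1) \<eta>(1) by (intro ext grad_test_linear)
  then show ?thesis unfolding h10_def
    using L2_lim_linear[OF \<phi>(2) \<eta>(2), of a b] L2_lim_linear[OF \<phi>(3) \<eta>(3), of a b] \<phi>(1) \<eta>(1)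
    by (intro exI[of _ "\<lambda>k x. a * \<phi> k x + b * \<eta> k x"]) (simp add: test_linear)
qed

lemma h10_has_weak_gradient:
  assumes "h10 u g" shows "has_weak_gradient D u g"
proof -
  obtain \<phi> where \<phi>: "\<And>k. \<phi> k \<in> test_functions D" "L2_lim M \<phi> u" "L2_lim M (\<lambda>k. grad (\<phi> k)) g"
    using assms unfolding h10_def by metis
  have "(LINT x|M. u x * partial_deriv i \<eta> x) = - (LINT x|M. g x $ i * \<eta> x)"
    if \<eta>: "\<eta> \<in> test_functions D" for \<eta> i
  proof (rule LIMSEQ_unique)
    have ax: "sq_int M (\<lambda>x. \<eta> x *\<^sub>R axis i (1::real))"
      using smooth_continuous[OF test_smooth[OF \<eta>]] by (intro continuous_sq_int continuous_intros)
    have p: "sq_int M (partial_deriv i \<eta>)" using \<eta> by (intro test_sq_int test_partial_deriv)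
    show "(\<lambda>k. LINT x|M. \<phi> k x * partial_deriv i \<eta> x) \<longlonglongrightarrow> (LINT x|M. u x * partial_deriv i \<eta> x)"
      using L2_lim_inner[OF \<phi>(2) L2_lim_const[OF p]] by simp
    have "(LINT x|M. \<phi> k x * partial_deriv i \<eta> x) = - (LINT x|M. grad (\<phi> k) x \<bullet> (\<eta> x *\<^sub>R axis i 1))" for k
      using integration_by_parts[OF \<phi>(1)[of k] test_smooth[OF \<eta>] D_sets, of i]
      by (simp add: inner_axis mult.commute)
    then show "(\<lambda>k. LINT x|M. \<phi> k x * partial_deriv i \<eta> x) \<longlonglongrightarrow> - (LINT x|M. g x $ i * \<eta> x)"
      using tendsto_minus[OF L2_lim_inner[OF \<phi>(3) L2_lim_const[OF ax]]] by (simp add: inner_axis mult.commute)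
  qed
  then show ?thesis
    using h10_sq_int[OF assms] by (auto simp: has_weak_gradient_def sq_int_locally_integrable)
qed

lemma weak_grad_AE:
  assumes "has_weak_gradient D u g" "sq_int M g"
  shows "AE x in M. g x = weak_grad D u x" "weak_grad D u \<in> borel_measurable M" "sq_int M (weak_grad D u)"
proof -
  have "has_weak_gradient D u (weak_grad D u)"
    unfolding weak_grad_def by (rule someI[of "has_weak_gradient D u", OF assms(1)])
  then show ae: "AE x in M. g x = weak_grad D u x"
    by (rule weak_gradient_unique[OF open_D assms(1)])
  show m: "weak_grad D u \<in> borel_measurable M"
    by (rule lebesgue_on_measurable_AE_cong[OF sq_int_measurable[OF assms(2)] ae D_sets])
  show "sq_int M (weak_grad D u)" using ae m assms(2) by (rule sq_int_AE_cong)
qed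

lemma H1_norm_sq:
  assumes "has_weak_gradient D u g" "sq_int M g"
  shows "(H1_norm D u)\<^sup>2 = (L2_norm M u)\<^sup>2 + (L2_norm M g)\<^sup>2"
proof -
  have "L2_norm M (weak_grad D u) = L2_norm M g"
    using weak_grad_AE[OF assms] assms(2) by (intro L2_norm_AE_cong) (auto simp: sq_int_def)
  then have "(LINT x|M. (norm (weak_grad D u x))\<^sup>2) = (L2_norm M g)\<^sup>2"
    by (metis L2_norm_sq)
  moreover have "(LINT x|M. (u x)\<^sup>2) = (L2_norm M u)\<^sup>2" by (simp add: L2_norm_sq)
  ultimately show ?thesis by (simp add: H1_norm_def)
qed

text \<open>In both directions the norm of \<open>H1 D\<close> splits into the two mean square distances, since
  the gradient of the difference is the difference of the gradients.\<close>
lemma h10_iff_H10: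
  "u \<in> H10 D \<longleftrightarrow> (\<exists>g. h10 u g)"
proof
  assume "u \<in> H10 D"
  then have u: "sq_int M u" and "\<exists>g. sq_int M g \<and> has_weak_gradient D u g"
    and "\<exists>\<phi>. (\<forall>k. \<phi> k \<in> test_functions D) \<and> (\<lambda>k. H1_norm D (\<lambda>x. u x - \<phi> k x)) \<longlonglongrightarrow> 0"
    by (auto simp: H10_def H1_def L2_eq_sq_int)
  then obtain g and \<phi> :: "nat \<Rightarrow> real^'n \<Rightarrow> real" where g: "sq_int M g" "has_weak_gradient D u g"
    and \<phi>: "\<And>k. \<phi> k \<in> test_functions D" and lim: "(\<lambda>k. H1_norm D (\<lambda>x. u x - \<phi> k x)) \<longlonglongrightarrow> 0"
    by metis
  have eq: "(H1_norm D (\<lambda>x. u x - \<phi> k x))\<^sup>2 =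
      (L2_norm M (\<lambda>x. \<phi> k x - u x))\<^sup>2 + (L2_norm M (\<lambda>x. grad (\<phi> k) x - g x))\<^sup>2" for k
    using H1_norm_sq[OF has_weak_gradient_diff[OF D_sets g(2) h10_has_weak_gradient[OF h10_test[OF \<phi>]]]
        sq_int_diff[OF g(1) test_sq_int(2)[OF \<phi>]], of k]
    by (simp add: L2_norm_minus_commute[of M u] L2_norm_minus_commute[of M g])
  have nn: "0 \<le> H1_norm D v" for v :: "real^'n \<Rightarrow> real" by (simp add: H1_norm_def)
  have le1: "L2_norm M (\<lambda>x. \<phi> k x - u x) \<le> H1_norm D (\<lambda>x. u x - \<phi> k x)" for k
    by (rule power2_le_imp_le[OF _ nn]) (simp add: eq)
  have le2: "L2_norm M (\<lambda>x. grad (\<phi> k) x - g x) \<le> H1_norm D (\<lambda>x. u x - \<phi> k x)" for k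
    by (rule power2_le_imp_le[OF _ nn]) (simp add: eq)
  have "(\<lambda>k. L2_norm M (\<lambda>x. \<phi> k x - u x)) \<longlonglongrightarrow> 0" "(\<lambda>k. L2_norm M (\<lambda>x. grad (\<phi> k) x - g x)) \<longlonglongrightarrow> 0"
    by (rule Lim_null_comparison[OF always_eventually lim]; simp add: le1 le2)+
  then have "L2_lim M \<phi> u" "L2_lim M (\<lambda>k. grad (\<phi> k)) g"
    using u g(1) test_sq_int(1)[OF \<phi>] test_sq_int(2)[OF \<phi>] by (simp_all add: L2_lim_def)
  then show "\<exists>g. h10 u g" using \<phi> unfolding h10_def by blast
next
  assume "\<exists>g. h10 u g"
  then obtain g where h: "h10 u g" ..
  then obtain \<phi> where \<phi>: "\<And>k. \<phi> k \<in> test_functions D" "L2_lim M \<phi> u" "L2_lim M (\<lambda>k. grad (\<phi> k)) g"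
    unfolding h10_def by metis
  note u = h10_sq_int[OF h] h10_has_weak_gradient[OF h]
  have eq: "(H1_norm D (\<lambda>x. u x - \<phi> k x))\<^sup>2 =
      (L2_norm M (\<lambda>x. \<phi> k x - u x))\<^sup>2 + (L2_norm M (\<lambda>x. grad (\<phi> k) x - g x))\<^sup>2" for k
    using H1_norm_sq[OF has_weak_gradient_diff[OF D_sets u(3) h10_has_weak_gradient[OF h10_test[OF \<phi>(1)]]]
        sq_int_diff[OF u(2) test_sq_int(2)[OF \<phi>(1)]], of k]
    by (simp add: L2_norm_minus_commute[of M u] L2_norm_minus_commute[of M g])
  have nn: "0 \<le> H1_norm D v" for v :: "real^'n \<Rightarrow> real" by (simp add: H1_norm_def)
  have "(\<lambda>k. sqrt ((H1_norm D (\<lambda>x. u x - \<phi> k x))\<^sup>2)) \<longlonglongrightarrow> sqrt (0\<^sup>2 + 0\<^sup>2)"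
    unfolding eq using \<phi> by (intro tendsto_intros) (auto simp: L2_lim_def)
  then have "(\<lambda>k. H1_norm D (\<lambda>x. u x - \<phi> k x)) \<longlonglongrightarrow> 0" using nn by simp
  then show "u \<in> H10 D" using u \<phi>(1) by (auto simp: H10_def H1_def L2_eq_sq_int)
qed

text \<open>Weak solutions together with their gradient, tested against test functions only. This form is
  linear in all three arguments and free of the choice hidden in \<open>weak_grad\<close>.\<close>
definition wsol :: "(real^'n \<Rightarrow> real) \<Rightarrow> (real^'n \<Rightarrow> real) \<Rightarrow> (real^'n \<Rightarrow> real^'n) \<Rightarrow> bool" where
  "wsol f u g \<longleftrightarrow> sq_int M f \<and> h10 u g \<and>
     (\<forall>v\<in>test_functions D. (LINT x|M. g x \<bullet> grad v x) = (LINT x|M. f x * v x))"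

lemma wsol_h10: "wsol f u g \<Longrightarrow> h10 u g" by (simp add: wsol_def)
lemma wsol_sq_int: "wsol f u g \<Longrightarrow> sq_int M f" "wsol f u g \<Longrightarrow> sq_int M u" "wsol f u g \<Longrightarrow> sq_int M g"
  by (auto simp: wsol_def dest: h10_sq_int)

lemma wsol_eq:
  assumes "wsol f u g" "h10 v h" shows "(LINT x|M. g x \<bullet> h x) = (LINT x|M. f x * v x)"
proof -
  obtain \<phi> where \<phi>: "\<And>k. \<phi> k \<in> test_functions D" "L2_lim M \<phi> v" "L2_lim M (\<lambda>k. grad (\<phi> k)) h"
    using assms unfolding h10_def by metis
  note sq = wsol_sq_int[OF assms(1)]
  have "(\<lambda>k. LINT x|M. g x \<bullet> grad (\<phi> k) x) \<longlonglongrightarrow> (LINT x|M. g x \<bullet> h x)"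
    by (rule L2_lim_inner[OF L2_lim_const[OF sq(3)] \<phi>(3)])
  moreover have "(LINT x|M. g x \<bullet> grad (\<phi> k) x) = (LINT x|M. f x \<bullet> \<phi> k x)" for k
    using assms(1) \<phi>(1) by (simp add: wsol_def)
  ultimately show ?thesis
    using L2_lim_inner[OF L2_lim_const[OF sq(1)] \<phi>(2)] by (simp add: LIMSEQ_unique)
qed

lemma weak_solution_iff_wsol:
  assumes f: "sq_int M f" shows "weak_solution D f u \<longleftrightarrow> (\<exists>g. wsol f u g)"
proof -
  have cong: "(LINT x|M. weak_grad D u x \<bullet> weak_grad D v x) = (LINT x|M. g x \<bullet> h x)"
    if "h10 u g" "h10 v h" for u v g h
  proof -
    note a = weak_grad_AE[OF h10_has_weak_gradient[OF that(1)] h10_sq_int(2)[OF that(1)]]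
    note b = weak_grad_AE[OF h10_has_weak_gradient[OF that(2)] h10_sq_int(2)[OF that(2)]]
    have "AE x in M. weak_grad D u x \<bullet> weak_grad D v x = g x \<bullet> h x"
      using a(1) b(1) by eventually_elim simp
    then show ?thesis using a(2) b(2) h10_sq_int[OF that(1)] h10_sq_int[OF that(2)]
      by (intro integral_cong_AE) (auto simp: sq_int_def)
  qed
  show ?thesis
  proof
    assume w: "weak_solution D f u"
    then obtain g where g: "h10 u g" by (auto simp: weak_solution_def h10_iff_H10)
    have "(LINT x|M. g x \<bullet> grad v x) = (LINT x|M. f x * v x)" if "v \<in> test_functions D" for v
    proof -
      have "v \<in> H10 D" using h10_test[OF that] h10_iff_H10 by blast
      then show ?thesis using w cong[OF g h10_test[OF that]] by (simp add: weak_solution_def)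
    qed
    then show "\<exists>g. wsol f u g" using f g by (auto simp: wsol_def)
  next
    assume "\<exists>g. wsol f u g"
    then obtain g where w: "wsol f u g" ..
    have "(LINT x|M. weak_grad D u x \<bullet> weak_grad D v x) = (LINT x|M. f x * v x)" if v: "v \<in> H10 D" for v
    proof -
      obtain h where h: "h10 v h" using v by (auto simp: h10_iff_H10)
      show ?thesis using cong[OF wsol_h10[OF w] h] wsol_eq[OF w h] by simp
    qed
    then show "weak_solution D f u" using wsol_h10[OF w] by (auto simp: weak_solution_def h10_iff_H10)
  qed
qed

lemma wsol_linear:
  assumes "wsol f u g" "wsol f' u' g'"
  shows "wsol (\<lambda>x. a * f x + b * f' x) (\<lambda>x. a * u x + b * u' x) (\<lambda>x. a *\<^sub>R g x + b *\<^sub>R g' x)"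
proof -
  note sq = wsol_sq_int[OF assms(1)] wsol_sq_int[OF assms(2)]
  have "(LINT x|M. (a *\<^sub>R g x + b *\<^sub>R g' x) \<bullet> grad v x) = (LINT x|M. (a * f x + b * f' x) * v x)"
    if v: "v \<in> test_functions D" for v
  proof -
    have i: "integrable M (\<lambda>x. g x \<bullet> grad v x)" "integrable M (\<lambda>x. g' x \<bullet> grad v x)"
      "integrable M (\<lambda>x. f x * v x)" "integrable M (\<lambda>x. f' x * v x)"
      using sq_int_inner[OF sq(3) test_sq_int(2)[OF v]] sq_int_inner[OF sq(6) test_sq_int(2)[OF v]]
        sq_int_inner[OF sq(1) test_sq_int(1)[OF v]] sq_int_inner[OF sq(4) test_sq_int(1)[OF v]] by simp_all
    have "(LINT x|M. (a *\<^sub>R g x + b *\<^sub>R g' x) \<bullet> grad v x)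
        = a * (LINT x|M. g x \<bullet> grad v x) + b * (LINT x|M. g' x \<bullet> grad v x)"
      using i by (simp add: inner_add_left)
    also have "\<dots> = a * (LINT x|M. f x * v x) + b * (LINT x|M. f' x * v x)"
      using assms v by (simp add: wsol_def)
    also have "\<dots> = (LINT x|M. (a * f x + b * f' x) * v x)"
      using i by (simp add: distrib_right mult.assoc)
    finally show ?thesis .
  qed
  then show ?thesis
    using h10_linear[OF wsol_h10[OF assms(1)] wsol_h10[OF assms(2)]] sq_int_linear[OF sq(1,4), of a b]
    by (simp add: wsol_def)
qed


text \<open>Integrate by parts in \<open>\<integral>\<phi>\<^sup>2 = \<integral>\<phi>\<^sup>2 \<partial>\<^sub>i x\<^sub>i\<close> and use that the coordinate
  \<open>x\<^sub>i\<close> is bounded on \<open>D\<close>.\<close>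
lemma Poincare_test:
  obtains C where "0 < C" "\<And>\<phi>. \<phi> \<in> test_functions D \<Longrightarrow> L2_norm M \<phi> \<le> C * L2_norm M (grad \<phi>)"
proof -
  obtain R where R: "0 < R" "\<And>x. x \<in> D \<Longrightarrow> norm x \<le> R"
    using bounded_D by (auto simp: bounded_pos)
  fix i :: 'n
  have "L2_norm M \<phi> \<le> (2 * R) * L2_norm M (grad \<phi>)" if \<phi>: "\<phi> \<in> test_functions D" for \<phi>
  proof (cases "L2_norm M \<phi> = 0")
    case False
    let ?w = "\<lambda>x. - 2 * (x $ i) * partial_deriv i \<phi> x"
    have sm: "smooth \<phi>" using \<phi> by (rule test_smooth)
    have w: "smooth ?w" by (intro smooth_mult smooth_const smooth_nth smooth_partial_deriv sm)
    have pd: "partial_deriv i (\<lambda>x. \<phi> x * \<phi> x) = (\<lambda>x. \<phi> x * partial_deriv i \<phi> x + partial_deriv i \<phi> x * \<phi> x)"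
      using smooth_differentiable[OF sm] by (intro ext partial_deriv_mult)
    have "\<phi> x \<bullet> ?w x = - (partial_deriv i (\<lambda>x. \<phi> x * \<phi> x) x * x $ i)" for x
      by (simp add: pd algebra_simps)
    then have "(LINT x|M. \<phi> x \<bullet> ?w x) = - (LINT x|M. partial_deriv i (\<lambda>x. \<phi> x * \<phi> x) x * x $ i)"
      by (simp only: Bochner_Integration.integral_minus)
    with integration_by_parts[OF test_mult_smooth[OF \<phi> sm] smooth_nth D_sets, of i i]
    have "(LINT x|M. \<phi> x * \<phi> x) = (LINT x|M. \<phi> x \<bullet> ?w x)"
      by (simp only: partial_deriv_nth refl if_True mult_1_right minus_minus)
    moreover have "(L2_norm M \<phi>)\<^sup>2 = (LINT x|M. \<phi> x * \<phi> x)"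
      by (subst L2_norm_sq) (simp add: power2_eq_square)
    ultimately have "(L2_norm M \<phi>)\<^sup>2 \<le> L2_norm M \<phi> * L2_norm M ?w"
      using Cauchy_Schwarz_L2[OF test_sq_int(1)[OF \<phi>] smooth_sq_int(1)[OF w]] by linarith
    then have "L2_norm M \<phi> \<le> L2_norm M ?w"
      using False by (simp add: power2_eq_square less_le)
    also have "\<dots> \<le> (2 * R) * L2_norm M (grad \<phi>)"
    proof (rule L2_norm_mono(2))
      show "AE x in M. norm (?w x) \<le> (2 * R) * norm (grad \<phi> x)"
      proof (rule AE_I2)
        fix x assume "x \<in> space M"
        then have "\<bar>x $ i\<bar> \<le> R" using R(2)[of x] component_le_norm_cart[of x i] by simp
        moreover have "\<bar>partial_deriv i \<phi> x\<bar> \<le> norm (grad \<phi> x)"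
          using component_le_norm_cart[of "grad \<phi> x" i] by simp
        ultimately have "\<bar>x $ i\<bar> * \<bar>partial_deriv i \<phi> x\<bar> \<le> R * norm (grad \<phi> x)"
          by (intro mult_mono) auto
        then show "norm (?w x) \<le> (2 * R) * norm (grad \<phi> x)" by (simp add: abs_mult)
      qed
      show "?w \<in> borel_measurable M" using smooth_sq_int(1)[OF w] by (rule sq_int_measurable)
    qed (use R test_sq_int(2)[OF \<phi>] in auto)
    finally show ?thesis .
  qed (use R in simp)
  then show ?thesis using that[of "2 * R"] R(1) by simp
qed

definition Poincare_const :: real where
  "Poincare_const = (SOME C. 0 < C \<and> (\<forall>\<phi>\<in>test_functions D. L2_norm M \<phi> \<le> C * L2_norm M (grad \<phi>)))"

lemma Poincare_const_pos: "0 < Poincare_const"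
  and Poincare_ineq_test: "\<phi> \<in> test_functions D \<Longrightarrow> L2_norm M \<phi> \<le> Poincare_const * L2_norm M (grad \<phi>)"
proof -
  have "\<exists>C. 0 < C \<and> (\<forall>\<phi>\<in>test_functions D. L2_norm M \<phi> \<le> C * L2_norm M (grad \<phi>))"
    using Poincare_test by metis
  from someI_ex[OF this] show "0 < Poincare_const" "\<phi> \<in> test_functions D \<Longrightarrow> L2_norm M \<phi> \<le> Poincare_const * L2_norm M (grad \<phi>)"
    by (auto simp: Poincare_const_def)
qed

lemma Poincare_h10:
  assumes "h10 u g" shows "L2_norm M u \<le> Poincare_const * L2_norm M g"
proof -
  obtain \<phi> where \<phi>: "\<And>k. \<phi> k \<in> test_functions D" "L2_lim M \<phi> u" "L2_lim M (\<lambda>k. grad (\<phi> k)) g"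
    using assms unfolding h10_def by metis
  show ?thesis
    by (rule LIMSEQ_le[OF L2_lim_norm[OF \<phi>(2)] tendsto_mult[OF tendsto_const L2_lim_norm[OF \<phi>(3)]]])
       (use Poincare_ineq_test \<phi>(1) in blast)
qed

lemma wsol_energy: "wsol f u g \<Longrightarrow> (L2_norm M g)\<^sup>2 = (LINT x|M. f x * u x)"
  using wsol_eq[OF _ wsol_h10] by (simp add: L2_norm_sq power2_norm_eq_inner)

text \<open>The energy identity and the Poincare inequality are used against each other: the norm of the
  gradient appears quadratically on the left and linearly on the right.\<close>
lemma wsol_bound:
  assumes w: "wsol f u g" shows "L2_norm M u \<le> Poincare_const\<^sup>2 * L2_norm M f"
proof -
  note sq = wsol_sq_int[OF w]
  have "(L2_norm M g)\<^sup>2 \<le> L2_norm M f * L2_norm M u"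
    using wsol_energy[OF w] Cauchy_Schwarz_L2[OF sq(1,2)] by simp
  also have "\<dots> \<le> L2_norm M f * (Poincare_const * L2_norm M g)"
    using Poincare_h10[OF wsol_h10[OF w]] by (intro mult_left_mono) auto
  finally have "L2_norm M g * L2_norm M g \<le> (Poincare_const * L2_norm M f) * L2_norm M g"
    by (simp add: power2_eq_square mult.assoc mult.commute mult.left_commute)
  then have "L2_norm M g \<le> Poincare_const * L2_norm M f"
    using Poincare_const_pos by (cases "L2_norm M g = 0") (auto simp: less_le mult_le_cancel_right)
  then have "Poincare_const * L2_norm M g \<le> Poincare_const * (Poincare_const * L2_norm M f)"
    using Poincare_const_pos by (intro mult_left_mono) auto
  then show ?thesis
    using Poincare_h10[OF wsol_h10[OF w]] by (simp add: power2_eq_square mult.assoc)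
qed

lemma wsol_unique:
  assumes "wsol f u g" "wsol f' u' g'" "AE x in M. f x = f' x"
  shows "AE x in M. u x = u' x"
proof -
  note w = wsol_linear[OF assms(1,2), of 1 "-1"]
  have "L2_norm M (\<lambda>x. 1 * f x + - 1 * f' x) = L2_norm M (\<lambda>x. 0::real)"
    using assms(3) wsol_sq_int(1)[OF w] by (intro L2_norm_AE_cong) (auto simp: sq_int_def)
  then have "L2_norm M (\<lambda>x. 1 * u x + - 1 * u' x) = 0"
    using wsol_bound[OF w] by (simp add: L2_norm_def[of M "\<lambda>x. 0"] order_antisym)
  from L2_norm_0_AE[OF wsol_sq_int(2)[OF w] this] show ?thesis by eventually_elim simp
qed

definition Dirichlet_energy :: "(real^'n \<Rightarrow> real) \<Rightarrow> (real^'n \<Rightarrow> real) \<Rightarrow> real" where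
  "Dirichlet_energy f \<phi> = (L2_norm M (grad \<phi>))\<^sup>2 / 2 - (LINT x|M. f x * \<phi> x)"

text \<open>Dirichlet's principle. The parallelogram law makes minimising sequences converge.\<close>
lemma wsol_exists:
  assumes f: "sq_int M f" obtains u g where "wsol f u g"
proof -
  let ?J = "Dirichlet_energy f"
  let ?T = "test_functions D"
  have fv: "integrable M (\<lambda>x. f x * \<phi> x)" if "\<phi> \<in> ?T" for \<phi>
    using sq_int_inner[OF f test_sq_int(1)[OF that]] by simp
  have Jadd: "?J (\<lambda>x. \<phi> x + t * v x) = ?J \<phi> + t * ((LINT x|M. grad \<phi> x \<bullet> grad v x) - (LINT x|M. f x * v x))
      + t\<^sup>2 * ((L2_norm M (grad v))\<^sup>2 / 2)" if "\<phi> \<in> ?T" "v \<in> ?T" for \<phi> v t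
  proof -
    have "grad (\<lambda>x. \<phi> x + t * v x) = (\<lambda>x. 1 *\<^sub>R grad \<phi> x + t *\<^sub>R grad v x)"
      using grad_test_linear[OF that, of 1 t] by (intro ext) simp
    then show ?thesis
      using L2_norm_linear_sq[OF test_sq_int(2)[OF that(1)] test_sq_int(2)[OF that(2)], of 1 t]
        fv[OF that(1)] fv[OF that(2)]
      by (simp add: Dirichlet_energy_def distrib_left mult.left_commute field_simps)
  qed
  have lower: "- (L2_norm M f * Poincare_const)\<^sup>2 / 2 \<le> ?J \<phi>" if "\<phi> \<in> ?T" for \<phi>
  proof -
    let ?s = "L2_norm M (grad \<phi>)" and ?a = "L2_norm M f * Poincare_const"
    have "(LINT x|M. f x * \<phi> x) \<le> L2_norm M f * L2_norm M \<phi>"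
      using Cauchy_Schwarz_L2[OF f test_sq_int(1)[OF that]] by simp
    also have "\<dots> \<le> ?a * ?s" using Poincare_ineq_test[OF that] by (simp add: mult.assoc mult_left_mono)
    finally have "?s\<^sup>2 / 2 - ?a * ?s \<le> ?J \<phi>" by (simp add: Dirichlet_energy_def)
    moreover have "0 \<le> (?s - ?a)\<^sup>2" by simp
    ultimately show ?thesis by (simp add: power2_diff algebra_simps)
  qed
  define m where "m = (INF \<phi>\<in>?T. ?J \<phi>)"
  have bdd: "bdd_below (?J ` ?T)" using lower by (auto intro!: bdd_belowI2)
  have m: "m \<le> ?J \<phi>" if "\<phi> \<in> ?T" for \<phi> unfolding m_def using bdd that by (rule cINF_lower)
  have "\<exists>\<phi>\<in>?T. ?J \<phi> < m + 1 / real (Suc k)" for k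
  proof -
    have "(INF \<phi>\<in>?T. ?J \<phi>) < m + 1 / real (Suc k)" by (simp add: m_def)
    then show ?thesis using test_zero bdd by (subst (asm) cINF_less_iff) auto
  qed
  then obtain \<phi> where \<phi>: "\<And>k. \<phi> k \<in> ?T" "\<And>k. ?J (\<phi> k) < m + 1 / real (Suc k)" by metis
  have Jlim: "(\<lambda>k. ?J (\<phi> k)) \<longlonglongrightarrow> m"
  proof (rule real_tendsto_sandwich)
    show "\<forall>\<^sub>F k in sequentially. m \<le> ?J (\<phi> k)" using m \<phi>(1) by simp
    show "\<forall>\<^sub>F k in sequentially. ?J (\<phi> k) \<le> m + 1 / real (Suc k)"
      using \<phi>(2) by (simp add: less_imp_le)
    show "(\<lambda>k. m + 1 / real (Suc k)) \<longlonglongrightarrow> m"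
      using tendsto_add[OF tendsto_const LIMSEQ_Suc[OF lim_1_over_n], of m] by simp
  qed simp
  have par: "(L2_norm M (\<lambda>x. grad (\<phi> j) x - grad (\<phi> k) x))\<^sup>2 \<le> 4 * (1 / real (Suc j) + 1 / real (Suc k))" for j k
  proof -
    let ?a = "grad (\<phi> j)" and ?b = "grad (\<phi> k)" and ?p = "\<lambda>x. 1/2 * \<phi> j x + 1/2 * \<phi> k x"
    note sq = test_sq_int(2)[OF \<phi>(1)[of j]] test_sq_int(2)[OF \<phi>(1)[of k]]
    have p: "?p \<in> ?T" by (intro test_linear \<phi>)
    have gp: "grad ?p = (\<lambda>x. (1/2) *\<^sub>R ?a x + (1/2) *\<^sub>R ?b x)"
      by (intro ext grad_test_linear[OF \<phi>(1) \<phi>(1)])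
    have "(LINT x|M. f x * ?p x) = (LINT x|M. f x * \<phi> j x) / 2 + (LINT x|M. f x * \<phi> k x) / 2"
      using fv[OF \<phi>(1)[of j]] fv[OF \<phi>(1)[of k]] by (simp add: distrib_left)
    then have "(L2_norm M (\<lambda>x. ?a x - ?b x))\<^sup>2 = 4 * (?J (\<phi> j) + ?J (\<phi> k) - 2 * ?J ?p)"
      unfolding Dirichlet_energy_def gp L2_norm_diff_sq[OF sq] L2_norm_linear_sq[OF sq]
      by (simp add: field_simps power2_eq_square)
    also have "\<dots> \<le> 4 * (1 / real (Suc j) + 1 / real (Suc k))"
      using \<phi>(2)[of j] \<phi>(2)[of k] m[OF p] by simp
    finally show ?thesis .
  qed
  have cauchy: "\<exists>N. \<forall>j\<ge>N. \<forall>k\<ge>N. L2_norm M (\<lambda>x. grad (\<phi> j) x - grad (\<phi> k) x) < e" if "0 < e" for e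
  proof -
    obtain N where N: "inverse (real (Suc N)) < e\<^sup>2 / 8"
      using reals_Archimedean[of "e\<^sup>2 / 8"] \<open>0 < e\<close> by auto
    have "L2_norm M (\<lambda>x. grad (\<phi> j) x - grad (\<phi> k) x) < e" if "j \<ge> N" "k \<ge> N" for j k
    proof (rule power2_less_imp_less)
      have "1 / real (Suc j) \<le> inverse (real (Suc N))" "1 / real (Suc k) \<le> inverse (real (Suc N))"
        using that by (simp_all add: inverse_eq_divide frac_le)
      then have "4 * (1 / real (Suc j) + 1 / real (Suc k)) \<le> 4 * (inverse (real (Suc N)) + inverse (real (Suc N)))"
        by (intro mult_left_mono add_mono) auto
      also have "\<dots> < 4 * (e\<^sup>2 / 8 + e\<^sup>2 / 8)"
        using N by (intro mult_strict_left_mono add_strict_mono) auto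
      finally show "(L2_norm M (\<lambda>x. grad (\<phi> j) x - grad (\<phi> k) x))\<^sup>2 < e\<^sup>2"
        using par[of j k] by simp
    qed (use \<open>0 < e\<close> in simp)
    then show ?thesis by blast
  qed
  obtain g where g: "L2_lim M (\<lambda>k. grad (\<phi> k)) g"
    by (rule L2_complete[OF finite_M test_sq_int(2)[OF \<phi>(1)] cauchy])
  have cauchy': "\<exists>N. \<forall>j\<ge>N. \<forall>k\<ge>N. L2_norm M (\<lambda>x. \<phi> j x - \<phi> k x) < e" if "0 < e" for e
  proof -
    obtain N where N: "\<And>j k. j \<ge> N \<Longrightarrow> k \<ge> N \<Longrightarrow> L2_norm M (\<lambda>x. grad (\<phi> j) x - grad (\<phi> k) x) < e / Poincare_const"
      using cauchy[of "e / Poincare_const"] \<open>0 < e\<close> Poincare_const_pos by auto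
    have "L2_norm M (\<lambda>x. \<phi> j x - \<phi> k x) < e" if "j \<ge> N" "k \<ge> N" for j k
    proof -
      have "grad (\<lambda>x. \<phi> j x - \<phi> k x) = (\<lambda>x. grad (\<phi> j) x - grad (\<phi> k) x)"
        using \<phi>(1) by (intro ext grad_test_diff)
      then have "L2_norm M (\<lambda>x. \<phi> j x - \<phi> k x) \<le> Poincare_const * L2_norm M (\<lambda>x. grad (\<phi> j) x - grad (\<phi> k) x)"
        using Poincare_ineq_test[OF test_diff[OF \<phi>(1)[of j] \<phi>(1)[of k]]] by simp
      also have "\<dots> < Poincare_const * (e / Poincare_const)" using N[OF that] Poincare_const_pos by (intro mult_strict_left_mono)
      finally show ?thesis using Poincare_const_pos by simp
    qed
    then show ?thesis by blast
  qed
  obtain u where u: "L2_lim M \<phi> u"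
    by (rule L2_complete[OF finite_M test_sq_int(1)[OF \<phi>(1)] cauchy'])
  have half: "0 \<le> (LINT x|M. g x \<bullet> grad v x) - (LINT x|M. f x * v x)" if v: "v \<in> ?T" for v
  proof (rule nonneg_if_quadratic_nonneg)
    fix t :: real
    have lim: "(\<lambda>k. ?J (\<phi> k) + t * ((LINT x|M. grad (\<phi> k) x \<bullet> grad v x) - (LINT x|M. f x * v x))
      + t\<^sup>2 * ((L2_norm M (grad v))\<^sup>2 / 2)) \<longlonglongrightarrow> m + t * ((LINT x|M. g x \<bullet> grad v x) - (LINT x|M. f x * v x))
      + t\<^sup>2 * ((L2_norm M (grad v))\<^sup>2 / 2)"
      by (intro tendsto_intros Jlim L2_lim_inner g L2_lim_const test_sq_int v)
    have le: "m \<le> ?J (\<phi> k) + t * ((LINT x|M. grad (\<phi> k) x \<bullet> grad v x) - (LINT x|M. f x * v x))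
      + t\<^sup>2 * ((L2_norm M (grad v))\<^sup>2 / 2)" for k
      using m[OF test_linear[OF \<phi>(1)[of k] v, of 1 t]] Jadd[OF \<phi>(1)[of k] v, of t] by simp
    have "m \<le> m + t * ((LINT x|M. g x \<bullet> grad v x) - (LINT x|M. f x * v x))
      + t\<^sup>2 * ((L2_norm M (grad v))\<^sup>2 / 2)"
      by (rule LIMSEQ_le_const[OF lim]) (use le in blast)
    then show "0 \<le> t * ((LINT x|M. g x \<bullet> grad v x) - (LINT x|M. f x * v x))
      + t\<^sup>2 * ((L2_norm M (grad v))\<^sup>2 / 2)" by simp
  qed
  have "(LINT x|M. g x \<bullet> grad v x) = (LINT x|M. f x * v x)" if v: "v \<in> ?T" for v
  proof -
    have nv: "(\<lambda>x. - v x) \<in> ?T" using test_linear[OF v v, of "-1" 0] by simp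
    have "grad (\<lambda>x. - v x) = (\<lambda>x. - grad v x)"
      using grad_test_linear[OF v v, of "-1" 0] by (intro ext) simp
    then show ?thesis using half[OF v] half[OF nv] by simp
  qed
  moreover have "h10 u g" using \<phi>(1) u g unfolding h10_def by blast
  ultimately show ?thesis using that f by (auto simp: wsol_def)
qed

text \<open>Completing the square: the excess energy of a test function is its distance from the
  solution.\<close>
lemma Dirichlet_energy_eq:
  assumes w: "wsol f u g" and v: "v \<in> test_functions D"
  shows "Dirichlet_energy f v = (L2_norm M (\<lambda>x. grad v x - g x))\<^sup>2 / 2 - (L2_norm M g)\<^sup>2 / 2"
proof -
  have "(LINT x|M. grad v x \<bullet> g x) = (LINT x|M. f x * v x)"
    using w v by (simp add: wsol_def inner_commute)
  then show ?thesis
    using L2_norm_diff_sq[OF test_sq_int(2)[OF v] wsol_sq_int(3)[OF w]]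
    by (simp add: Dirichlet_energy_def field_simps)
qed

text \<open>Comparison of the minimiser with the truncation \<open>(u - t \<psi>)\<^sup>+\<close>. It is admissible
  because \<open>\<psi> \<ge> 0\<close> forces it to vanish wherever \<open>u\<close> does. The right hand side \<open>f \<ge> 0\<close> only gains
  from truncation, and the gradient does not grow, so the energy is bounded by that of
  \<open>u - t \<psi>\<close>. The statement is about the approximating test functions \<open>\<phi>\<close> and their truncations \<open>v\<close>;
  \<open>c\<close> are the energy bounds.\<close>
lemma truncation_competitor:
  assumes w: "wsol f u g" and f: "AE x in M. 0 \<le> f x" and \<psi>: "smooth \<psi>" "\<And>x. 0 \<le> \<psi> x" and t: "0 \<le> t"
  obtains \<phi> v c where "\<And>k. \<phi> k \<in> test_functions D" "L2_lim M \<phi> u" "L2_lim M (\<lambda>k. grad (\<phi> k)) g"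
    "\<And>k. v k \<in> test_functions D" "\<And>k x. 0 \<le> v k x"
    "\<And>k. Dirichlet_energy f (v k) \<le> c k"
    "c \<longlonglongrightarrow> - (L2_norm M g)\<^sup>2 / 2 + t * ((LINT x|M. f x * \<psi> x) - (LINT x|M. g x \<bullet> grad \<psi> x))
       + t\<^sup>2 * ((L2_norm M (grad \<psi>))\<^sup>2 / 2)"
proof -
  obtain \<phi> where \<phi>: "\<And>k. \<phi> k \<in> test_functions D" "L2_lim M \<phi> u" "L2_lim M (\<lambda>k. grad (\<phi> k)) g"
    using wsol_h10[OF w] unfolding h10_def by metis
  note sq = wsol_sq_int[OF w]
  define e where "e k = 1 / real (Suc k)" for k
  have e: "0 < e k" for k by (simp add: e_def)
  have e0: "e \<longlonglongrightarrow> 0" unfolding e_def using LIMSEQ_Suc[OF lim_1_over_n] by simp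
  define p where "p k x = 1 * \<phi> k x + (- t) * \<psi> x" for k x
  have psm: "smooth (p k)" for k
    unfolding p_def by (intro smooth_add smooth_cmult test_smooth[OF \<phi>(1)] \<psi>)
  have gp: "grad (p k) = (\<lambda>x. 1 *\<^sub>R grad (\<phi> k) x + (- t) *\<^sub>R grad \<psi> x)" for k
    unfolding p_def by (intro ext grad_linear test_smooth[OF \<phi>(1)] \<psi>)
  define v where "v k x = smooth_pos_part (e k) (p k x)" for k x
  have vT: "v k \<in> test_functions D" for k
  proof -
    obtain K where K: "compact K" "K \<subseteq> D" "\<And>x. x \<notin> K \<Longrightarrow> \<phi> k x = 0"
      using test_support[OF \<phi>(1)] by metis
    have "v k x = 0" if "x \<notin> K" for x
      unfolding v_def using K(3)[OF that] t \<psi>(2)[of x]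
      by (intro smooth_pos_part(3)[OF e]) (simp add: p_def)
    moreover have "smooth (v k)" unfolding v_def by (intro smooth_smooth_pos_part psm)
    ultimately show ?thesis using K by (intro test_functionsI) auto
  qed
  define c where "c k = (L2_norm M (grad (p k)))\<^sup>2 / 2 - (LINT x|M. f x * (p k x - e k))" for k
  have psq: "sq_int M (\<lambda>x. p k x - e k)" for k
    by (intro sq_int_diff smooth_sq_int(1) psm sq_int_const)
  have le: "Dirichlet_energy f (v k) \<le> c k" for k
  proof -
    have "L2_norm M (grad (v k)) \<le> 1 * L2_norm M (grad (p k))"
    proof (rule L2_norm_mono(2))
      have "v k = (\<lambda>x. smooth_pos_part (e k) (p k x))" by (rule ext) (rule v_def)
      then show "AE x in M. norm (grad (v k) x) \<le> 1 * norm (grad (p k) x)"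
        using norm_grad_smooth_pos_part_le[OF e psm] by (intro AE_I2) simp
      show "grad (v k) \<in> borel_measurable M" by (rule sq_int_measurable[OF test_sq_int(2)[OF vT]])
    qed (simp_all add: smooth_sq_int(2)[OF psm])
    then have "(L2_norm M (grad (v k)))\<^sup>2 \<le> (L2_norm M (grad (p k)))\<^sup>2"
      by (intro power_mono) auto
    moreover have "(LINT x|M. f x * (p k x - e k)) \<le> (LINT x|M. f x * v k x)"
    proof (rule integral_mono_AE)
      show "integrable M (\<lambda>x. f x * (p k x - e k))" using sq_int_inner[OF sq(1) psq] by simp
      show "integrable M (\<lambda>x. f x * v k x)" using sq_int_inner[OF sq(1) test_sq_int(1)[OF vT]] by simp
      show "AE x in M. f x * (p k x - e k) \<le> f x * v k x"
        using f by eventually_elim (simp add: v_def mult_left_mono smooth_pos_part(2)[OF e])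
    qed
    ultimately show ?thesis unfolding Dirichlet_energy_def c_def by linarith
  qed
  have lim: "c \<longlonglongrightarrow> (L2_norm M (\<lambda>x. 1 *\<^sub>R g x + (- t) *\<^sub>R grad \<psi> x))\<^sup>2 / 2
      - ((LINT x|M. f x \<bullet> (1 *\<^sub>R u x + (- t) *\<^sub>R \<psi> x)) - 0 * (LINT x|M. f x))"
  proof -
    have fi: "integrable M f" by (rule sq_int_integrable(1)[OF finite_M sq(1)])
    have "integrable M (\<lambda>x. f x * p k x)" for k
      using sq_int_inner[OF sq(1) smooth_sq_int(1)[OF psm]] by simp
    then have eq: "c k = (L2_norm M (\<lambda>x. 1 *\<^sub>R grad (\<phi> k) x + (- t) *\<^sub>R grad \<psi> x))\<^sup>2 / 2
      - ((LINT x|M. f x \<bullet> (1 *\<^sub>R \<phi> k x + (- t) *\<^sub>R \<psi> x)) - e k * (LINT x|M. f x))" for k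
      using fi unfolding c_def gp
      by (simp add: right_diff_distrib mult.commute[of _ "e k"] p_def)
    show ?thesis unfolding eq
      by (intro tendsto_intros L2_lim_norm L2_lim_inner L2_lim_linear L2_lim_const \<phi> smooth_sq_int sq e0 \<psi>) auto
  qed
  have e1: "(LINT x|M. f x \<bullet> (1 *\<^sub>R u x + (- t) *\<^sub>R \<psi> x)) = (L2_norm M g)\<^sup>2 - t * (LINT x|M. f x * \<psi> x)"
    using sq_int_inner[OF sq(1,2)] sq_int_inner[OF sq(1) smooth_sq_int(1)[OF \<psi>(1)]]
    unfolding wsol_energy[OF w] by (simp add: right_diff_distrib mult.left_commute[of _ t])
  have e2: "(L2_norm M (\<lambda>x. 1 *\<^sub>R g x + (- t) *\<^sub>R grad \<psi> x))\<^sup>2 / 2 =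
     (L2_norm M g)\<^sup>2 / 2 - t * (LINT x|M. g x \<bullet> grad \<psi> x) + t\<^sup>2 * ((L2_norm M (grad \<psi>))\<^sup>2 / 2)"
    unfolding L2_norm_linear_sq[OF sq(3) smooth_sq_int(2)[OF \<psi>(1)]] by simp
  have "c \<longlonglongrightarrow> - (L2_norm M g)\<^sup>2 / 2 + t * ((LINT x|M. f x * \<psi> x) - (LINT x|M. g x \<bullet> grad \<psi> x))
       + t\<^sup>2 * ((L2_norm M (grad \<psi>))\<^sup>2 / 2)"
    using lim unfolding e1 e2
    by (rule back_subst[where P="\<lambda>l. c \<longlonglongrightarrow> l"]) (simp add: algebra_simps)
  with \<phi> vT le show ?thesis using that[of \<phi> v c] smooth_pos_part(1)[OF e] by (simp add: v_def)
qed

text \<open>The zero extension of a nonnegative solution is a subsolution in the whole space: the test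
  function need not vanish on the boundary.\<close>
lemma wsol_subsolution:
  assumes w: "wsol f u g" and f: "AE x in M. 0 \<le> f x" and \<psi>: "smooth \<psi>" "\<And>x. 0 \<le> \<psi> x"
  shows "(LINT x|M. g x \<bullet> grad \<psi> x) \<le> (LINT x|M. f x * \<psi> x)"
proof -
  have "0 \<le> (LINT x|M. f x * \<psi> x) - (LINT x|M. g x \<bullet> grad \<psi> x)"
  proof (rule nonneg_if_quadratic_nonneg)
    fix t :: real assume t: "0 < t"
    obtain \<phi> v c where "\<And>k. \<phi> k \<in> test_functions D" "L2_lim M \<phi> u" "L2_lim M (\<lambda>k. grad (\<phi> k)) g"
      and v: "\<And>k. v k \<in> test_functions D" "\<And>k x. 0 \<le> v k x" "\<And>k. Dirichlet_energy f (v k) \<le> c k"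
      and c: "c \<longlonglongrightarrow> - (L2_norm M g)\<^sup>2 / 2 + t * ((LINT x|M. f x * \<psi> x) - (LINT x|M. g x \<bullet> grad \<psi> x))
       + t\<^sup>2 * ((L2_norm M (grad \<psi>))\<^sup>2 / 2)"
      by (rule truncation_competitor[OF w f \<psi> less_imp_le[OF t]]) (rule that, assumption+)
    have "- (L2_norm M g)\<^sup>2 / 2 \<le> c k" for k
      using v(3)[of k] Dirichlet_energy_eq[OF w v(1)[of k]] zero_le_power2[of "L2_norm M (\<lambda>x. grad (v k) x - g x)"]
      by linarith
    then have "- (L2_norm M g)\<^sup>2 / 2 \<le> - (L2_norm M g)\<^sup>2 / 2 + t * ((LINT x|M. f x * \<psi> x) - (LINT x|M. g x \<bullet> grad \<psi> x))
       + t\<^sup>2 * ((L2_norm M (grad \<psi>))\<^sup>2 / 2)"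
      using LIMSEQ_le_const[OF c] by blast
    then show "0 \<le> t * ((LINT x|M. f x * \<psi> x) - (LINT x|M. g x \<bullet> grad \<psi> x))
       + t\<^sup>2 * ((L2_norm M (grad \<psi>))\<^sup>2 / 2)" by simp
  qed
  then show ?thesis by simp
qed

text \<open>The weak maximum principle: truncating a minimising sequence at \<open>0\<close> keeps it minimising, so
  the truncations still converge to the solution.\<close>
lemma wsol_nonneg:
  assumes w: "wsol f u g" and f: "AE x in M. 0 \<le> f x"
  shows "AE x in M. 0 \<le> u x"
proof -
  obtain \<phi> v c where \<phi>: "\<And>k. \<phi> k \<in> test_functions D" "L2_lim M \<phi> u" "L2_lim M (\<lambda>k. grad (\<phi> k)) g"
    and v: "\<And>k. v k \<in> test_functions D" "\<And>k x. 0 \<le> v k x"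
      "\<And>k. Dirichlet_energy f (v k) \<le> c k"
    and "c \<longlonglongrightarrow> - (L2_norm M g)\<^sup>2 / 2 + 0 * ((LINT x|M. f x * 0) - (LINT x|M. g x \<bullet> grad (\<lambda>x. 0) x))
       + 0\<^sup>2 * ((L2_norm M (grad (\<lambda>x. 0)))\<^sup>2 / 2)"
    by (rule truncation_competitor[OF w f smooth_const[of 0] order_refl order_refl]) (rule that, assumption+)
  then have c: "c \<longlonglongrightarrow> - (L2_norm M g)\<^sup>2 / 2" by simp
  let ?n = "\<lambda>k. L2_norm M (\<lambda>x. grad (v k) x - g x)"
  have "?n k \<le> sqrt (2 * c k + (L2_norm M g)\<^sup>2)" for k
    using v(3)[of k] Dirichlet_energy_eq[OF w v(1)[of k]] by (intro real_le_rsqrt) (simp add: field_simps)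
  moreover have "(\<lambda>k. sqrt (2 * c k + (L2_norm M g)\<^sup>2)) \<longlonglongrightarrow> sqrt (2 * (- (L2_norm M g)\<^sup>2 / 2) + (L2_norm M g)\<^sup>2)"
    by (intro tendsto_intros c)
  ultimately have "?n \<longlonglongrightarrow> 0"
    by (intro Lim_null_comparison[of ?n "\<lambda>k. sqrt (2 * c k + (L2_norm M g)\<^sup>2)"]) (auto intro: always_eventually)
  then have gv: "L2_lim M (\<lambda>k. grad (v k)) g"
    using test_sq_int(2)[OF v(1)] wsol_sq_int(3)[OF w] by (simp add: L2_lim_def)
  have d: "(\<lambda>k. L2_norm M (\<lambda>x. grad (v k) x - grad (\<phi> k) x)) \<longlonglongrightarrow> 0"
    using L2_lim_norm[OF L2_lim_diff[OF gv \<phi>(3)]] by (simp add: L2_norm_def)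
  have nle: "norm (L2_norm M (\<lambda>x. v k x - \<phi> k x)) \<le> Poincare_const * L2_norm M (\<lambda>x. grad (v k) x - grad (\<phi> k) x)" for k
  proof -
    have "grad (\<lambda>x. v k x - \<phi> k x) = (\<lambda>x. grad (v k) x - grad (\<phi> k) x)"
      using v(1) \<phi>(1) by (intro ext grad_test_diff)
    then show ?thesis using Poincare_ineq_test[OF test_diff[OF v(1)[of k] \<phi>(1)[of k]]] by simp
  qed
  have d': "(\<lambda>k. L2_norm M (\<lambda>x. v k x - \<phi> k x)) \<longlonglongrightarrow> 0"
    by (rule Lim_null_comparison[OF always_eventually tendsto_mult_right_zero[OF d]]) (rule allI, rule nle)
  have "L2_lim M v u"
  proof -
    have sum0: "(\<lambda>k. L2_norm M (\<lambda>x. v k x - \<phi> k x) + L2_norm M (\<lambda>x. \<phi> k x - u x)) \<longlonglongrightarrow> 0"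
      using tendsto_add[OF d', of _ 0] \<phi>(2) by (simp add: L2_lim_def)
    have le: "norm (L2_norm M (\<lambda>x. v k x - u x)) \<le> L2_norm M (\<lambda>x. v k x - \<phi> k x) + L2_norm M (\<lambda>x. \<phi> k x - u x)" for k
      using L2_norm_triangle_diff[OF test_sq_int(1)[OF v(1)] test_sq_int(1)[OF \<phi>(1)] wsol_sq_int(2)[OF w], of k k]
      by simp
    have "(\<lambda>k. L2_norm M (\<lambda>x. v k x - u x)) \<longlonglongrightarrow> 0"
      by (rule Lim_null_comparison[OF always_eventually sum0]) (rule allI, rule le)
    then show ?thesis using test_sq_int(1)[OF v(1)] wsol_sq_int(2)[OF w] by (simp add: L2_lim_def)
  qed
  then show ?thesis by (rule L2_lim_nonneg) (simp add: v(2))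
qed

end

section \<open>A mean value inequality\<close>

text \<open>The mean value theorem bounds the difference quotients of the kernel by the bound for its
  derivative, so dominated convergence applies.\<close>
lemma DERIV_integral_kernel:
  fixes h h' :: "real \<Rightarrow> 'a \<Rightarrow> real"
  assumes u: "integrable M u" and l: "a < l" "l < b"
    and h: "\<And>l y. a < l \<Longrightarrow> l < b \<Longrightarrow> y \<in> space M \<Longrightarrow> ((\<lambda>l. h l y) has_real_derivative h' l y) (at l)"
    and bd: "\<And>l y. a < l \<Longrightarrow> l < b \<Longrightarrow> y \<in> space M \<Longrightarrow> \<bar>h l y\<bar> \<le> B"
    and bd': "\<And>l y. a < l \<Longrightarrow> l < b \<Longrightarrow> y \<in> space M \<Longrightarrow> \<bar>h' l y\<bar> \<le> B"
    and meas: "\<And>l. h l \<in> borel_measurable M" "\<And>l. h' l \<in> borel_measurable M"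
  shows "((\<lambda>l. LINT y|M. u y * h l y) has_real_derivative (LINT y|M. u y * h' l y)) (at l)"
  unfolding DERIV_def tendsto_at_iff_sequentially
proof (intro allI impI)
  fix X :: "nat \<Rightarrow> real" assume X: "\<forall>i. X i \<in> UNIV - {0}" "X \<longlonglongrightarrow> 0"
  have um: "u \<in> borel_measurable M" using u by (rule borel_measurable_integrable)
  define r where "r = min (l - a) (b - l)"
  have r: "0 < r" using l by (simp add: r_def)
  obtain N where N: "\<And>i. i \<ge> N \<Longrightarrow> \<bar>X i\<bar> < r"
    using LIMSEQ_D[OF X(2) r] by auto
  define Y where "Y i = X (i + N)" for i
  have Y: "Y i \<noteq> 0" "a < l + Y i" "l + Y i < b" for i
    using N[of "i + N"] X(1) by (auto simp: Y_def r_def)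
  have Y0: "Y \<longlonglongrightarrow> 0" unfolding Y_def using X(2) by (rule LIMSEQ_ignore_initial_segment)
  have inth: "integrable M (\<lambda>y. u y * h l y)" if "a < l" "l < b" for l
  proof (rule Bochner_Integration.integrable_bound)
    show "integrable M (\<lambda>y. B * \<bar>u y\<bar>)" using u by simp
    show "AE y in M. norm (u y * h l y) \<le> norm (B * \<bar>u y\<bar>)"
    proof (rule AE_I2)
      fix y assume y: "y \<in> space M"
      have "0 \<le> B" using bd[OF that y] by linarith
      moreover have "\<bar>u y\<bar> * \<bar>h l y\<bar> \<le> \<bar>u y\<bar> * B"
        using bd[OF that y] by (intro mult_left_mono) auto
      ultimately show "norm (u y * h l y) \<le> norm (B * \<bar>u y\<bar>)" by (simp add: abs_mult mult.commute)
    qed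
  qed (intro borel_measurable_times um meas)
  have lim: "(\<lambda>i. LINT y|M. u y * ((h (l + Y i) y - h l y) / Y i)) \<longlonglongrightarrow> (LINT y|M. u y * h' l y)"
  proof (rule integral_dominated_convergence)
    show "integrable M (\<lambda>y. B * \<bar>u y\<bar>)" using u by simp
    show "(\<lambda>y. u y * h' l y) \<in> borel_measurable M" by (intro borel_measurable_times um meas)
    show "(\<lambda>y. u y * ((h (l + Y i) y - h l y) / Y i)) \<in> borel_measurable M" for i
      by (intro borel_measurable_times borel_measurable_divide borel_measurable_diff um meas borel_measurable_const)
    show "AE y in M. (\<lambda>i. u y * ((h (l + Y i) y - h l y) / Y i)) \<longlonglongrightarrow> u y * h' l y"
    proof (rule AE_I2)
      fix y assume y: "y \<in> space M"
      have "((\<lambda>t. (h (l + t) y - h l y) / t) \<longlongrightarrow> h' l y) (at 0)"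
        using h[OF l y] by (simp add: DERIV_def)
      then have "(\<lambda>i. (h (l + Y i) y - h l y) / Y i) \<longlonglongrightarrow> h' l y"
        using Y(1) Y0 by (auto simp: tendsto_at_iff_sequentially comp_def)
      then show "(\<lambda>i. u y * ((h (l + Y i) y - h l y) / Y i)) \<longlonglongrightarrow> u y * h' l y"
        by (intro tendsto_intros)
    qed
    show "AE y in M. norm (u y * ((h (l + Y i) y - h l y) / Y i)) \<le> B * \<bar>u y\<bar>" for i
    proof (rule AE_I2)
      fix y assume y: "y \<in> space M"
      let ?S = "{min l (l + Y i)..max l (l + Y i)}"
      have S: "a < z" "z < b" if "z \<in> ?S" for z
        using that l Y(2,3)[of i] by (simp_all add: min_def max_def split: if_splits)
      have "norm (h (l + Y i) y - h l y) \<le> B * norm (l + Y i - l)"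
      proof (rule field_differentiable_bound[where S="?S" and f'="\<lambda>l. h' l y"])
        show "((\<lambda>l. h l y) has_field_derivative h' z y) (at z within ?S)" if "z \<in> ?S" for z
          by (rule has_field_derivative_at_within[OF h[OF S[OF that] y]])
        show "norm (h' z y) \<le> B" if "z \<in> ?S" for z
          using bd'[OF S[OF that] y] by simp
      qed simp_all
      then have "\<bar>(h (l + Y i) y - h l y) / Y i\<bar> \<le> B"
        using Y(1)[of i] by (simp add: abs_div divide_le_eq)
      then have "\<bar>u y\<bar> * \<bar>(h (l + Y i) y - h l y) / Y i\<bar> \<le> \<bar>u y\<bar> * B"
        by (intro mult_left_mono) auto
      then show "norm (u y * ((h (l + Y i) y - h l y) / Y i)) \<le> B * \<bar>u y\<bar>"
        by (simp add: abs_mult mult.commute)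
    qed
  qed
  have eq: "(LINT y|M. u y * ((h (l + Y i) y - h l y) / Y i))
      = ((LINT y|M. u y * h (l + Y i) y) - (LINT y|M. u y * h l y)) / Y i" for i
  proof -
    have "(LINT y|M. u y * ((h (l + Y i) y - h l y) / Y i)) = (LINT y|M. (u y * h (l + Y i) y - u y * h l y) / Y i)"
      by (simp add: right_diff_distrib)
    also have "\<dots> = ((LINT y|M. u y * h (l + Y i) y) - (LINT y|M. u y * h l y)) / Y i"
      using inth[OF Y(2,3)[of i]] inth[OF l] by simp
    finally show ?thesis .
  qed
  have "(\<lambda>i. ((LINT y|M. u y * h (l + X (i + N)) y) - (LINT y|M. u y * h l y)) / X (i + N))
      \<longlonglongrightarrow> (LINT y|M. u y * h' l y)"
    using lim unfolding eq unfolding Y_def .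
  then show "((\<lambda>t. ((LINT y|M. u y * h (l + t) y) - (LINT y|M. u y * h l y)) / t) \<circ> X)
      \<longlonglongrightarrow> (LINT y|M. u y * h' l y)"
    unfolding comp_def by (rule LIMSEQ_offset)
qed

definition laplacian :: "(real^'n \<Rightarrow> real) \<Rightarrow> real^'n \<Rightarrow> real" where
  "laplacian f x = (\<Sum>i\<in>UNIV. partial_deriv i (partial_deriv i f) x)"

text \<open>A bump of radius \<open>l\<close> around \<open>x\<close> with values in \<open>[0,1]\<close>.\<close>
definition cap :: "real^'n \<Rightarrow> real \<Rightarrow> real^'n \<Rightarrow> real" where
  "cap x l y = flat_exp 0 (1 - (norm (y - x))\<^sup>2 / l\<^sup>2)"

text \<open>The averaging kernel, with mass not normalised to \<open>1\<close>. Since \<open>flat_exp 2\<close> is the derivative of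
  \<open>flat_exp 0\<close>, the vector field \<open>(y - x) ker\<close> is a multiple of the gradient of \<open>cap\<close>; this is what
  makes \<open>DERIV_ker\<close> true.\<close>
definition ker :: "real^'n \<Rightarrow> real \<Rightarrow> real^'n \<Rightarrow> real" where
  "ker x l y = flat_exp 2 (1 - (norm (y - x))\<^sup>2 / l\<^sup>2) / l ^ CARD('n)"

lemma smooth_bump_arg: "smooth (\<lambda>y. 1 - (norm (y - x))\<^sup>2 / l\<^sup>2)"
  using smooth_diff[OF smooth_const[of 1] smooth_cmult[OF smooth_norm_diff_sq[of x], of "1 / l\<^sup>2"]] by simp

lemma partial_deriv_bump_arg: "partial_deriv i (\<lambda>y. 1 - (norm (y - x))\<^sup>2 / l\<^sup>2) y = - 2 / l\<^sup>2 * (y $ i - x $ i)"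
proof -
  have d: "((\<lambda>s. 1 - s / l\<^sup>2) has_real_derivative (- 1 / l\<^sup>2)) (at s)" for s
  proof -
    have "((\<lambda>s. 1 - s * (1 / l\<^sup>2)) has_real_derivative (0 - 1 * (1 / l\<^sup>2))) (at s)"
      by (rule DERIV_diff[OF DERIV_const DERIV_cmult_right[OF DERIV_ident]])
    then show ?thesis by simp
  qed
  have "partial_deriv i (\<lambda>y. 1 - (norm (y - x))\<^sup>2 / l\<^sup>2) y = - 1 / l\<^sup>2 * partial_deriv i (\<lambda>y. (norm (y - x))\<^sup>2) y"
    by (rule partial_deriv_chain[where F="\<lambda>s. 1 - s / l\<^sup>2", OF d smooth_differentiable[OF smooth_norm_diff_sq]])
  then show ?thesis by (simp add: partial_deriv_norm_diff_sq)
qed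

lemma partial_deriv_flat_exp_bump:
  "partial_deriv i (\<lambda>y. flat_exp m (1 - (norm (y - x))\<^sup>2 / l\<^sup>2)) y =
    (flat_exp (m + 2) (1 - (norm (y - x))\<^sup>2 / l\<^sup>2) - real m * flat_exp (m + 1) (1 - (norm (y - x))\<^sup>2 / l\<^sup>2))
     * (- 2 / l\<^sup>2 * (y $ i - x $ i))"
  using partial_deriv_chain[OF flat_exp_deriv smooth_differentiable[OF smooth_bump_arg]]
  by (simp only: partial_deriv_bump_arg)

lemma smooth_cap: "smooth (cap x l)"
  unfolding cap_def[abs_def] by (intro smooth_flat_exp smooth_bump_arg)

lemma laplacian_cap:
  fixes x :: "real^'n"
  shows "laplacian (cap x l) y = - 2 / l\<^sup>2 * (real CARD('n) * flat_exp 2 (1 - (norm (y - x))\<^sup>2 / l\<^sup>2)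
    - 2 / l\<^sup>2 * (norm (y - x))\<^sup>2 * (flat_exp 4 (1 - (norm (y - x))\<^sup>2 / l\<^sup>2) - 2 * flat_exp 3 (1 - (norm (y - x))\<^sup>2 / l\<^sup>2)))"
proof -
  let ?e = "\<lambda>m y. flat_exp m (1 - (norm (y - x))\<^sup>2 / l\<^sup>2)"
  have e: "flat_exp (0 + 2) = flat_exp 2" "flat_exp (2 + 2) = flat_exp 4" "flat_exp (2 + 1) = flat_exp 3"
    by (rule arg_cong[where f=flat_exp], simp)+
  have 1: "partial_deriv i (cap x l) = (\<lambda>y. (- 2 / l\<^sup>2) * ((y $ i - x $ i) * ?e 2 y))" for i
    unfolding cap_def[abs_def] partial_deriv_flat_exp_bump e
    by (rule ext) (simp only: partial_deriv_flat_exp_bump e of_nat_0 mult_zero_left diff_0_right ac_simps)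
  have 2: "partial_deriv i (partial_deriv i (cap x l)) y = - 2 / l\<^sup>2 * (?e 2 y
      - 2 / l\<^sup>2 * (?e 4 y - 2 * ?e 3 y) * (y $ i - x $ i)\<^sup>2)" for i
  proof -
    have d: "(\<lambda>y. y $ i - x $ i) differentiable (at y)" "(?e 2) differentiable (at y)"
      "(\<lambda>y. (y $ i - x $ i) * ?e 2 y) differentiable (at y)"
      by (intro smooth_differentiable smooth_mult smooth_flat_exp smooth_bump_arg smooth_diff smooth_nth smooth_const)+
    have n: "partial_deriv i (\<lambda>y. y $ i - x $ i) y = 1"
    proof -
      have "((\<lambda>s. s - x $ i) has_real_derivative 1) (at s)" for s
        by (auto intro!: derivative_eq_intros)
      from partial_deriv_chain[OF this smooth_differentiable[OF smooth_nth[of i]], of i y]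
      show ?thesis by (simp add: partial_deriv_nth)
    qed
    have "partial_deriv i (partial_deriv i (cap x l)) y =
        (- 2 / l\<^sup>2) * partial_deriv i (\<lambda>y. (y $ i - x $ i) * ?e 2 y) y"
      unfolding 1 by (rule partial_deriv_chain[where F="\<lambda>s. (- 2 / l\<^sup>2) * s", OF DERIV_cmult_Id d(3)])
    also have "partial_deriv i (\<lambda>y. (y $ i - x $ i) * ?e 2 y) y =
        (y $ i - x $ i) * partial_deriv i (?e 2) y + ?e 2 y"
      using partial_deriv_mult[OF d(1,2), of i] n by simp
    also have "partial_deriv i (?e 2) y = (?e 4 y - 2 * ?e 3 y) * (- 2 / l\<^sup>2 * (y $ i - x $ i))"
      unfolding partial_deriv_flat_exp_bump e by simp
    finally show ?thesis by (simp add: power2_eq_square algebra_simps)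
  qed
  have "(norm (y - x))\<^sup>2 = (\<Sum>i\<in>UNIV. (y $ i - x $ i)\<^sup>2)"
    unfolding power2_norm_eq_inner inner_vec_def by (simp add: power2_eq_square)
  then show ?thesis unfolding laplacian_def 2
    by (simp only: sum_distrib_left[symmetric] sum_subtractf sum_constant) (simp only: mult_ac)
qed

text \<open>The scale derivative of a rescaled density is \<open>-1/l\<close> times the divergence of
  \<open>(y - x) ker\<close>, and that field is a multiple of the gradient of \<open>cap\<close>.\<close>
lemma DERIV_ker:
  fixes x :: "real^'n"
  assumes l: "0 < l"
  shows "((\<lambda>l. ker x l y) has_real_derivative (l / (2 * l ^ CARD('n)) * laplacian (cap x l) y)) (at l)"
proof -
  let ?a = "(norm (y - x))\<^sup>2" and ?n = "CARD('n)"
  have a: "((\<lambda>l. 1 - ?a / l\<^sup>2) has_real_derivative (2 * ?a / l ^ 3)) (at l)"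
    using l by (auto intro!: derivative_eq_intros simp: power2_eq_square power3_eq_cube field_simps)
  have b: "((\<lambda>l. flat_exp 2 (1 - ?a / l\<^sup>2)) has_real_derivative
      (flat_exp (2 + 2) (1 - ?a / l\<^sup>2) - real 2 * flat_exp (2 + 1) (1 - ?a / l\<^sup>2)) * (2 * ?a / l ^ 3)) (at l)"
    by (rule DERIV_chain'[OF a flat_exp_deriv])
  have c: "((\<lambda>l. l ^ ?n) has_real_derivative real ?n * l ^ (?n - 1)) (at l)"
    using DERIV_pow[of ?n l] by simp
  have n: "l ^ ?n = l * l ^ (?n - 1)"
    using zero_less_card_finite[where 'a='n] by (metis power_eq_if card_gt_0_iff neq0_conv)
  have e: "flat_exp (2 + 2) = flat_exp 4" "flat_exp (2 + 1) = flat_exp 3"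
    by (rule arg_cong[where f=flat_exp], simp)+
  have "(((e4 - real 2 * e3) * (2 * ?a / l ^ 3)) * (l * P) - e2 * (N * P)) / ((l * P) * (l * P))
     = l / (2 * (l * P)) * (- 2 / l\<^sup>2 * (N * e2 - 2 / l\<^sup>2 * ?a * (e4 - 2 * e3)))"
    if "P \<noteq> 0" for e2 e3 e4 N P :: real
    using l that by (simp add: field_simps power2_eq_square power3_eq_cube)
  note eq = this[of "l ^ (?n - 1)"]
  show ?thesis unfolding ker_def laplacian_cap n
    by (rule DERIV_cong[OF DERIV_divide[OF b c, unfolded n e] eq]) (use l in simp_all)
qed

lemma flat_exp_measurable [measurable]: "flat_exp m \<in> borel_measurable borel"
  by (rule borel_measurable_continuous_onI[OF flat_exp_continuous])

lemma ker_nonneg: "0 < l \<Longrightarrow> 0 \<le> ker x l y"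
  by (simp add: ker_def flat_exp_nonneg)

lemma ker_commute: "ker x l y = ker y l x"
  by (simp add: ker_def norm_minus_commute)

lemma bump_arg_nonpos:
  assumes "0 < l" "l \<le> norm (y - x)" shows "1 - (norm (y - x))\<^sup>2 / l\<^sup>2 \<le> 0"
proof -
  have "1 = l\<^sup>2 / l\<^sup>2" using assms by simp
  also have "\<dots> \<le> (norm (y - x))\<^sup>2 / l\<^sup>2" using assms by (intro divide_right_mono power_mono) auto
  finally show ?thesis by (simp only: diff_le_0_iff_le)
qed

lemma flat_exp_nonpos: "s \<le> 0 \<Longrightarrow> flat_exp m s = 0"
  by (simp add: flat_exp_def)

lemma ker_zero: "0 < l \<Longrightarrow> l \<le> norm (y - x) \<Longrightarrow> ker x l y = 0"
  unfolding ker_def by (simp only: flat_exp_nonpos[OF bump_arg_nonpos] div_0)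

lemma cap_le: "0 < l \<Longrightarrow> cap x l y \<le> indicator (ball x l) y"
  unfolding cap_def using flat_exp_0_le_1
  by (cases "l \<le> norm (y - x)")
     (simp_all only: flat_exp_nonpos[OF bump_arg_nonpos], simp_all add: dist_norm norm_minus_commute[of x y])

lemma cap_nonneg: "0 \<le> cap x l y" by (simp add: cap_def flat_exp_nonneg)

lemma smooth_ker: "smooth (ker x l)"
  unfolding ker_def[abs_def]
  using smooth_cmult[OF smooth_flat_exp[OF smooth_bump_arg[of x l], of 2], of "1 / l ^ CARD('a)"] by simp

text \<open>The common mass of the averaging kernels, see \<open>nn_integral_ker\<close>; the type argument carries the
  dimension.\<close>
definition kmass :: "'n::finite itself \<Rightarrow> real" where
  "kmass _ = enn2real (\<integral>\<^sup>+ (z::real^'n). ennreal (flat_exp 2 (1 - (norm z)\<^sup>2)) \<partial>lborel)"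

lemma kmass_pos: "0 < kmass TYPE('n::finite)"
  and kmass_eq: "(\<integral>\<^sup>+ (z::real^'n). ennreal (flat_exp 2 (1 - (norm z)\<^sup>2)) \<partial>lborel) = ennreal (kmass TYPE('n))"
proof -
  let ?I = "\<integral>\<^sup>+ (z::real^'n). ennreal (flat_exp 2 (1 - (norm z)\<^sup>2)) \<partial>lborel"
  have "?I \<le> (\<integral>\<^sup>+ (z::real^'n). 2 * indicator (ball 0 1) z \<partial>lborel)"
  proof (intro nn_integral_mono)
    fix z :: "real^'n"
    have "flat_exp 2 (1 - (norm z)\<^sup>2) \<le> 2" using flat_exp_bound[of 2] by (simp add: numeral_2_eq_2)
    moreover have "flat_exp 2 (1 - (norm z)\<^sup>2) = 0" if "\<not> norm z < 1"
      using that by (simp add: flat_exp_def not_less)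
    ultimately show "ennreal (flat_exp 2 (1 - (norm z)\<^sup>2)) \<le> 2 * indicator (ball 0 1) z"
      by (cases "norm z < 1") (auto simp: indicator_def ennreal_leI[of _ 2, simplified])
  qed
  also have "\<dots> = 2 * emeasure lborel (ball 0 1 :: (real^'n) set)" by (subst nn_integral_cmult_indicator) auto
  also have "\<dots> < \<infinity>" using emeasure_bounded_finite[of "ball 0 1 :: (real^'n) set"]
    by (simp add: ennreal_mult_less_top)
  finally have fin: "?I < \<infinity>" .
  then show eq: "?I = ennreal (kmass TYPE('n))" by (simp add: kmass_def)
  have "0 < ennreal (exp (- 2)) * emeasure lborel (ball 0 (1/2) :: (real^'n) set)"
    by (subst emeasure_ball) (simp_all add: ennreal_zero_less_mult_iff)
  also have "\<dots> = (\<integral>\<^sup>+ (z::real^'n). ennreal (exp (- 2)) * indicator (ball 0 (1/2)) z \<partial>lborel)"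
    by (subst nn_integral_cmult_indicator) auto
  also have "\<dots> \<le> ?I"
  proof (intro nn_integral_mono)
    fix z :: "real^'n"
    have "exp (- 2) \<le> flat_exp 2 (1 - (norm z)\<^sup>2)" if "norm z < 1/2"
    proof -
      let ?s = "1 - (norm z)\<^sup>2"
      have "(norm z)\<^sup>2 \<le> (1/2)\<^sup>2" using that by (intro power_mono) auto
      then have s: "1/2 \<le> ?s" "?s \<le> 1" by (auto simp: power2_eq_square)
      have "exp (- 2) \<le> exp (- 1 / ?s) / 1" using s by (simp add: field_simps)
      also have "\<dots> \<le> exp (- 1 / ?s) / ?s\<^sup>2"
        using s by (intro divide_left_mono) (auto simp: power_le_one)
      finally show ?thesis using s by (simp add: flat_exp_def)
    qed
    then show "ennreal (exp (- 2)) * indicator (ball 0 (1/2)) z \<le> ennreal (flat_exp 2 (1 - (norm z)\<^sup>2))"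
      by (auto simp: indicator_def intro: ennreal_leI)
  qed
  finally show "0 < kmass TYPE('n)" using eq by simp
qed

lemma nn_integral_ker:
  fixes x :: "real^'n"
  assumes l: "0 < l"
  shows "(\<integral>\<^sup>+ y. ennreal (ker x l y) \<partial>lborel) = ennreal (kmass TYPE('n))"
proof -
  have [measurable]: "ker x l \<in> borel_measurable borel" by (intro smooth_measurable smooth_ker)
  have "(\<integral>\<^sup>+ y. ennreal (ker x l y) \<partial>lborel) =
      (\<integral>\<^sup>+ y. ennreal (ker x l y) \<partial>density (distr lborel borel (\<lambda>z. x + l *\<^sub>R z)) (\<lambda>_. ennreal (\<bar>l\<bar> ^ DIM(real^'n))))"
    using l by (subst lborel_affine[of l x]) auto
  also have "\<dots> = (\<integral>\<^sup>+ z. ennreal (\<bar>l\<bar> ^ DIM(real^'n)) * ennreal (ker x l (x + l *\<^sub>R z)) \<partial>lborel)"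
    by (simp add: nn_integral_density nn_integral_distr)
  also have "\<dots> = (\<integral>\<^sup>+ (z::real^'n). ennreal (flat_exp 2 (1 - (norm z)\<^sup>2)) \<partial>lborel)"
  proof (intro nn_integral_cong)
    fix z :: "real^'n"
    have "\<bar>l\<bar> ^ DIM(real^'n) * ker x l (x + l *\<^sub>R z) = flat_exp 2 (1 - (norm z)\<^sup>2)"
      using l by (simp add: ker_def power_mult_distrib)
    then show "ennreal (\<bar>l\<bar> ^ DIM(real^'n)) * ennreal (ker x l (x + l *\<^sub>R z)) = ennreal (flat_exp 2 (1 - (norm z)\<^sup>2))"
      using ker_nonneg[OF l] by (subst ennreal_mult[symmetric]) auto
  qed
  finally show ?thesis by (simp add: kmass_eq)
qed

context bounded_domain
begin

lemma nn_integral_M_le: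
  assumes "f \<in> borel_measurable borel"
  shows "(\<integral>\<^sup>+ y. f y \<partial>M) \<le> (\<integral>\<^sup>+ y. f y \<partial>lborel)"
proof -
  have "(\<integral>\<^sup>+ y. f y \<partial>M) = (\<integral>\<^sup>+ y. f y * indicator D y \<partial>lebesgue)"
    by (rule nn_integral_restrict_space) simp
  also have "\<dots> \<le> (\<integral>\<^sup>+ y. f y \<partial>lebesgue)"
    by (intro nn_integral_mono) (simp add: indicator_def)
  also have "\<dots> = (\<integral>\<^sup>+ y. f y \<partial>lborel)"
    using assms by (simp add: nn_integral_completion)
  finally show ?thesis .
qed

lemma integral_M_le:
  assumes f: "integrable M f" "AE y in M. 0 \<le> f y" and F: "AE y in M. f y \<le> F y" "F \<in> borel_measurable borel"
    and c: "(\<integral>\<^sup>+ y. ennreal (F y) \<partial>lborel) \<le> ennreal c" "0 \<le> c"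
  shows "(LINT y|M. f y) \<le> c"
proof -
  have "ennreal (LINT y|M. f y) = (\<integral>\<^sup>+ y. ennreal (f y) \<partial>M)"
    using f by (simp add: nn_integral_eq_integral)
  also have "\<dots> \<le> (\<integral>\<^sup>+ y. ennreal (F y) \<partial>M)"
    using F(1) by (intro nn_integral_mono_AE) (auto intro: ennreal_leI)
  also have "\<dots> \<le> ennreal c"
    using nn_integral_M_le[of "\<lambda>y. ennreal (F y)"] F(2) c(1) by (auto intro: order_trans)
  finally show ?thesis using c(2) by (simp add: ennreal_le_iff)
qed

text \<open>Integration by parts for the approximating test functions; \<open>\<psi>\<close> may be nonzero on the
  boundary because they vanish there.\<close>
lemma h10_laplacian:
  assumes u: "h10 u g" and \<psi>: "smooth \<psi>"
  shows "(LINT x|M. g x \<bullet> grad \<psi> x) = - (LINT x|M. u x * laplacian \<psi> x)"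
proof -
  obtain \<phi> where \<phi>: "\<And>k. \<phi> k \<in> test_functions D" "L2_lim M \<phi> u" "L2_lim M (\<lambda>k. grad (\<phi> k)) g"
    using u unfolding h10_def by metis
  have lap: "smooth (laplacian \<psi>)"
    unfolding laplacian_def[abs_def] by (intro smooth_sum smooth_partial_deriv \<psi>)
  have "(LINT x|M. grad (\<phi> k) x \<bullet> grad \<psi> x) = - (LINT x|M. \<phi> k x * laplacian \<psi> x)" for k
  proof -
    have i1: "integrable M (\<lambda>x. partial_deriv i (\<phi> k) x * partial_deriv i \<psi> x)" for i
      by (rule test_integrable[OF test_mult_smooth[OF test_partial_deriv[OF \<phi>(1)] smooth_partial_deriv[OF \<psi>]] D_sets])
    have i2: "integrable M (\<lambda>x. \<phi> k x * partial_deriv i (partial_deriv i \<psi>) x)" for i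
      by (rule test_integrable[OF test_mult_smooth[OF \<phi>(1) smooth_partial_deriv[OF smooth_partial_deriv[OF \<psi>]]] D_sets])
    have "(LINT x|M. grad (\<phi> k) x \<bullet> grad \<psi> x) = (\<Sum>i\<in>UNIV. LINT x|M. partial_deriv i (\<phi> k) x * partial_deriv i \<psi> x)"
      unfolding inner_vec_def using i1 by (simp add: Bochner_Integration.integral_sum)
    also have "\<dots> = (\<Sum>i\<in>UNIV. - (LINT x|M. \<phi> k x * partial_deriv i (partial_deriv i \<psi>) x))"
      by (intro sum.cong refl integration_by_parts[OF \<phi>(1) smooth_partial_deriv[OF \<psi>] D_sets])
    also have "\<dots> = - (LINT x|M. \<phi> k x * laplacian \<psi> x)"
      unfolding laplacian_def sum_distrib_left using i2 by (simp add: Bochner_Integration.integral_sum sum_negf)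
    finally show ?thesis .
  qed
  then have "(\<lambda>k. LINT x|M. grad (\<phi> k) x \<bullet> grad \<psi> x) \<longlonglongrightarrow> - (LINT x|M. u x * laplacian \<psi> x)"
    using tendsto_minus[OF L2_lim_inner[OF \<phi>(2) L2_lim_const[OF smooth_sq_int(1)[OF lap]]]] by simp
  moreover have "(\<lambda>k. LINT x|M. grad (\<phi> k) x \<bullet> grad \<psi> x) \<longlonglongrightarrow> (LINT x|M. g x \<bullet> grad \<psi> x)"
    by (rule L2_lim_inner[OF \<phi>(3) L2_lim_const[OF smooth_sq_int(2)[OF \<psi>]]])
  ultimately show ?thesis by (rule LIMSEQ_unique[rotated])
qed

lemma bounded_on_closure:
  fixes h :: "real \<Rightarrow> real^'n \<Rightarrow> real"
  assumes "continuous_on ({a..b} \<times> closure D) (\<lambda>z. h (fst z) (snd z))"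
  obtains B where "\<And>l y. a \<le> l \<Longrightarrow> l \<le> b \<Longrightarrow> y \<in> D \<Longrightarrow> \<bar>h l y\<bar> \<le> B"
proof -
  have "compact ({a..b} \<times> closure D)" using bounded_D by (intro compact_Times) (simp_all add: compact_closure)
  then have "bounded ((\<lambda>z. h (fst z) (snd z)) ` ({a..b} \<times> closure D))"
    using assms by (intro compact_imp_bounded compact_continuous_image)
  then obtain B where B: "\<forall>v\<in>(\<lambda>z. h (fst z) (snd z)) ` ({a..b} \<times> closure D). norm v \<le> B"
    unfolding bounded_iff by blast
  show ?thesis
  proof
    fix l y assume "a \<le> l" "l \<le> b" "y \<in> D"
    then have "h l y \<in> (\<lambda>z. h (fst z) (snd z)) ` ({a..b} \<times> closure D)"
      using closure_subset[of D] by (intro image_eqI[of _ _ "(l, y)"]) auto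
    then show "\<bar>h l y\<bar> \<le> B" using B by (simp only: real_norm_def)
  qed
qed

abbreviation average :: "(real^'n \<Rightarrow> real) \<Rightarrow> real^'n \<Rightarrow> real \<Rightarrow> real" where
  "average u x l \<equiv> LINT y|M. u y * ker x l y"

lemma sq_int_times_ker: "sq_int M u \<Longrightarrow> integrable M (\<lambda>y. u y * ker x l y)"
  using sq_int_inner[OF _ smooth_sq_int(1)[OF smooth_ker]] by simp

lemma cap_integral_le:
  assumes l: "0 < l" and f: "sq_int M f" "AE y in M. 0 \<le> f y" "AE y in M. f y \<le> 1"
  shows "(LINT y|M. f y * cap x l y) \<le> unit_ball_vol (real CARD('n)) * l ^ CARD('n)"
proof (rule integral_M_le[where F="indicator (ball x l)"])
  show "integrable M (\<lambda>y. f y * cap x l y)"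
    using sq_int_inner[OF f(1) smooth_sq_int(1)[OF smooth_cap]] by simp
  show "AE y in M. 0 \<le> f y * cap x l y" using f(2) by eventually_elim (simp add: cap_nonneg)
  show "AE y in M. f y * cap x l y \<le> indicator (ball x l) y"
    using f(2,3)
  proof eventually_elim
    case (elim y)
    have "f y * cap x l y \<le> 1 * cap x l y" using elim cap_nonneg by (intro mult_right_mono) auto
    then show ?case using cap_le[OF l, of x y] by simp
  qed
  have "(\<integral>\<^sup>+ y. ennreal (indicator (ball x l) y) \<partial>lborel) = emeasure lborel (ball x l)"
    by (simp add: ennreal_indicator)
  also have "\<dots> = ennreal (unit_ball_vol (real CARD('n)) * l ^ CARD('n))" using l by (simp add: emeasure_ball)
  finally show "(\<integral>\<^sup>+ y. ennreal (indicator (ball x l) y) \<partial>lborel) \<le> ennreal (unit_ball_vol (real CARD('n)) * l ^ CARD('n))" by simp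
  show "indicator (ball x l) \<in> borel_measurable borel" by (rule borel_measurable_indicator) simp
  show "0 \<le> unit_ball_vol (real CARD('n)) * l ^ CARD('n)" using l by simp
qed

text \<open>Sub-mean-value inequality. The scale derivative of the averages is the integral of \<open>u\<close> against a
  multiple of the Laplacian of the nonnegative bump \<open>cap\<close>, which \<open>wsol_subsolution\<close> bounds below by
  \<open>- l / 2\<close> times the volume of the unit ball. Integrating from \<open>\<delta>\<close> to \<open>r\<close> gives the factor
  \<open>1 / 4\<close>.\<close>
lemma ker_average_mono:
  assumes w: "wsol f u g" and f: "AE y in M. 0 \<le> f y" "AE y in M. f y \<le> 1" and dr: "0 < \<delta>" "\<delta> \<le> r"
  shows "(average u x \<delta>) \<le> (average u x r) + unit_ball_vol (real CARD('n)) / 4 * r\<^sup>2"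
proof -
  let ?n = "CARD('n)"
  let ?F = "\<lambda>l. (average u x l) + unit_ball_vol (real CARD('n)) / 4 * l\<^sup>2"
  let ?h' = "\<lambda>l y. l / (2 * l ^ ?n) * laplacian (cap x l) y"
  note sq = wsol_sq_int[OF w]
  have ui: "integrable M u" by (rule sq_int_integrable(1)[OF finite_M sq(2)])
  have c1: "continuous_on ({\<delta>/2..r+1} \<times> closure D) (\<lambda>z. ker x (fst z) (snd z))"
    unfolding ker_def using dr by (intro continuous_intros continuous_on_compose2[OF flat_exp_continuous]) auto
  obtain B where B: "\<And>l y. \<delta>/2 \<le> l \<Longrightarrow> l \<le> r+1 \<Longrightarrow> y \<in> D \<Longrightarrow> \<bar>ker x l y\<bar> \<le> B"
    using bounded_on_closure[OF c1] by metis
  have c2: "continuous_on ({\<delta>/2..r+1} \<times> closure D) (\<lambda>z. ?h' (fst z) (snd z))"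
    unfolding laplacian_cap using dr by (intro continuous_intros continuous_on_compose2[OF flat_exp_continuous]) auto
  obtain B' where B': "\<And>l y. \<delta>/2 \<le> l \<Longrightarrow> l \<le> r+1 \<Longrightarrow> y \<in> D \<Longrightarrow> \<bar>?h' l y\<bar> \<le> B'"
    using bounded_on_closure[OF c2] by metis
  have "?F \<delta> \<le> ?F r"
  proof (rule DERIV_nonneg_imp_nondecreasing[OF dr(2)])
    fix l assume l: "\<delta> \<le> l" "l \<le> r"
    then have l0: "0 < l" using dr by simp
    have lap: "smooth (laplacian (cap x l))" for l
      unfolding laplacian_def[abs_def] by (intro smooth_sum smooth_partial_deriv smooth_cap)
    have D: "((\<lambda>l. LINT y|M. u y * ker x l y) has_real_derivative (LINT y|M. u y * ?h' l y)) (at l)"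
    proof (rule DERIV_integral_kernel[OF ui, where a="\<delta>/2" and b="r+1" and B="max B B'"])
      show "((\<lambda>l. ker x l y) has_real_derivative ?h' l y) (at l)" if "\<delta>/2 < l" for l y
        using that dr by (intro DERIV_ker) simp
      show "\<bar>ker x l y\<bar> \<le> max B B'" if "\<delta>/2 < l" "l < r+1" "y \<in> space M" for l y
        using B[of l y] that by simp
      show "\<bar>?h' l y\<bar> \<le> max B B'" if "\<delta>/2 < l" "l < r+1" "y \<in> space M" for l y
        using B'[of l y] that by simp
      show "ker x l \<in> borel_measurable M" for l
        by (rule borel_measurable_lebesgue_on[OF smooth_measurable[OF smooth_ker]])
      show "?h' l \<in> borel_measurable M" for l
        by (rule borel_measurable_lebesgue_on[OF smooth_measurable[OF smooth_cmult[OF lap]]])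
    qed (use l dr in simp_all)
    have "(LINT y|M. u y * ?h' l y) = l / (2 * l ^ ?n) * (LINT y|M. u y * laplacian (cap x l) y)"
      by (simp add: mult.left_commute)
    also have "(LINT y|M. u y * laplacian (cap x l) y) = - (LINT y|M. g y \<bullet> grad (cap x l) y)"
      using h10_laplacian[OF wsol_h10[OF w] smooth_cap[of x l]] by simp
    finally have eq: "(LINT y|M. u y * ?h' l y) = - (l / (2 * l ^ ?n) * (LINT y|M. g y \<bullet> grad (cap x l) y))"
      by simp
    have "(LINT y|M. g y \<bullet> grad (cap x l) y) \<le> unit_ball_vol (real CARD('n)) * l ^ ?n"
      using wsol_subsolution[OF w f(1) smooth_cap cap_nonneg, of x l] cap_integral_le[OF l0 sq(1) f, of x] by linarith
    then have "l / (2 * l ^ ?n) * (LINT y|M. g y \<bullet> grad (cap x l) y) \<le> l / (2 * l ^ ?n) * (unit_ball_vol (real CARD('n)) * l ^ ?n)"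
      using l0 by (intro mult_left_mono) auto
    also have "\<dots> = unit_ball_vol (real CARD('n)) / 2 * l" using l0 by simp
    finally have "0 \<le> (LINT y|M. u y * ?h' l y) + unit_ball_vol (real CARD('n)) / 2 * l" using eq by linarith
    moreover have "((\<lambda>l. unit_ball_vol (real CARD('n)) / 4 * l\<^sup>2) has_real_derivative unit_ball_vol (real CARD('n)) / 2 * l) (at l)"
      by (auto intro!: derivative_eq_intros)
    from DERIV_add[OF D this] have "(?F has_real_derivative (LINT y|M. u y * ?h' l y) + unit_ball_vol (real CARD('n)) / 2 * l) (at l)" .
    ultimately show "\<exists>y. (?F has_real_derivative y) (at l) \<and> 0 \<le> y" by blast
  qed
  moreover have "0 \<le> unit_ball_vol (real CARD('n)) / 4 * \<delta>\<^sup>2" by simp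
  ultimately show ?thesis by linarith
qed

lemma ker_integral_le: "0 < l \<Longrightarrow> (LINT y|M. ker x l y) \<le> kmass TYPE('n)"
  by (rule integral_M_le[where F="ker x l"])
     (simp_all add: nn_integral_ker ker_nonneg kmass_pos less_imp_le smooth_measurable smooth_ker
       sq_int_integrable(1)[OF finite_M smooth_sq_int(1)])

lemma ker_average_le:
  assumes u: "sq_int M u" "AE y in M. u y \<le> S" and S: "0 \<le> S" and l: "0 < l"
  shows "(average u x l) \<le> S * kmass TYPE('n)"
proof -
  have "(average u x l) \<le> (LINT y|M. S * ker x l y)"
  proof (rule integral_mono_AE)
    show "AE y in M. u y * ker x l y \<le> S * ker x l y"
      using u(2) by eventually_elim (intro mult_right_mono ker_nonneg l)
    show "integrable M (\<lambda>y. S * ker x l y)"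
      by (intro integrable_mult_right sq_int_integrable(1)[OF finite_M smooth_sq_int(1)] smooth_ker)
  qed (rule sq_int_times_ker[OF u(1)])
  also have "\<dots> \<le> S * kmass TYPE('n)"
    using ker_integral_le[OF l, of x] S by (simp add: mult_left_mono)
  finally show ?thesis .
qed

lemma ker_le: "0 < l \<Longrightarrow> ker x l y \<le> 2 / l ^ CARD('n)"
  for x y :: "real^'n"
  unfolding ker_def using flat_exp_bound[of 2] by (intro divide_right_mono) (simp_all add: numeral_2_eq_2)

lemma ker_average_le_L2:
  assumes u: "sq_int M u" and l: "0 < l"
  shows "(average u x l) \<le> 2 / l ^ CARD('n) * (sqrt (measure lebesgue D) * L2_norm M u)"
proof -
  have ui: "integrable M u" by (rule sq_int_integrable(1)[OF finite_M u])
  have "(average u x l) \<le> (LINT y|M. 2 / l ^ CARD('n) * \<bar>u y\<bar>)"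
  proof (rule integral_mono_AE[OF sq_int_times_ker[OF u]])
    show "AE y in M. u y * ker x l y \<le> 2 / l ^ CARD('n) * \<bar>u y\<bar>"
    proof (rule AE_I2)
      fix y
      have "u y * ker x l y \<le> \<bar>u y\<bar> * ker x l y" using ker_nonneg[OF l] by (intro mult_right_mono) auto
      also have "\<dots> \<le> \<bar>u y\<bar> * (2 / l ^ CARD('n))" using ker_le[OF l] by (intro mult_left_mono) auto
      finally show "u y * ker x l y \<le> 2 / l ^ CARD('n) * \<bar>u y\<bar>" by (simp only: mult.commute)
    qed
  qed (use ui in simp)
  also have "\<dots> = 2 / l ^ CARD('n) * (LINT y|M. \<bar>u y\<bar>)" by simp
  also have "\<dots> \<le> 2 / l ^ CARD('n) * (sqrt (measure lebesgue D) * L2_norm M u)"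
    using sq_int_integrable(2)[OF finite_M u] l unfolding measure_M by (intro mult_left_mono) auto
  finally show ?thesis .
qed

text \<open>Uniform continuity on a ball slightly larger than \<open>D\<close> makes the scale \<open>d\<close> independent of the
  centre. The average may be taken over the whole space as \<open>\<phi>\<close> vanishes outside \<open>D\<close>.\<close>
lemma test_ker_average:
  assumes \<phi>: "\<phi> \<in> test_functions D" and e: "0 < e"
  obtains d where "0 < d" "\<And>l x. 0 < l \<Longrightarrow> l < d \<Longrightarrow> x \<in> D \<Longrightarrow> kmass TYPE('n) * \<phi> x \<le> (average \<phi> x l) + e * kmass TYPE('n)"
proof -
  obtain R where R: "\<And>x. x \<in> D \<Longrightarrow> norm x \<le> R" using bounded_D by (auto simp: bounded_iff)
  have "uniformly_continuous_on (cball 0 (R + 1)) \<phi>"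
    by (intro compact_uniformly_continuous smooth_continuous test_smooth[OF \<phi>] compact_cball)
  then obtain d where d: "0 < d" "\<And>x y. x \<in> cball 0 (R + 1) \<Longrightarrow> y \<in> cball 0 (R + 1) \<Longrightarrow> dist y x < d \<Longrightarrow> dist (\<phi> y) (\<phi> x) < e"
    using e unfolding uniformly_continuous_on_def by metis
  have "kmass TYPE('n) * \<phi> x \<le> (average \<phi> x l) + e * kmass TYPE('n)" if l: "0 < l" "l < min d 1" and x: "x \<in> D" for l x
  proof -
    have [measurable]: "ker x l \<in> borel_measurable borel" by (rule smooth_measurable[OF smooth_ker])
    have ki: "integrable lborel (ker x l)"
      using nn_integral_ker[OF l(1), of x] ker_nonneg[OF l(1)]
      by (intro integrableI_nonneg) auto
    have kI: "(LINT y|lborel. ker x l y) = kmass TYPE('n)"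
      using ki nn_integral_ker[OF l(1), of x] ker_nonneg[OF l(1)] kmass_pos[where 'n='n]
      by (subst integral_eq_nn_integral) (auto simp: less_imp_le)
    have pk: "(\<lambda>y. \<phi> y * ker x l y) \<in> test_functions D" by (rule test_mult_smooth[OF \<phi> smooth_ker])
    have "\<phi> x * ker x l y \<le> \<phi> y * ker x l y + e * ker x l y" for y
    proof (cases "norm (y - x) < l")
      case True
      have "norm y \<le> norm x + norm (y - x)" by (metis add.commute diff_add_cancel norm_triangle_ineq)
      then have "x \<in> cball 0 (R + 1)" "y \<in> cball 0 (R + 1)" using True R[OF x] l by auto
      then have "\<phi> x \<le> \<phi> y + e" using d(2)[of x y] True l by (auto simp: dist_norm)
      then have "\<phi> x * ker x l y \<le> (\<phi> y + e) * ker x l y" using ker_nonneg[OF l(1)] by (intro mult_right_mono)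
      then show ?thesis by (simp add: distrib_right)
    next
      case False
      then have "ker x l y = 0" by (intro ker_zero l) simp
      then show ?thesis by simp
    qed
    then have "(LINT y|lborel. \<phi> x * ker x l y) \<le> (LINT y|lborel. \<phi> y * ker x l y + e * ker x l y)"
      using ki test_integrable_lborel[OF pk] by (intro integral_mono) auto
    also have "\<dots> = (LINT y|lborel. \<phi> y * ker x l y) + e * kmass TYPE('n)"
      using ki kI test_integrable_lborel[OF pk] by simp
    also have "(LINT y|lborel. \<phi> y * ker x l y) = (average \<phi> x l)"
      using test_outside[OF pk] smooth_measurable[OF test_smooth[OF pk]]
      by (intro integral_lebesgue_on_eq_lborel[symmetric]) auto
    finally show ?thesis using kI by (simp add: mult.commute)
  qed
  then show ?thesis using that[of "min d 1"] d(1) by auto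
qed

lemma ennreal_zero_if_le_all: "(\<And>s. 0 < s \<Longrightarrow> X \<le> ennreal s) \<Longrightarrow> X = 0"
  by (metis ennreal_zero_less_mult_iff ennreal_le_epsilon add_0 ennreal_0 le_zero_eq zero_le)

text \<open>For a test function in place of \<open>u\<close> the averages at small scale approximate its values. The
  error of replacing \<open>u\<close> by an approximating test function is small in the mean, uniformly in the
  scale: by Tonelli's theorem averaging multiplies an integral by at most the mass of the kernel.\<close>
lemma AE_le_if_ker_averages_le:
  assumes u: "h10 u g"
    and S: "\<And>d. 0 < d \<Longrightarrow> \<exists>l. 0 < l \<and> l < d \<and> (\<forall>x\<in>D. (average u x l) \<le> S * kmass TYPE('n))"
  shows "AE x in M. u x \<le> S"
proof -
  obtain \<phi> where \<phi>: "\<And>k. \<phi> k \<in> test_functions D" "L2_lim M \<phi> u"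
    using u unfolding h10_def by metis
  note sq = h10_sq_int(1)[OF u]
  have [measurable]: "u \<in> borel_measurable M" by (rule sq_int_measurable[OF sq])
  have km: "0 < kmass TYPE('n)" by (rule kmass_pos)
  \<comment> \<open>The excess of \<open>u\<close> over the bound; its integral is shown to be smaller than every \<open>s > 0\<close>.\<close>
  define P where "P x = max 0 (u x - S)" for x
  have [measurable]: "P \<in> borel_measurable M" unfolding P_def by measurable
  have bound: "ennreal (kmass TYPE('n)) * (\<integral>\<^sup>+ x. ennreal (P x) \<partial>M) \<le> ennreal (2 * kmass TYPE('n) * (LINT x|M. \<bar>u x - \<phi> k x\<bar>) + e * kmass TYPE('n) * measure M (space M))"
    if e: "0 < e" for e k
  proof -
    define w where "w x = \<bar>u x - \<phi> k x\<bar>" for x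
    have wsq: "sq_int M (\<lambda>x. u x - \<phi> k x)" by (rule sq_int_diff[OF sq test_sq_int(1)[OF \<phi>(1)]])
    have [measurable]: "w \<in> borel_measurable M" unfolding w_def using sq_int_measurable[OF wsq] by simp
    have wi: "integrable M w" unfolding w_def using sq_int_integrable(1)[OF finite_M wsq] by simp
    obtain d where d: "0 < d" "\<And>l x. 0 < l \<Longrightarrow> l < d \<Longrightarrow> x \<in> D \<Longrightarrow> kmass TYPE('n) * \<phi> k x \<le> (average (\<phi> k) x l) + e * kmass TYPE('n)"
      using test_ker_average[OF \<phi>(1) e] by metis
    obtain l where l: "0 < l" "l < d" "\<And>x. x \<in> D \<Longrightarrow> (average u x l) \<le> S * kmass TYPE('n)"
      using S[OF d(1)] by blast
    have wk: "integrable M (\<lambda>y. w y * ker x l y)" for x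
    proof (rule sq_int_times_ker)
      show "sq_int M w" using wsq \<open>w \<in> borel_measurable M\<close> by (simp add: sq_int_def w_def)
    qed
    have wkn: "0 \<le> w y * ker x l y" for x y
      by (intro mult_nonneg_nonneg ker_nonneg l(1)) (simp add: w_def)
    have point: "kmass TYPE('n) * P x \<le> kmass TYPE('n) * w x + e * kmass TYPE('n) + (average w x l)" if x: "x \<in> D" for x
    proof -
      have "kmass TYPE('n) * u x = kmass TYPE('n) * (u x - \<phi> k x) + kmass TYPE('n) * \<phi> k x" by (simp add: algebra_simps)
      also have "\<dots> \<le> kmass TYPE('n) * w x + ((average (\<phi> k) x l) + e * kmass TYPE('n))"
        using d(2)[OF l(1,2) x] km by (intro add_mono mult_left_mono) (auto simp: w_def)
      also have "(average (\<phi> k) x l) \<le> (LINT y|M. u y * ker x l y + w y * ker x l y)"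
      proof (rule integral_mono)
        show "integrable M (\<lambda>y. \<phi> k y * ker x l y)" by (rule sq_int_times_ker[OF test_sq_int(1)[OF \<phi>(1)]])
        show "integrable M (\<lambda>y. u y * ker x l y + w y * ker x l y)"
          by (intro Bochner_Integration.integrable_add sq_int_times_ker[OF sq] wk)
        show "\<phi> k y * ker x l y \<le> u y * ker x l y + w y * ker x l y" for y
        proof -
          have "\<phi> k y * ker x l y \<le> (u y + w y) * ker x l y"
            using ker_nonneg[OF l(1)] by (intro mult_right_mono) (auto simp: w_def)
          then show ?thesis by (simp add: distrib_right)
        qed
      qed
      also have "\<dots> = (average u x l) + (average w x l)"
        by (intro Bochner_Integration.integral_add sq_int_times_ker[OF sq] wk)
      finally have "kmass TYPE('n) * (u x - S) \<le> kmass TYPE('n) * w x + e * kmass TYPE('n) + (average w x l)"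
        using l(3)[OF x] by (simp add: algebra_simps)
      moreover have "0 \<le> kmass TYPE('n) * w x + e * kmass TYPE('n) + (average w x l)"
        using km e ker_nonneg[OF l(1)] by (intro add_nonneg_nonneg mult_nonneg_nonneg Bochner_Integration.integral_nonneg) (auto simp: w_def)
      ultimately show ?thesis by (simp add: P_def max_def)
    qed
    have kerM [measurable]: "(\<lambda>z. ker (fst z) l (snd z)) \<in> borel_measurable (M \<Otimes>\<^sub>M M)"
    proof -
      have [measurable]: "(\<lambda>x. x) \<in> M \<rightarrow>\<^sub>M borel"
        by (rule borel_measurable_lebesgue_on) simp
      show ?thesis unfolding ker_def by measurable
    qed
    have "(\<integral>\<^sup>+ x. (\<integral>\<^sup>+ y. ennreal (w y * ker x l y) \<partial>M) \<partial>M) = (\<integral>\<^sup>+ y. (\<integral>\<^sup>+ x. ennreal (w y * ker x l y) \<partial>M) \<partial>M)"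
    proof -
      interpret P: pair_sigma_finite M M by unfold_locales
      show ?thesis
        by (rule P.Fubini'[symmetric]) (use kerM in \<open>simp add: split_beta'\<close>)
    qed
    also have "\<dots> \<le> (\<integral>\<^sup>+ y. ennreal (w y) * ennreal (kmass TYPE('n)) \<partial>M)"
    proof (rule nn_integral_mono)
      fix y
      have w0: "0 \<le> w y" by (simp add: w_def)
      have [measurable]: "ker y l \<in> borel_measurable borel" by (rule smooth_measurable[OF smooth_ker])
      have "(\<integral>\<^sup>+ x. ennreal (w y * ker x l y) \<partial>M) = (\<integral>\<^sup>+ x. ennreal (w y) * ennreal (ker y l x) \<partial>M)"
        unfolding ker_commute[of _ l y] by (intro nn_integral_cong ennreal_mult w0 ker_nonneg l(1))
      also have "\<dots> = ennreal (w y) * (\<integral>\<^sup>+ x. ennreal (ker y l x) \<partial>M)"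
        by (intro nn_integral_cmult measurable_compose[OF borel_measurable_lebesgue_on[OF smooth_measurable[OF smooth_ker]]]) simp
      also have "\<dots> \<le> ennreal (w y) * ennreal (kmass TYPE('n))"
        using nn_integral_M_le[of "\<lambda>x. ennreal (ker y l x)"] nn_integral_ker[OF l(1), of y]
        by (intro mult_left_mono) auto
      finally show "(\<integral>\<^sup>+ x. ennreal (w y * ker x l y) \<partial>M) \<le> ennreal (w y) * ennreal (kmass TYPE('n))" .
    qed
    also have "\<dots> = (\<integral>\<^sup>+ y. ennreal (w y) \<partial>M) * ennreal (kmass TYPE('n))" by (rule nn_integral_multc) simp
    also have "(\<integral>\<^sup>+ y. ennreal (w y) \<partial>M) = ennreal (LINT y|M. w y)"
      by (rule nn_integral_eq_integral[OF wi]) (simp add: w_def)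
    finally have dbl: "(\<integral>\<^sup>+ x. (\<integral>\<^sup>+ y. ennreal (w y * ker x l y) \<partial>M) \<partial>M) \<le> ennreal (LINT y|M. w y) * ennreal (kmass TYPE('n))" .
    have "ennreal (kmass TYPE('n)) * (\<integral>\<^sup>+ x. ennreal (P x) \<partial>M) = (\<integral>\<^sup>+ x. ennreal (kmass TYPE('n)) * ennreal (P x) \<partial>M)"
      by (intro nn_integral_cmult[symmetric]) simp
    also have "\<dots> \<le> (\<integral>\<^sup>+ x. ennreal (kmass TYPE('n) * w x) + (ennreal (e * kmass TYPE('n)) + (\<integral>\<^sup>+ y. ennreal (w y * ker x l y) \<partial>M)) \<partial>M)"
    proof (rule nn_integral_mono)
      fix x assume x: "x \<in> space M"
      have "ennreal (kmass TYPE('n)) * ennreal (P x) = ennreal (kmass TYPE('n) * P x)" using km by (simp add: ennreal_mult P_def)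
      also have "\<dots> \<le> ennreal (kmass TYPE('n) * w x + e * kmass TYPE('n) + (average w x l))"
        using point x by (intro ennreal_leI) simp
      also have "\<dots> = ennreal (kmass TYPE('n) * w x) + (ennreal (e * kmass TYPE('n)) + ennreal (average w x l))"
      proof -
        have "0 \<le> kmass TYPE('n) * w x" "0 \<le> e * kmass TYPE('n)" using km e by (simp_all add: w_def)
        moreover have "0 \<le> (average w x l)"
          using wkn by (intro Bochner_Integration.integral_nonneg)
        ultimately show ?thesis by (simp only: ennreal_plus add_nonneg_nonneg add.assoc)
      qed
      also have "ennreal (average w x l) = (\<integral>\<^sup>+ y. ennreal (w y * ker x l y) \<partial>M)"
        using wkn by (intro nn_integral_eq_integral[OF wk, symmetric]) simp
      finally show "ennreal (kmass TYPE('n)) * ennreal (P x) \<le> ennreal (kmass TYPE('n) * w x) + (ennreal (e * kmass TYPE('n)) + (\<integral>\<^sup>+ y. ennreal (w y * ker x l y) \<partial>M))" .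
    qed
    also have "\<dots> = (\<integral>\<^sup>+ x. ennreal (kmass TYPE('n) * w x) \<partial>M) + ((\<integral>\<^sup>+ x. ennreal (e * kmass TYPE('n)) \<partial>M) + (\<integral>\<^sup>+ x. (\<integral>\<^sup>+ y. ennreal (w y * ker x l y) \<partial>M) \<partial>M))"
    proof -
      have [measurable]: "(\<lambda>x. \<integral>\<^sup>+ y. ennreal (w y * ker x l y) \<partial>M) \<in> borel_measurable M"
        by (rule borel_measurable_nn_integral) (use kerM in \<open>simp add: split_beta'\<close>)
      show ?thesis by (subst nn_integral_add; simp add: nn_integral_add)
    qed
    also have "\<dots> \<le> ennreal (kmass TYPE('n) * (LINT x|M. w x)) + (ennreal (e * kmass TYPE('n) * measure M (space M)) + ennreal (LINT y|M. w y) * ennreal (kmass TYPE('n)))"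
    proof (intro add_mono dbl)
      have "(\<integral>\<^sup>+ x. ennreal (kmass TYPE('n) * w x) \<partial>M) = ennreal (LINT x|M. kmass TYPE('n) * w x)"
      proof (rule nn_integral_eq_integral)
        show "integrable M (\<lambda>x. kmass TYPE('n) * w x)" using wi by simp
        show "AE x in M. 0 \<le> kmass TYPE('n) * w x" using km by (simp add: w_def)
      qed
      then show "(\<integral>\<^sup>+ x. ennreal (kmass TYPE('n) * w x) \<partial>M) \<le> ennreal (kmass TYPE('n) * (LINT x|M. w x))" by simp
      show "(\<integral>\<^sup>+ x. ennreal (e * kmass TYPE('n)) \<partial>M) \<le> ennreal (e * kmass TYPE('n) * measure M (space M))"
        using e km by (simp add: emeasure_eq_measure ennreal_mult)
    qed
    also have "\<dots> = ennreal (2 * kmass TYPE('n) * (LINT x|M. w x) + e * kmass TYPE('n) * measure M (space M))"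
    proof -
      let ?W = "LINT x|M. w x"
      have W: "0 \<le> ?W" by (simp add: w_def)
      have "ennreal ?W * ennreal (kmass TYPE('n)) = ennreal (?W * kmass TYPE('n))"
        using W km by (intro ennreal_mult[symmetric]) auto
      moreover have "0 \<le> kmass TYPE('n) * ?W" "0 \<le> e * kmass TYPE('n) * measure M (space M)" "0 \<le> ?W * kmass TYPE('n)"
        using W km e by simp_all
      moreover have "2 * kmass TYPE('n) * ?W + e * kmass TYPE('n) * measure M (space M)
          = kmass TYPE('n) * ?W + (e * kmass TYPE('n) * measure M (space M) + ?W * kmass TYPE('n))" by simp
      ultimately show ?thesis by (simp only: ennreal_plus add_nonneg_nonneg)
    qed
    finally show ?thesis unfolding w_def .
  qed
  have "(\<integral>\<^sup>+ x. ennreal (P x) \<partial>M) = 0"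
  proof (rule ennreal_zero_if_le_all)
    fix s :: real assume s: "0 < s"
    define \<mu> where "\<mu> = measure M (space M)"
    have \<mu>: "0 \<le> \<mu>" by (simp add: \<mu>_def)
    define c where "c = sqrt \<mu>"
    have c0: "0 \<le> c" using \<mu> by (simp add: c_def)
    obtain k where k: "norm (L2_norm M (\<lambda>x. \<phi> k x - u x) - 0) < s / (4 * (c + 1))"
      using LIMSEQ_D[of "\<lambda>k. L2_norm M (\<lambda>x. \<phi> k x - u x)" 0 "s / (4 * (c + 1))"] \<phi>(2) s c0
      by (auto simp: L2_lim_def)
    have "(LINT x|M. \<bar>u x - \<phi> k x\<bar>) \<le> c * L2_norm M (\<lambda>x. u x - \<phi> k x)"
      using sq_int_integrable(2)[OF finite_M sq_int_diff[OF sq test_sq_int(1)[OF \<phi>(1)]]] by (simp add: c_def \<mu>_def)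
    also have "\<dots> \<le> (c + 1) * (s / (4 * (c + 1)))"
      using k c0 s by (intro mult_mono) (auto simp: L2_norm_minus_commute[of M u])
    also have "\<dots> = s / 4" using c0 by (simp add: field_simps)
    finally have 1: "(LINT x|M. \<bar>u x - \<phi> k x\<bar>) \<le> s / 4" .
    let ?e = "s / (2 * (\<mu> + 1))"
    have e: "0 < ?e" using s \<mu> by simp
    have 2: "?e * \<mu> \<le> s / 2" using s \<mu> by (simp add: field_simps)
    have "2 * kmass TYPE('n) * (LINT x|M. \<bar>u x - \<phi> k x\<bar>) + ?e * kmass TYPE('n) * \<mu> \<le> kmass TYPE('n) * s"
    proof -
      have "2 * (LINT x|M. \<bar>u x - \<phi> k x\<bar>) + ?e * \<mu> \<le> s" using 1 2 by linarith
      then have "kmass TYPE('n) * (2 * (LINT x|M. \<bar>u x - \<phi> k x\<bar>) + ?e * \<mu>) \<le> kmass TYPE('n) * s" using km by (intro mult_left_mono) auto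
      then show ?thesis by (simp add: algebra_simps)
    qed
    from order_trans[OF bound[OF e, of k, folded \<mu>_def] ennreal_leI[OF this]]
    have "ennreal (kmass TYPE('n)) * (\<integral>\<^sup>+ x. ennreal (P x) \<partial>M) \<le> ennreal (kmass TYPE('n)) * ennreal s"
      using km s by (simp only: ennreal_mult[OF less_imp_le less_imp_le])
    then show "(\<integral>\<^sup>+ x. ennreal (P x) \<partial>M) \<le> ennreal s"
      using km by (subst (asm) ennreal_mult_le_mult_iff) auto
  qed
  then have "AE x in M. ennreal (P x) = 0" by (subst (asm) nn_integral_0_iff_AE) auto
  then show ?thesis by eventually_elim (auto simp: P_def max_def split: if_splits)
qed

section \<open>Right hand sides between 0 and 1\<close>


lemma Linf_I:
  assumes "f \<in> borel_measurable M" "AE x in M. \<bar>f x\<bar> \<le> B" "0 \<le> B"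
  shows "f \<in> Linf D" "Linf_norm D f \<le> B"
proof -
  have m: "(\<lambda>x. ereal \<bar>f x\<bar>) \<in> borel_measurable M" using assms(1) by measurable
  have le: "esssup M (\<lambda>x. ereal \<bar>f x\<bar>) \<le> ereal B"
    using assms(2) by (intro esssup_I m) auto
  then show "f \<in> Linf D" using assms(1) by (auto simp: Linf_def less_ereal.simps intro: le_less_trans)
  show "Linf_norm D f \<le> B" using le assms(3) unfolding Linf_norm_def
    by (cases "esssup M (\<lambda>x. ereal \<bar>f x\<bar>)") auto
qed

lemma Linf_measurable: "f \<in> Linf D \<Longrightarrow> f \<in> borel_measurable M"
  by (simp add: Linf_def)

lemma Linf_AE:
  assumes "f \<in> Linf D" shows "AE x in M. \<bar>f x\<bar> \<le> Linf_norm D f"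
  using esssup_AE[where M=M and f="\<lambda>x. ereal \<bar>f x\<bar>"]
proof eventually_elim
  case (elim x)
  then show ?case using assms unfolding Linf_def Linf_norm_def
    by (cases "esssup M (\<lambda>x. ereal \<bar>f x\<bar>)") auto
qed

lemma Linf_norm_nonneg:
  assumes "f \<in> Linf D" shows "0 \<le> Linf_norm D f"
proof (rule ccontr)
  assume neg: "\<not> 0 \<le> Linf_norm D f"
  have "AE x in M. ereal \<bar>f x\<bar> \<le> - \<infinity>"
    using Linf_AE[OF assms] by eventually_elim (use neg in linarith)
  then have "esssup M (\<lambda>x. ereal \<bar>f x\<bar>) \<le> - \<infinity>"
    using Linf_measurable[OF assms] by (intro esssup_I) measurable
  then have "Linf_norm D f = 0" by (simp add: Linf_norm_def)
  then show False using neg by simp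
qed

lemma Linf_sq_int: "f \<in> Linf D \<Longrightarrow> sq_int M f"
  using Linf_AE Linf_measurable by (intro sq_int_bounded[OF finite_M]) auto

lemma Linf_linear:
  assumes "f \<in> Linf D" "h \<in> Linf D"
  shows "(\<lambda>x. a * f x + b * h x) \<in> Linf D"
    "Linf_norm D (\<lambda>x. a * f x + b * h x) \<le> \<bar>a\<bar> * Linf_norm D f + \<bar>b\<bar> * Linf_norm D h"
proof -
  have m: "(\<lambda>x. a * f x + b * h x) \<in> borel_measurable M"
    using assms[THEN Linf_measurable] by measurable
  have "AE x in M. \<bar>a * f x + b * h x\<bar> \<le> \<bar>a\<bar> * Linf_norm D f + \<bar>b\<bar> * Linf_norm D h"
    using Linf_AE[OF assms(1)] Linf_AE[OF assms(2)]
  proof eventually_elim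
    case (elim x)
    have "\<bar>a * f x + b * h x\<bar> \<le> \<bar>a\<bar> * \<bar>f x\<bar> + \<bar>b\<bar> * \<bar>h x\<bar>"
      by (metis abs_mult abs_triangle_ineq)
    also have "\<dots> \<le> \<bar>a\<bar> * Linf_norm D f + \<bar>b\<bar> * Linf_norm D h"
      using elim by (intro add_mono mult_left_mono) auto
    finally show ?case .
  qed
  moreover have "0 \<le> \<bar>a\<bar> * Linf_norm D f + \<bar>b\<bar> * Linf_norm D h"
    using assms[THEN Linf_norm_nonneg] by simp
  ultimately show "(\<lambda>x. a * f x + b * h x) \<in> Linf D"
    "Linf_norm D (\<lambda>x. a * f x + b * h x) \<le> \<bar>a\<bar> * Linf_norm D f + \<bar>b\<bar> * Linf_norm D h"
    using Linf_I[OF m] by blast+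
qed

lemma Linf_scale:
  assumes f: "f \<in> Linf D"
  shows "(\<lambda>x. c * f x) \<in> Linf D" "Linf_norm D (\<lambda>x. c * f x) = \<bar>c\<bar> * Linf_norm D f"
proof -
  have up: "(\<lambda>x. c * f x) \<in> Linf D \<and> Linf_norm D (\<lambda>x. c * f x) \<le> \<bar>c\<bar> * Linf_norm D f"
    if "f \<in> Linf D" for c f
    using Linf_linear[OF that that, of c 0] by simp
  then show cf: "(\<lambda>x. c * f x) \<in> Linf D" using f by blast
  show "Linf_norm D (\<lambda>x. c * f x) = \<bar>c\<bar> * Linf_norm D f"
  proof (cases "c = 0")
    case True
    then show ?thesis using up[OF f, of c] Linf_norm_nonneg[OF cf] by simp
  next
    case False
    have "Linf_norm D f \<le> \<bar>1 / c\<bar> * Linf_norm D (\<lambda>x. c * f x)"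
      using up[OF cf, of "1 / c"] False by simp
    then have "\<bar>c\<bar> * Linf_norm D f \<le> \<bar>c\<bar> * (\<bar>1 / c\<bar> * Linf_norm D (\<lambda>x. c * f x))"
      by (intro mult_left_mono) auto
    also have "\<dots> = Linf_norm D (\<lambda>x. c * f x)" using False by (simp add: abs_div)
    finally show ?thesis using up[OF f, of c] by simp
  qed
qed

text \<open>The admissible right hand sides of total mass \<open>t\<close>.\<close>
definition adm :: "real \<Rightarrow> (real^'n \<Rightarrow> real) \<Rightarrow> bool" where
  "adm t f \<longleftrightarrow> f \<in> borel_measurable M \<and> (AE x in M. 0 \<le> f x) \<and> (AE x in M. f x \<le> 1) \<and> (LINT x|M. f x) = t"

lemma admD:
  assumes "adm t f"
  shows "f \<in> borel_measurable M" "AE x in M. 0 \<le> f x" "AE x in M. f x \<le> 1" "(LINT x|M. f x) = t"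
    "f \<in> Linf D" "sq_int M f" "integrable M f" "0 \<le> t" "t \<le> measure lebesgue D"
proof -
  show a: "f \<in> borel_measurable M" "AE x in M. 0 \<le> f x" "AE x in M. f x \<le> 1" "(LINT x|M. f x) = t"
    using assms by (auto simp: adm_def)
  have "AE x in M. \<bar>f x\<bar> \<le> 1" using a(2,3) by eventually_elim simp
  then show l: "f \<in> Linf D" using Linf_I[OF a(1)] by simp
  then show "sq_int M f" by (rule Linf_sq_int)
  then show i: "integrable M f" by (rule sq_int_integrable(1)[OF finite_M])
  show "0 \<le> t" using a(2) by (subst a(4)[symmetric]) (rule integral_nonneg_AE)
  have "(LINT x|M. f x) \<le> (LINT x|M. 1)" using a(3) i by (intro integral_mono_AE) auto
  then show "t \<le> measure lebesgue D" using a(4) by (simp add: measure_M[simplified])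
qed

lemma adm_L2_norm: assumes "adm t f" shows "L2_norm M f \<le> sqrt t"
proof -
  note a = admD[OF assms]
  have "(LINT x|M. (norm (f x))\<^sup>2) \<le> (LINT x|M. f x)"
  proof (rule integral_mono_AE)
    show "AE x in M. (norm (f x))\<^sup>2 \<le> f x"
      using a(2,3) by eventually_elim (simp add: power2_eq_square mult_left_le)
  qed (use a in \<open>simp_all add: sq_int_def\<close>)
  then show ?thesis using a(4) by (simp add: L2_norm_def)
qed

lemma adm_combine:
  assumes "adm t f" "adm s h" "0 \<le> a" "0 \<le> b" "a + b \<le> 1"
  shows "adm (a * t + b * s) (\<lambda>x. a * f x + b * h x)"
proof -
  note f = admD[OF assms(1)] and h = admD[OF assms(2)]
  have "AE x in M. 0 \<le> a * f x + b * h x" using f(2) h(2) by eventually_elim (use assms in simp)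
  moreover have "AE x in M. a * f x + b * h x \<le> 1" using f(3) h(3)
  proof eventually_elim
    case (elim x)
    have "a * f x + b * h x \<le> a * 1 + b * 1" using elim assms by (intro add_mono mult_left_mono) auto
    then show ?case using assms(5) by simp
  qed
  moreover have "(LINT x|M. a * f x + b * h x) = a * t + b * s" using f h by simp
  ultimately show ?thesis using f(1) h(1) by (simp add: adm_def)
qed

lemma adm_ex: assumes "0 \<le> t" "t \<le> measure lebesgue D" obtains f where "adm t f"
proof
  let ?\<mu> = "measure lebesgue D"
  have "0 \<le> t / ?\<mu>" "t / ?\<mu> \<le> 1" using assms by (auto simp: divide_le_eq_1)
  moreover have "t / ?\<mu> * ?\<mu> = t" using assms by (cases "?\<mu> = 0") auto
  ultimately show "adm t (\<lambda>x. t / ?\<mu>)" by (simp add: adm_def measure_M[simplified] mult.commute)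
qed

lemma AE_bound_from_averages:
  assumes a: "adm t f" and w: "wsol f u g" and r: "0 < r"
    and T: "\<And>x. x \<in> D \<Longrightarrow> (average u x r) \<le> T"
  shows "AE x in M. u x \<le> (T + unit_ball_vol (real CARD('n)) / 4 * r\<^sup>2) / kmass TYPE('n)"
proof (rule AE_le_if_ker_averages_le[OF wsol_h10[OF w]])
  fix d :: real assume d: "0 < d"
  let ?l = "min (d / 2) r"
  have l: "0 < ?l" "?l < d" "?l \<le> r" using d r by auto
  have "(average u x ?l) \<le> (T + unit_ball_vol (real CARD('n)) / 4 * r\<^sup>2) / kmass TYPE('n) * kmass TYPE('n)"
    if "x \<in> D" for x
    using ker_average_mono[OF w admD(2,3)[OF a] l(1,3), of x] T[OF that] kmass_pos[where 'n='n] by simp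
  then show "\<exists>l>0. l < d \<and> (\<forall>x\<in>D. (average u x l) \<le>
      (T + unit_ball_vol (real CARD('n)) / 4 * r\<^sup>2) / kmass TYPE('n) * kmass TYPE('n))"
    using l by blast
qed

text \<open>The first term bounds the averages at scale \<open>r\<close>, by the Poincare inequality; the second is the
  cost of passing from scale \<open>r\<close> to the pointwise values. The freedom in \<open>r\<close> is what makes solutions
  of small mass uniformly small.\<close>
lemma adm_bounds:
  obtains A B where "0 \<le> A" "0 \<le> B"
    "\<And>t f u g r. adm t f \<Longrightarrow> wsol f u g \<Longrightarrow> 0 < r \<Longrightarrow>
      u \<in> Linf D \<and> Linf_norm D u \<le> A / r ^ CARD('n) * sqrt t + B * r\<^sup>2"
proof
  let ?\<mu> = "sqrt (measure lebesgue D)" and ?km = "kmass TYPE('n)"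
  let ?A = "2 * ?\<mu> * Poincare_const\<^sup>2 / ?km" and ?B = "unit_ball_vol (real CARD('n)) / (4 * ?km)"
  have km: "0 < ?km" by (rule kmass_pos)
  show "0 \<le> ?A" "0 \<le> ?B" using km by simp_all
  fix t f u g and r :: real assume a: "adm t f" and w: "wsol f u g" and r: "0 < r"
  let ?T = "2 / r ^ CARD('n) * (?\<mu> * (Poincare_const\<^sup>2 * sqrt t))"
  have T: "(average u x r) \<le> ?T" for x
  proof -
    have "L2_norm M u \<le> Poincare_const\<^sup>2 * sqrt t"
      using wsol_bound[OF w] adm_L2_norm[OF a] by (meson mult_left_mono order_trans zero_le_power2)
    then have "2 / r ^ CARD('n) * (?\<mu> * L2_norm M u) \<le> ?T"
      using r by (intro mult_left_mono) auto
    then show ?thesis using ker_average_le_L2[OF wsol_sq_int(2)[OF w] r, of x] by linarith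
  qed
  have eq: "(?T + unit_ball_vol (real CARD('n)) / 4 * r\<^sup>2) / ?km = ?A / r ^ CARD('n) * sqrt t + ?B * r\<^sup>2"
    using r km by (simp add: field_simps)
  have "AE x in M. u x \<le> ?A / r ^ CARD('n) * sqrt t + ?B * r\<^sup>2"
    using AE_bound_from_averages[OF a w r T] unfolding eq .
  then have "AE x in M. \<bar>u x\<bar> \<le> ?A / r ^ CARD('n) * sqrt t + ?B * r\<^sup>2"
    using wsol_nonneg[OF w admD(2)[OF a]] by eventually_elim simp
  moreover have "0 \<le> ?A / r ^ CARD('n) * sqrt t + ?B * r\<^sup>2"
    using r km admD(8)[OF a] by simp
  ultimately show "u \<in> Linf D \<and> Linf_norm D u \<le> ?A / r ^ CARD('n) * sqrt t + ?B * r\<^sup>2"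
    using Linf_I[OF sq_int_measurable[OF wsol_sq_int(2)[OF w]]] by blast
qed

lemma adm_wsol_Linf: "adm t f \<Longrightarrow> wsol f u g \<Longrightarrow> u \<in> Linf D"
  by (metis adm_bounds zero_less_one)

lemma Linf_norm_mono:
  assumes "u \<in> borel_measurable M" "v \<in> Linf D" "AE x in M. \<bar>u x\<bar> \<le> v x"
  shows "u \<in> Linf D" "Linf_norm D u \<le> Linf_norm D v"
proof -
  have "AE x in M. \<bar>u x\<bar> \<le> Linf_norm D v"
    using assms(3) Linf_AE[OF assms(2)] by eventually_elim linarith
  then show "u \<in> Linf D" "Linf_norm D u \<le> Linf_norm D v"
    using Linf_I[OF assms(1)] Linf_norm_nonneg[OF assms(2)] by blast+
qed

section \<open>The optimal modulus\<close>

definition opt_modulus :: "real \<Rightarrow> real" where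
  "opt_modulus t = Sup {Linf_norm D u | f u g. adm t f \<and> wsol f u g}"

lemma opt_modulus_upper:
  assumes "adm t f" "wsol f u g" shows "Linf_norm D u \<le> opt_modulus t"
proof -
  obtain A B where "\<And>t f u g r. adm t f \<Longrightarrow> wsol f u g \<Longrightarrow> 0 < r \<Longrightarrow>
      u \<in> Linf D \<and> Linf_norm D u \<le> A / r ^ CARD('n) * sqrt t + B * r\<^sup>2"
    using adm_bounds by metis
  then have "bdd_above {Linf_norm D u | f u g. adm t f \<and> wsol f u g}"
    by (intro bdd_aboveI[of _ "A / 1 ^ CARD('n) * sqrt t + B * 1\<^sup>2"]) (use zero_less_one in blast)
  then show ?thesis unfolding opt_modulus_def using assms by (intro cSup_upper) auto
qed

lemma opt_modulus_nonempty:
  assumes "0 \<le> t" "t \<le> measure lebesgue D"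
  shows "{Linf_norm D u | f u g. adm t f \<and> wsol f u g} \<noteq> {}"
proof -
  obtain f where f: "adm t f" using adm_ex[OF assms] .
  obtain u g where "wsol f u g" using wsol_exists[OF admD(6)[OF f]] .
  then show ?thesis using f by blast
qed

lemma opt_modulus_least:
  assumes "0 \<le> t" "t \<le> measure lebesgue D"
    and "\<And>f u g. adm t f \<Longrightarrow> wsol f u g \<Longrightarrow> Linf_norm D u \<le> c"
  shows "opt_modulus t \<le> c"
  unfolding opt_modulus_def using opt_modulus_nonempty[OF assms(1,2)] assms(3) by (intro cSup_least) auto

lemma opt_modulus_nonneg: assumes "0 \<le> t" "t \<le> measure lebesgue D" shows "0 \<le> opt_modulus t"
proof -
  obtain f where f: "adm t f" using adm_ex[OF assms] .
  obtain u g where w: "wsol f u g" using wsol_exists[OF admD(6)[OF f]] .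
  show ?thesis using opt_modulus_upper[OF f w] Linf_norm_nonneg[OF adm_wsol_Linf[OF f w]] by linarith
qed

lemma wsol_scale: "wsol f u g \<Longrightarrow> wsol (\<lambda>x. c * f x) (\<lambda>x. c * u x) (\<lambda>x. c *\<^sub>R g x)"
  using wsol_linear[of f u g f u g c 0] by simp

text \<open>Scaling a competitor of mass \<open>t\<close> by \<open>s / t\<close> gives one of mass \<open>s\<close>.\<close>
lemma opt_modulus_star_shaped:
  assumes "0 \<le> s" "s \<le> t" "0 < t" "t \<le> measure lebesgue D"
  shows "s / t * opt_modulus t \<le> opt_modulus s"
proof (cases "s = 0")
  case False
  have "opt_modulus t \<le> t / s * opt_modulus s"
  proof (rule opt_modulus_least)
    fix f u g assume f: "adm t f" and w: "wsol f u g"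
    have "adm (s / t * t + 0 * t) (\<lambda>x. s / t * f x + 0 * f x)"
      using assms by (intro adm_combine f) auto
    then have "adm s (\<lambda>x. s / t * f x)" using assms by simp
    from opt_modulus_upper[OF this wsol_scale[OF w]]
    have "s / t * Linf_norm D u \<le> opt_modulus s"
      using Linf_scale(2)[OF adm_wsol_Linf[OF f w], of "s / t"] assms by simp
    then show "Linf_norm D u \<le> t / s * opt_modulus s" using assms False by (simp add: field_simps)
  qed (use assms in auto)
  then show ?thesis using assms False by (simp add: field_simps)
qed (use assms opt_modulus_nonneg[of 0] in simp)

text \<open>More mass can be added without leaving the interval \<open>[0,1]\<close>; by the maximum principle this
  increases the solution.\<close>
lemma opt_modulus_mono:
  assumes "0 \<le> s" "s \<le> t" "t \<le> measure lebesgue D"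
  shows "opt_modulus s \<le> opt_modulus t"
proof (cases "s = t")
  case False
  then have s\<mu>: "s < measure lebesgue D" "s < t" using assms by auto
  show ?thesis
  proof (rule opt_modulus_least)
    fix f u g assume f: "adm s f" and w: "wsol f u g"
    note a = admD[OF f]
    define c where "c = (t - s) / (measure lebesgue D - s)"
    have c: "0 \<le> c" "c \<le> 1" "c * (measure lebesgue D - s) = t - s"
      using assms s\<mu> by (auto simp: c_def divide_le_eq_1)
    have one: "adm (measure lebesgue D) (\<lambda>x. 1)" by (simp add: adm_def measure_M[simplified])
    have "adm ((1 - c) * s + c * measure lebesgue D) (\<lambda>x. (1 - c) * f x + c * 1)"
      using c by (intro adm_combine f one) auto
    moreover have "(1 - c) * s + c * measure lebesgue D = t" using c(3) by (simp add: algebra_simps)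
    ultimately have f': "adm t (\<lambda>x. (1 - c) * f x + c)" by simp
    obtain u' g' where w': "wsol (\<lambda>x. (1 - c) * f x + c) u' g'" using wsol_exists[OF admD(6)[OF f']] .
    have "AE x in M. 0 \<le> 1 * ((1 - c) * f x + c) + - 1 * f x"
      using a(3)
    proof eventually_elim
      case (elim x)
      have "0 \<le> c * (1 - f x)" using c elim by simp
      then show ?case by (simp add: algebra_simps)
    qed
    then have "AE x in M. 0 \<le> 1 * u' x + - 1 * u x"
      by (rule wsol_nonneg[OF wsol_linear[OF w' w]])
    then have "AE x in M. \<bar>u x\<bar> \<le> u' x"
      using wsol_nonneg[OF w a(2)] by eventually_elim simp
    then have "Linf_norm D u \<le> Linf_norm D u'"
      by (rule Linf_norm_mono[OF sq_int_measurable[OF wsol_sq_int(2)[OF w]] adm_wsol_Linf[OF f' w']])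
    also have "\<dots> \<le> opt_modulus t" by (rule opt_modulus_upper[OF f' w'])
    finally show "Linf_norm D u \<le> opt_modulus t" .
  qed (use assms in auto)
qed simp

lemma opt_modulus_small:
  obtains A B where "0 \<le> A" "0 \<le> B" "\<And>t r. 0 \<le> t \<Longrightarrow> t \<le> measure lebesgue D \<Longrightarrow> 0 < r \<Longrightarrow>
    opt_modulus t \<le> A / r ^ CARD('n) * sqrt t + B * r\<^sup>2"
proof -
  obtain A B where AB: "0 \<le> A" "0 \<le> B" "\<And>t f u g r. adm t f \<Longrightarrow> wsol f u g \<Longrightarrow> 0 < r \<Longrightarrow>
      u \<in> Linf D \<and> Linf_norm D u \<le> A / r ^ CARD('n) * sqrt t + B * r\<^sup>2"
    by (rule adm_bounds) blast
  then have "opt_modulus t \<le> A / r ^ CARD('n) * sqrt t + B * r\<^sup>2"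
    if "0 \<le> t" "t \<le> measure lebesgue D" "0 < r" for t r
    using that by (intro opt_modulus_least) blast+
  then show ?thesis using that AB(1,2) by blast
qed

text \<open>First choose \<open>r\<close> so that the second term of \<open>opt_modulus_small\<close> is below \<open>e / 2\<close>, then
  the mass so that the first one is.\<close>
lemma opt_modulus_near_0:
  assumes e: "0 < e"
  obtains d where "0 < d" "\<And>t. 0 \<le> t \<Longrightarrow> t \<le> measure lebesgue D \<Longrightarrow> t < d \<Longrightarrow> opt_modulus t < e"
proof -
  obtain A B where AB: "0 \<le> A" "0 \<le> B" and le: "\<And>t r. 0 \<le> t \<Longrightarrow> t \<le> measure lebesgue D \<Longrightarrow> 0 < r \<Longrightarrow>
    opt_modulus t \<le> A / r ^ CARD('n) * sqrt t + B * r\<^sup>2"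
    by (rule opt_modulus_small) blast
  define r where "r = sqrt (e / (2 * (B + 1)))"
  have r: "0 < r" "r\<^sup>2 = e / (2 * (B + 1))" using e AB by (simp_all add: r_def)
  have Br: "B * r\<^sup>2 \<le> e / 2" unfolding r(2) using e AB by (simp add: field_simps)
  define q where "q = e / (2 * (A / r ^ CARD('n) + 1))"
  have K: "0 \<le> A / r ^ CARD('n)" using AB r by simp
  have q: "0 < q" using e K by (simp add: q_def add_nonneg_pos)
  have qe: "(A / r ^ CARD('n) + 1) * q = e / 2"
  proof -
    have "x * (e / (2 * x)) = e / 2" if "x \<noteq> 0" for x :: real using that by simp
    then show ?thesis using K unfolding q_def by (simp only: add_nonneg_eq_0_iff zero_le_one one_neq_zero simp_thms)
  qed
  show ?thesis
  proof
    show "0 < q\<^sup>2" using q by simp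
    fix t assume t: "0 \<le> t" "t \<le> measure lebesgue D" "t < q\<^sup>2"
    have "sqrt t < q" using t q by (metis real_sqrt_less_iff real_sqrt_unique less_imp_le)
    then have "A / r ^ CARD('n) * sqrt t \<le> A / r ^ CARD('n) * q" using K by (intro mult_left_mono) auto
    also have "\<dots> < e / 2" using qe q by (simp add: distrib_right)
    finally show "opt_modulus t < e" using le[OF t(1,2) r(1)] Br by linarith
  qed
qed

lemma opt_modulus_0: "opt_modulus 0 = 0"
proof (rule antisym)
  show "opt_modulus 0 \<le> 0"
  proof (rule field_le_epsilon)
    fix e :: real assume "0 < e"
    then obtain d where "0 < d" "\<And>t. 0 \<le> t \<Longrightarrow> t \<le> measure lebesgue D \<Longrightarrow> t < d \<Longrightarrow> opt_modulus t < e"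
      using opt_modulus_near_0 by blast
    then show "opt_modulus 0 \<le> 0 + e" by (simp add: less_imp_le)
  qed
  show "0 \<le> opt_modulus 0" by (rule opt_modulus_nonneg) simp_all
qed

text \<open>Monotonicity and \<open>opt_modulus_star_shaped\<close> bound \<open>\<bar>\<sigma>(t) - \<sigma>(s)\<bar>\<close> by
  \<open>(t - s) / t\<close> times the largest value, for \<open>s \<le> t\<close>.\<close>
lemma opt_modulus_modulus: "modulus_of_continuity_on (measure lebesgue D) opt_modulus"
proof -
  let ?\<mu> = "measure lebesgue D"
  have lip: "\<bar>opt_modulus t - opt_modulus s\<bar> \<le> (t - s) / t * opt_modulus ?\<mu>" if "0 \<le> s" "s \<le> t" "0 < t" "t \<le> ?\<mu>" for s t
  proof -
    have "opt_modulus t - opt_modulus s \<le> opt_modulus t - s / t * opt_modulus t" using opt_modulus_star_shaped[OF that] by simp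
    also have "\<dots> = (t - s) / t * opt_modulus t" using that by (simp add: field_simps)
    also have "\<dots> \<le> (t - s) / t * opt_modulus ?\<mu>" using that by (intro mult_left_mono opt_modulus_mono) auto
    finally show ?thesis using opt_modulus_mono[of s t] that by simp
  qed
  have "continuous_on {0..?\<mu>} opt_modulus"
    unfolding continuous_on_iff
  proof (intro ballI allI impI)
    fix t e :: real assume t: "t \<in> {0..?\<mu>}" and e: "0 < e"
    show "\<exists>d>0. \<forall>s\<in>{0..?\<mu>}. dist s t < d \<longrightarrow> dist (opt_modulus s) (opt_modulus t) < e"
    proof (cases "t = 0")
      case True
      obtain d where d: "0 < d" "\<And>s. 0 \<le> s \<Longrightarrow> s \<le> ?\<mu> \<Longrightarrow> s < d \<Longrightarrow> opt_modulus s < e"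
        using opt_modulus_near_0[OF e] by blast
      have "dist (opt_modulus s) (opt_modulus t) < e" if "s \<in> {0..?\<mu>}" "dist s t < d" for s
        using that d(2)[of s] opt_modulus_nonneg[of s] True by (simp add: opt_modulus_0 dist_real_def)
      then show ?thesis using d(1) by blast
    next
      case False
      then have t0: "0 < t" using t by simp
      have K: "0 \<le> opt_modulus ?\<mu>" by (rule opt_modulus_nonneg) simp_all
      define d where "d = min (t / 2) (e * (t / 2) / (opt_modulus ?\<mu> + 1))"
      have d: "0 < d" using t0 e K by (simp add: d_def)
      have "dist (opt_modulus s) (opt_modulus t) < e" if s: "s \<in> {0..?\<mu>}" "dist s t < d" for s
      proof -
        have st: "\<bar>s - t\<bar> < d" using s(2) by (simp add: dist_real_def)
        have m: "t / 2 \<le> max s t" "0 < max s t" using t0 by auto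
        have "\<bar>opt_modulus s - opt_modulus t\<bar> \<le> \<bar>s - t\<bar> / max s t * opt_modulus ?\<mu>"
          using lip[of s t] lip[of t s] s(1) t t0 by (cases "s \<le> t") (auto simp: max_def abs_minus_commute)
        also have "\<dots> \<le> \<bar>s - t\<bar> / (t / 2) * opt_modulus ?\<mu>"
          using m t0 K by (intro mult_right_mono divide_left_mono) auto
        also have "\<dots> \<le> d / (t / 2) * opt_modulus ?\<mu>"
          using st t0 K by (intro mult_right_mono divide_right_mono) auto
        also have "\<dots> < d / (t / 2) * (opt_modulus ?\<mu> + 1)" using d t0 by (simp add: distrib_left)
        also have "\<dots> \<le> (e * (t / 2) / (opt_modulus ?\<mu> + 1)) / (t / 2) * (opt_modulus ?\<mu> + 1)"
          using t0 K by (intro mult_right_mono divide_right_mono) (auto simp: d_def)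
        also have "\<dots> = e"
        proof -
          have cancel: "(e * y / x) / y * x = e" if "x \<noteq> 0" "y \<noteq> 0" for x y :: real using that by simp
          show ?thesis by (rule cancel) (use K t0 in linarith)+
        qed
        finally show ?thesis by (simp add: dist_real_def)
      qed
      then show ?thesis using d by blast
    qed
  qed
  moreover have "mono_on {0..?\<mu>} opt_modulus" by (rule mono_onI) (use opt_modulus_mono in auto)
  ultimately show ?thesis by (simp add: modulus_of_continuity_on_def opt_modulus_0 opt_modulus_nonneg)
qed

text \<open>By the maximum principle \<open>u\<close> and \<open>-u\<close> both lie below the solution for \<open>\<bar>f\<bar>\<close>, and dividing
  by the sup norm makes \<open>\<bar>f\<bar>\<close> admissible.\<close>
lemma opt_modulus_estimate:
  assumes f: "f \<in> Linf D" "0 < Linf_norm D f" and u: "weak_solution D f u"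
  shows "u \<in> Linf D" "Linf_norm D u \<le> Linf_norm D f * opt_modulus (L1_norm D f / Linf_norm D f)"
proof -
  let ?N = "Linf_norm D f"
  let ?t = "L1_norm D f / ?N" and ?F = "\<lambda>x. \<bar>f x\<bar> / ?N"
  note fsq = Linf_sq_int[OF f(1)]
  obtain g where w: "wsol f u g" using u weak_solution_iff_wsol[OF fsq] by blast
  have "AE x in M. ?F x \<le> 1" using Linf_AE[OF f(1)] by eventually_elim (use f(2) in simp)
  moreover have "?F \<in> borel_measurable M" using Linf_measurable[OF f(1)] by measurable
  moreover have "AE x in M. 0 \<le> ?F x" using f(2) by simp
  moreover have "(LINT x|M. ?F x) = ?t" by (simp add: L1_norm_def)
  ultimately have F: "adm ?t ?F" by (simp only: adm_def)
  obtain U G where W: "wsol ?F U G" using wsol_exists[OF admD(6)[OF F]] .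
  have s: "AE x in M. 0 \<le> 1 * ?F x + c * f x" if "\<bar>c\<bar> = 1 / ?N" for c
  proof (rule AE_I2)
    fix x
    have "\<bar>c * f x\<bar> = ?F x" using that by (simp add: abs_mult)
    then show "0 \<le> 1 * ?F x + c * f x" by linarith
  qed
  have n: "\<bar>1 / ?N\<bar> = 1 / ?N" "\<bar>- 1 / ?N\<bar> = 1 / ?N" using f(2) by simp_all
  have "AE x in M. 0 \<le> 1 * U x + 1 / ?N * u x"
    by (rule wsol_nonneg[OF wsol_linear[OF W w] s[OF n(1)]])
  moreover have "AE x in M. 0 \<le> 1 * U x + - 1 / ?N * u x"
    by (rule wsol_nonneg[OF wsol_linear[OF W w] s[OF n(2)]])
  ultimately have le: "AE x in M. \<bar>u x\<bar> \<le> ?N * U x"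
    by eventually_elim (use f(2) in \<open>auto simp: field_simps abs_le_iff\<close>)
  note UL = adm_wsol_Linf[OF F W]
  note m = Linf_norm_mono[OF sq_int_measurable[OF wsol_sq_int(2)[OF w]] Linf_scale(1)[OF UL] le]
  show "u \<in> Linf D" by (rule m(1))
  have "Linf_norm D u \<le> ?N * Linf_norm D U" using m(2) Linf_scale(2)[OF UL, of ?N] f(2) by simp
  also have "\<dots> \<le> ?N * opt_modulus ?t" using f(2) opt_modulus_upper[OF F W] by (intro mult_left_mono) auto
  finally show "Linf_norm D u \<le> ?N * opt_modulus ?t" .
qed

end

section \<open>The supremum is attained\<close>

lemma flat_exp_2_Lipschitz: "\<bar>flat_exp 2 s - flat_exp 2 t\<bar> \<le> 36 * \<bar>s - t\<bar>"
proof -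
  have "norm (flat_exp 2 s - flat_exp 2 t) \<le> 36 * norm (s - t)"
  proof (rule field_differentiable_bound[where S=UNIV])
    show "(flat_exp 2 has_field_derivative flat_exp (2 + 2) z - real 2 * flat_exp (2 + 1) z) (at z within UNIV)" for z
      by (rule flat_exp_deriv)
    fix z :: real
    have "\<bar>flat_exp 4 z\<bar> \<le> 24" "\<bar>flat_exp 3 z\<bar> \<le> 6"
      using flat_exp_abs_bound[of 4 z] flat_exp_abs_bound[of 3 z] by (simp_all add: fact_numeral)
    then show "norm (flat_exp (2 + 2) z - real 2 * flat_exp (2 + 1) z) \<le> 36" by simp
  qed auto
  then show ?thesis by simp
qed

context bounded_domain
begin

lemma ker_Lipschitz:
  assumes r: "0 < r"
  obtains L where "0 \<le> L" "\<And>x x' y. x \<in> closure D \<Longrightarrow> x' \<in> closure D \<Longrightarrow> y \<in> D \<Longrightarrow>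
    \<bar>ker x r y - ker x' r y\<bar> \<le> L * norm (x - x')"
proof -
  obtain R where R: "0 < R" "\<And>x. x \<in> closure D \<Longrightarrow> norm x \<le> R"
    using bounded_closure[OF bounded_D] by (auto simp: bounded_pos)
  let ?L = "36 * (4 * R / r\<^sup>2) / r ^ CARD('n)"
  have "\<bar>ker x r y - ker x' r y\<bar> \<le> ?L * norm (x - x')"
    if x: "x \<in> closure D" "x' \<in> closure D" "y \<in> D" for x x' y
  proof -
    have y: "norm y \<le> R" using x(3) R(2) closure_subset[of D] by auto
    have "(norm (y - x))\<^sup>2 - (norm (y - x'))\<^sup>2 = (x' - x) \<bullet> (2 *\<^sub>R y - x - x')"
      by (simp add: power2_norm_eq_inner inner_diff_left inner_diff_right inner_commute algebra_simps)
    then have "\<bar>(norm (y - x))\<^sup>2 - (norm (y - x'))\<^sup>2\<bar> \<le> norm (x' - x) * norm (2 *\<^sub>R y - x - x')"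
      using Cauchy_Schwarz_ineq2 by metis
    also have "\<dots> \<le> norm (x' - x) * (4 * R)"
    proof (rule mult_left_mono)
      have "norm (2 *\<^sub>R y - x - x') \<le> norm (2 *\<^sub>R y) + norm x + norm x'"
        using norm_triangle_ineq4[of "2 *\<^sub>R y - x" x'] norm_triangle_ineq4[of "2 *\<^sub>R y" x] by linarith
      then show "norm (2 *\<^sub>R y - x - x') \<le> 4 * R" using y R(2)[OF x(1)] R(2)[OF x(2)] by simp
    qed simp
    finally have d: "\<bar>(norm (y - x))\<^sup>2 - (norm (y - x'))\<^sup>2\<bar> \<le> 4 * R * norm (x - x')"
      by (simp add: norm_minus_commute mult.commute)
    let ?s = "1 - (norm (y - x))\<^sup>2 / r\<^sup>2" and ?s' = "1 - (norm (y - x'))\<^sup>2 / r\<^sup>2"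
    have "\<bar>?s - ?s'\<bar> = \<bar>(norm (y - x))\<^sup>2 - (norm (y - x'))\<^sup>2\<bar> / r\<^sup>2"
      using r by (simp add: diff_divide_distrib[symmetric] abs_div abs_minus_commute)
    also have "\<dots> \<le> 4 * R * norm (x - x') / r\<^sup>2" using d by (intro divide_right_mono) auto
    finally have "36 * \<bar>?s - ?s'\<bar> \<le> 36 * (4 * R * norm (x - x') / r\<^sup>2)" by simp
    then have "\<bar>flat_exp 2 ?s - flat_exp 2 ?s'\<bar> \<le> 36 * (4 * R * norm (x - x') / r\<^sup>2)"
      using flat_exp_2_Lipschitz[of ?s ?s'] by linarith
    then have "\<bar>flat_exp 2 ?s - flat_exp 2 ?s'\<bar> / r ^ CARD('n) \<le> 36 * (4 * R * norm (x - x') / r\<^sup>2) / r ^ CARD('n)"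
      using r by (intro divide_right_mono) auto
    then show ?thesis using r
      by (simp add: ker_def diff_divide_distrib[symmetric] abs_div)
  qed
  then show ?thesis using that[of ?L] R(1) r by simp
qed

text \<open>Moving the centre of an average at a fixed scale changes it little, uniformly over bounded sets
  of functions; so the centre may be replaced by a limit point.\<close>
lemma ker_average_Lipschitz:
  assumes r: "0 < r"
  obtains L where "0 \<le> L" "\<And>x x' u. x \<in> closure D \<Longrightarrow> x' \<in> closure D \<Longrightarrow> sq_int M u \<Longrightarrow>
    (average u x r) - L * norm (x - x') * L2_norm M u \<le> (average u x' r)"
proof -
  obtain L where L: "0 \<le> L" "\<And>x x' y. x \<in> closure D \<Longrightarrow> x' \<in> closure D \<Longrightarrow> y \<in> D \<Longrightarrow>
    \<bar>ker x r y - ker x' r y\<bar> \<le> L * norm (x - x')"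
    by (rule ker_Lipschitz[OF r]) blast
  let ?c = "sqrt (measure lebesgue D)"
  have "(average u x r) - L * ?c * norm (x - x') * L2_norm M u \<le> (average u x' r)"
    if x: "x \<in> closure D" "x' \<in> closure D" and u: "sq_int M u" for x x' u
  proof -
    have ui: "integrable M u" by (rule sq_int_integrable(1)[OF finite_M u])
    have "(average u x r) \<le> (LINT y|M. u y * ker x' r y + L * norm (x - x') * \<bar>u y\<bar>)"
    proof (rule integral_mono)
      show "integrable M (\<lambda>y. u y * ker x' r y + L * norm (x - x') * \<bar>u y\<bar>)"
        using ui by (intro Bochner_Integration.integrable_add sq_int_times_ker[OF u] integrable_mult_right integrable_abs)
      fix y assume "y \<in> space M"
      then have "\<bar>u y\<bar> * \<bar>ker x r y - ker x' r y\<bar> \<le> \<bar>u y\<bar> * (L * norm (x - x'))"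
        using L(2)[OF x, of y] by (intro mult_left_mono) auto
      moreover have "u y * ker x r y - u y * ker x' r y \<le> \<bar>u y\<bar> * \<bar>ker x r y - ker x' r y\<bar>"
        by (metis abs_ge_self abs_mult right_diff_distrib)
      ultimately show "u y * ker x r y \<le> u y * ker x' r y + L * norm (x - x') * \<bar>u y\<bar>"
        by (simp add: mult.commute)
    qed (rule sq_int_times_ker[OF u])
    also have "\<dots> = (average u x' r) + L * norm (x - x') * (LINT y|M. \<bar>u y\<bar>)"
      using ui by (subst Bochner_Integration.integral_add) (auto intro: sq_int_times_ker[OF u])
    also have "\<dots> \<le> (average u x' r) + L * norm (x - x') * (?c * L2_norm M u)"
      using sq_int_integrable(2)[OF finite_M u] L(1) unfolding measure_M
      by (intro add_left_mono mult_left_mono) auto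
    finally show ?thesis by (simp add: algebra_simps)
  qed
  then show ?thesis using that[of "L * ?c"] L(1) by simp
qed

lemma adm_wsol_L2_norm: "adm t f \<Longrightarrow> wsol f u g \<Longrightarrow> L2_norm M u \<le> Poincare_const\<^sup>2 * sqrt t"
  using wsol_bound adm_L2_norm by (meson mult_left_mono order_trans zero_le_power2)

text \<open>A maximising sequence of solutions almost reaches the supremum at points \<open>x\<^sub>n\<close>, whose averages
  stay large at every larger scale. These points accumulate at some \<open>x\<^sub>0\<close>.\<close>
lemma concentration_point:
  assumes t: "0 \<le> t" "t \<le> measure lebesgue D" and pos: "0 < opt_modulus t"
  obtains x0 where "\<And>N. \<exists>f u g. adm t f \<and> wsol f u g \<and>
    (\<forall>j\<le>N. opt_modulus t * kmass TYPE('n) - unit_ball_vol (real CARD('n)) / 4 * (1 / real (Suc j))\<^sup>2 - 1 / real (Suc N)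
      \<le> (average u x0 (1 / real (Suc j))))"
proof -
  let ?s = "opt_modulus t" and ?om = "unit_ball_vol (real CARD('n))" and ?km = "kmass TYPE('n)"
  define S where "S n = ?s * (1 - 1 / real (Suc (Suc n)))" for n
  have S0: "0 \<le> S n" "S n < ?s" for n using pos by (simp_all add: S_def mult_less_cancel_left2)
  \<comment> \<open>\<open>x\<close> is a point near which the \<open>n\<close>-th solution almost reaches its supremum, seen at a scale
    \<open>l\<close> that tends to \<open>0\<close>.\<close>
  define Q where "Q n f u g l x \<longleftrightarrow> adm t f \<and> wsol f u g \<and> 0 < l \<and> l < 1 / real (Suc n) \<and> x \<in> D \<and>
      S n * ?km < (average u x l)" for n f u g l x
  have "\<exists>f u g l x. Q n f u g l x" for n
  proof -
    have "S n < Sup {Linf_norm D u | f u g. adm t f \<and> wsol f u g}" using S0 by (simp add: opt_modulus_def)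
    then obtain y where "y \<in> {Linf_norm D u | f u g. adm t f \<and> wsol f u g}" "S n < y"
      using opt_modulus_nonempty[OF t] by (rule less_cSupE)
    then obtain f u g where f: "adm t f" and w: "wsol f u g" and big: "S n < Linf_norm D u" by blast
    have "\<not> (AE x in M. u x \<le> S n)"
    proof
      assume "AE x in M. u x \<le> S n"
      then have "AE x in M. \<bar>u x\<bar> \<le> S n" using wsol_nonneg[OF w admD(2)[OF f]] by eventually_elim simp
      from Linf_I(2)[OF sq_int_measurable[OF wsol_sq_int(2)[OF w]] this S0(1)] show False using big by simp
    qed
    then have "\<not> (\<forall>d>0. \<exists>l. 0 < l \<and> l < d \<and> (\<forall>x\<in>D. (average u x l) \<le> S n * ?km))"
      using AE_le_if_ker_averages_le[OF wsol_h10[OF w]] by blast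
    then obtain d where d: "0 < d" "\<And>l. 0 < l \<Longrightarrow> l < d \<Longrightarrow> \<exists>x\<in>D. S n * ?km < (average u x l)"
      by (meson not_le)
    have "0 < 1 / real (Suc n)" by simp
    from field_lbound_gt_zero[OF d(1) this] obtain l where l: "0 < l" "l < d" "l < 1 / real (Suc n)" by blast
    obtain x where "x \<in> D" "S n * ?km < (average u x l)" using d(2)[OF l(1,2)] by blast
    then show ?thesis using f w l unfolding Q_def by blast
  qed
  then obtain f u g l x where Q: "\<And>n. Q n (f n) (u n) (g n) (l n) (x n)" by metis
  have f: "adm t (f n)" and w: "wsol (f n) (u n) (g n)" and l: "0 < l n" "l n < 1 / real (Suc n)"
    and x: "x n \<in> D" and big: "S n * ?km < (average (u n) (x n) (l n))" for n
    using Q[of n] by (simp_all only: Q_def)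
  have "compact (closure D)" using bounded_D by (simp add: compact_closure)
  then obtain x0 \<rho> where x0: "x0 \<in> closure D" "strict_mono \<rho>" "(x \<circ> \<rho>) \<longlonglongrightarrow> x0"
    unfolding compact_def using x closure_subset[of D] by (meson subsetD)
  have large: "\<forall>\<^sub>F n in sequentially. ?s * ?km - ?om / 4 * r\<^sup>2 - e \<le> (average (u (\<rho> n)) x0 r)"
    if r: "0 < r" and e: "0 < e" for r e
  proof -
    obtain L where L: "0 \<le> L" "\<And>x x' u. x \<in> closure D \<Longrightarrow> x' \<in> closure D \<Longrightarrow> sq_int M u \<Longrightarrow>
      (average u x r) - L * norm (x - x') * L2_norm M u \<le> (average u x' r)"
      by (rule ker_average_Lipschitz[OF r]) blast
    define K where "K = Poincare_const\<^sup>2 * sqrt t"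
    have "(\<lambda>n. S (\<rho> n) * ?km - ?om / 4 * r\<^sup>2 - L * norm (x (\<rho> n) - x0) * K) \<longlonglongrightarrow> ?s * (1 - 0) * ?km - ?om / 4 * r\<^sup>2 - L * 0 * K"
    proof -
      have "(\<lambda>n. 1 / real (Suc (Suc n))) \<longlonglongrightarrow> 0"
        using LIMSEQ_Suc[OF LIMSEQ_Suc[OF lim_1_over_n]] by simp
      from LIMSEQ_subseq_LIMSEQ[OF this x0(2)]
      have 1: "(\<lambda>n. 1 / real (Suc (Suc (\<rho> n)))) \<longlonglongrightarrow> 0" by (simp only: comp_def)
      have 2: "(\<lambda>n. norm (x (\<rho> n) - x0)) \<longlonglongrightarrow> 0"
        using tendsto_norm_zero[OF LIM_zero[OF x0(3)]] by (simp only: comp_def)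
      show ?thesis unfolding S_def by (intro tendsto_intros 1 2)
    qed
    then have "\<forall>\<^sub>F n in sequentially. ?s * ?km - ?om / 4 * r\<^sup>2 - e
        < S (\<rho> n) * ?km - ?om / 4 * r\<^sup>2 - L * norm (x (\<rho> n) - x0) * K"
      using e by (intro order_tendstoD(1)) auto
    moreover have "\<forall>\<^sub>F n in sequentially. 1 / real (Suc n) < r"
      using order_tendstoD(2)[OF LIMSEQ_Suc[OF lim_1_over_n] r] .
    ultimately show ?thesis
    proof eventually_elim
      case (elim n)
      have "n \<le> \<rho> n" using x0(2) by (rule seq_suble)
      then have "1 / real (Suc (\<rho> n)) \<le> 1 / real (Suc n)" by (simp add: frac_le)
      then have lr: "l (\<rho> n) \<le> r" using l(2)[of "\<rho> n"] elim(2) by linarith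
      have "S (\<rho> n) * ?km - ?om / 4 * r\<^sup>2 \<le> (average (u (\<rho> n)) (x (\<rho> n)) r)"
        using big[of "\<rho> n"] ker_average_mono[OF w[of "\<rho> n"] admD(2)[OF f] admD(3)[OF f] l(1) lr, where x="x (\<rho> n)"] by linarith
      moreover have "(average (u (\<rho> n)) (x (\<rho> n)) r) - L * norm (x (\<rho> n) - x0) * L2_norm M (u (\<rho> n))
          \<le> (average (u (\<rho> n)) x0 r)"
        using x[of "\<rho> n"] closure_subset[of D] by (intro L(2) x0(1) wsol_sq_int(2)[OF w]) auto
      moreover have "L * norm (x (\<rho> n) - x0) * L2_norm M (u (\<rho> n)) \<le> L * norm (x (\<rho> n) - x0) * K"
        using adm_wsol_L2_norm[OF f w[of "\<rho> n"]] L(1) unfolding K_def by (intro mult_left_mono) auto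
      ultimately show ?case using elim(1) by linarith
    qed
  qed
  show ?thesis
  proof
    fix N
    have "\<forall>\<^sub>F n in sequentially. \<forall>j\<in>{..N}. ?s * ?km - ?om / 4 * (1 / real (Suc j))\<^sup>2 - 1 / real (Suc N)
        \<le> (average (u (\<rho> n)) x0 (1 / real (Suc j)))"
      by (intro eventually_ball_finite ballI large) auto
    then obtain n where "\<forall>j\<in>{..N}. ?s * ?km - ?om / 4 * (1 / real (Suc j))\<^sup>2 - 1 / real (Suc N)
        \<le> (average (u (\<rho> n)) x0 (1 / real (Suc j)))"
      using eventually_happens'[OF trivial_limit_sequentially] by blast
    then show "\<exists>f u g. adm t f \<and> wsol f u g \<and>
      (\<forall>j\<le>N. ?s * ?km - ?om / 4 * (1 / real (Suc j))\<^sup>2 - 1 / real (Suc N)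
      \<le> (average u x0 (1 / real (Suc j))))"
      using f[of "\<rho> n"] w[of "\<rho> n"] by blast
  qed
qed

text \<open>The midpoint of two almost minimal elements lies in the larger of the two sets, so by the
  parallelogram law their distance is controlled by the differences of the infima. This extracts a
  strong limit from convex conditions alone.\<close>
lemma almost_minimal_Cauchy:
  fixes F :: "nat \<Rightarrow> real^'n \<Rightarrow> real"
  assumes C: "\<And>m n. m \<le> n \<Longrightarrow> C n \<subseteq> C m" and F: "\<And>n. F n \<in> C n" "\<And>n f. f \<in> C n \<Longrightarrow> sq_int M f"
    and bd: "\<And>n f. f \<in> C n \<Longrightarrow> (L2_norm M f)\<^sup>2 \<le> K"
    and min: "\<And>n f. f \<in> C n \<Longrightarrow> (L2_norm M (F n))\<^sup>2 \<le> (L2_norm M f)\<^sup>2 + 1 / real (Suc n)"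
    and conv: "\<And>n f h. f \<in> C n \<Longrightarrow> h \<in> C n \<Longrightarrow> (\<lambda>x. 1/2 * f x + 1/2 * h x) \<in> C n"
    and e: "0 < e"
  shows "\<exists>N. \<forall>m\<ge>N. \<forall>n\<ge>N. L2_norm M (\<lambda>x. F m x - F n x) < e"
proof -
  let ?a = "\<lambda>n. (L2_norm M (F n))\<^sup>2"
  define b where "b n = (INF f\<in>C n. (L2_norm M f)\<^sup>2)" for n
  have bdd: "bdd_below ((\<lambda>f. (L2_norm M f)\<^sup>2) ` C n)" for n by (rule bdd_belowI2[of _ 0]) simp
  have b: "b n \<le> ?a n" "?a n \<le> b n + 1 / real (Suc n)" for n
  proof -
    show "b n \<le> ?a n" unfolding b_def by (rule cINF_lower[OF bdd F(1)])
    have "?a n - 1 / real (Suc n) \<le> b n"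
      unfolding b_def using F(1)[of n] min[of _ n] by (intro cINF_greatest) (auto simp: algebra_simps)
    then show "?a n \<le> b n + 1 / real (Suc n)" by simp
  qed
  have "incseq b"
  proof (rule incseq_SucI)
    fix n
    have "C (Suc n) \<noteq> {}" using F(1)[of "Suc n"] by blast
    then show "b n \<le> b (Suc n)" unfolding b_def by (rule cINF_superset_mono[OF _ bdd C]) simp_all
  qed
  moreover have "b n \<le> K" for n using b(1)[of n] bd[OF F(1)[of n]] by linarith
  ultimately obtain L where L: "b \<longlonglongrightarrow> L" "\<And>n. b n \<le> L" using incseq_convergent by metis
  define \<delta> where "\<delta> = e\<^sup>2 / 16"
  have \<delta>: "0 < \<delta>" using e by (simp add: \<delta>_def)
  have "\<forall>\<^sub>F n in sequentially. L - \<delta> < b n" using L(1) \<delta> by (intro order_tendstoD) auto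
  moreover have "\<forall>\<^sub>F n in sequentially. 1 / real (Suc n) < \<delta>"
    using order_tendstoD(2)[OF LIMSEQ_Suc[OF lim_1_over_n] \<delta>] .
  ultimately have "\<forall>\<^sub>F n in sequentially. L - \<delta> < b n \<and> 1 / real (Suc n) < \<delta>" by eventually_elim simp
  then obtain N where N: "\<And>n. n \<ge> N \<Longrightarrow> L - \<delta> < b n" "\<And>n. n \<ge> N \<Longrightarrow> 1 / real (Suc n) < \<delta>"
    by (auto simp: eventually_sequentially)
  have le: "L2_norm M (\<lambda>x. F m x - F n x) < e" if mn: "N \<le> m" "m \<le> n" for m n
  proof (rule power2_less_imp_less)
    let ?h = "\<lambda>x. 1/2 * F m x + 1/2 * F n x"
    have Fn: "F n \<in> C m" using F(1)[of n] C[OF mn(2)] by blast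
    note sq = F(2)[OF F(1)[of m]] F(2)[OF Fn]
    have h: "?a m \<le> (L2_norm M ?h)\<^sup>2 + 1 / real (Suc m)" by (intro min conv F(1) Fn)
    have "4 * (L2_norm M ?h)\<^sup>2 = ?a m + 2 * (LINT x|M. F m x \<bullet> F n x) + ?a n"
      using L2_norm_linear_sq[OF sq, of "1/2" "1/2"] by (simp add: field_simps power2_eq_square)
    then have "(L2_norm M (\<lambda>x. F m x - F n x))\<^sup>2 = 2 * ?a m + 2 * ?a n - 4 * (L2_norm M ?h)\<^sup>2"
      using L2_norm_diff_sq[OF sq] by linarith
    also have "\<dots> \<le> 2 * ?a n - 2 * ?a m + 4 * (1 / real (Suc m))" using h by linarith
    also have "\<dots> < 8 * \<delta>"
      using b(2)[of n] b(1)[of m] L(2)[of n] N(1)[of m] N(2)[of m] N(2)[of n] mn by linarith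
    also have "\<dots> \<le> e\<^sup>2" by (simp add: \<delta>_def)
    finally show "(L2_norm M (\<lambda>x. F m x - F n x))\<^sup>2 < e\<^sup>2" .
  qed (use e in simp)
  have "L2_norm M (\<lambda>x. F m x - F n x) < e" if "m \<ge> N" "n \<ge> N" for m n
    using le[of m n] le[of n m] that by (cases "m \<le> n") (simp_all add: L2_norm_minus_commute[of M "F m"])
  then show ?thesis by blast
qed

lemma adm_L2_limit:
  assumes F: "\<And>n. adm t (F n)" and lim: "L2_lim M F f"
  shows "adm t f"
proof -
  have f: "sq_int M f" using lim by (simp add: L2_lim_def)
  have "AE x in M. 0 \<le> f x" by (rule L2_lim_nonneg[OF lim]) (rule admD(2)[OF F])
  moreover have "AE x in M. 0 \<le> 1 - f x"
  proof (rule L2_lim_nonneg[OF L2_lim_diff[OF L2_lim_const[OF sq_int_const] lim]])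
    show "AE x in M. 0 \<le> 1 - F k x" for k using admD(3)[OF F[of k]] by eventually_elim simp
  qed
  moreover have "(LINT x|M. f x) = t"
  proof (rule LIMSEQ_unique)
    show "(\<lambda>n. LINT x|M. F n x) \<longlonglongrightarrow> (LINT x|M. f x)"
      using L2_lim_inner[OF lim L2_lim_const[OF sq_int_const[of "1::real"]]] by simp
    show "(\<lambda>n. LINT x|M. F n x) \<longlonglongrightarrow> t" using admD(4)[OF F] by simp
  qed
  ultimately show ?thesis using sq_int_measurable[OF f] by (simp add: adm_def)
qed

text \<open>The lower bounds for the averages at the concentration point are linear in the solution. Hence
  they define convex sets \<open>C N\<close>, and they survive the passage to the limit of almost minimal
  elements. Letting the scale tend to \<open>0\<close>, the limit has sup norm at least the supremum.\<close>
lemma opt_modulus_attained: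
  assumes t: "0 \<le> t" "t \<le> measure lebesgue D"
  obtains f u g where "adm t f" "wsol f u g" "Linf_norm D u = opt_modulus t"
proof (cases "0 < opt_modulus t")
  case False
  obtain f where f: "adm t f" using adm_ex[OF t] .
  obtain u g where w: "wsol f u g" using wsol_exists[OF admD(6)[OF f]] .
  have "Linf_norm D u = opt_modulus t"
    using opt_modulus_upper[OF f w] Linf_norm_nonneg[OF adm_wsol_Linf[OF f w]] False by linarith
  then show ?thesis using f w that by blast
next
  case True
  let ?s = "opt_modulus t" and ?om = "unit_ball_vol (real CARD('n))" and ?km = "kmass TYPE('n)"
  let ?r = "\<lambda>j. 1 / real (Suc j)"
  let ?low = "\<lambda>j n. ?s * ?km - ?om / 4 * (?r j)\<^sup>2 - 1 / real (Suc n)"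
  obtain x0 where x0: "\<And>N. \<exists>f u g. adm t f \<and> wsol f u g \<and>
    (\<forall>j\<le>N. ?low j N \<le> (average u x0 (?r j)))"
    using concentration_point[OF t True] by blast
  define C where "C N = {f. adm t f \<and> (\<exists>u g. wsol f u g \<and>
    (\<forall>j\<le>N. ?low j N \<le> (average u x0 (?r j))))}" for N
  have ne: "C N \<noteq> {}" for N using x0[of N] by (auto simp: C_def)
  have Csub: "C n \<subseteq> C m" if "m \<le> n" for m n
  proof
    fix f assume "f \<in> C n"
    then obtain u g where f: "adm t f" "wsol f u g" and
      le: "\<And>j. j \<le> n \<Longrightarrow> ?low j n \<le> (average u x0 (?r j))"
      by (auto simp: C_def)
    have "1 / real (Suc n) \<le> 1 / real (Suc m)" using that by (simp add: frac_le)
    then have "?low j m \<le> (average u x0 (?r j))" if "j \<le> m" for j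
      using le[of j] \<open>m \<le> n\<close> that by linarith
    then show "f \<in> C m" using f unfolding C_def by blast
  qed
  have conv: "(\<lambda>x. 1/2 * f x + 1/2 * h x) \<in> C n" if "f \<in> C n" "h \<in> C n" for n f h
  proof -
    obtain u g where f: "adm t f" and u: "wsol f u g" and
      le: "\<And>j. j \<le> n \<Longrightarrow> ?low j n \<le> (average u x0 (?r j))"
      using \<open>f \<in> C n\<close> by (auto simp: C_def)
    obtain v k where h: "adm t h" and v: "wsol h v k" and
      le': "\<And>j. j \<le> n \<Longrightarrow> ?low j n \<le> (average v x0 (?r j))"
      using \<open>h \<in> C n\<close> by (auto simp: C_def)
    have a: "adm t (\<lambda>x. 1/2 * f x + 1/2 * h x)" using adm_combine[OF f h, of "1/2" "1/2"] by simp
    have "?low j n \<le> (LINT y|M. (1/2 * u y + 1/2 * v y) * ker x0 (?r j) y)"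
      if j: "j \<le> n" for j
    proof -
      note i = sq_int_times_ker[OF wsol_sq_int(2)[OF u], of x0 "?r j"] sq_int_times_ker[OF wsol_sq_int(2)[OF v], of x0 "?r j"]
      have "(LINT y|M. (1/2 * u y + 1/2 * v y) * ker x0 (?r j) y) =
          (LINT y|M. 1/2 * (u y * ker x0 (?r j) y) + 1/2 * (v y * ker x0 (?r j) y))"
        by (simp add: distrib_right)
      also have "\<dots> = 1/2 * (average u x0 (?r j)) + 1/2 * (average v x0 (?r j))"
        using i by (simp only: Bochner_Integration.integral_add integrable_mult_right integral_mult_right_zero)
      finally show ?thesis using le[OF j] le'[OF j] by linarith
    qed
    then show ?thesis using a wsol_linear[OF u v, of "1/2" "1/2"] unfolding C_def by blast
  qed
  have Csq: "sq_int M f" if "f \<in> C n" for f n using that admD(6) by (auto simp: C_def)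
  have bd: "(L2_norm M f)\<^sup>2 \<le> t" if "f \<in> C n" for f n
  proof -
    have "L2_norm M f \<le> sqrt t" using that adm_L2_norm by (auto simp: C_def)
    then have "(L2_norm M f)\<^sup>2 \<le> (sqrt t)\<^sup>2" by (intro power_mono) auto
    then show ?thesis using t(1) by simp
  qed
  have "\<exists>f\<in>C n. \<forall>h\<in>C n. (L2_norm M f)\<^sup>2 \<le> (L2_norm M h)\<^sup>2 + 1 / real (Suc n)" for n
  proof -
    have bdd: "bdd_below ((\<lambda>f. (L2_norm M f)\<^sup>2) ` C n)" by (rule bdd_belowI2[of _ 0]) simp
    have "(INF f\<in>C n. (L2_norm M f)\<^sup>2) < (INF f\<in>C n. (L2_norm M f)\<^sup>2) + 1 / real (Suc n)" by simp
    then obtain f where "f \<in> C n" "(L2_norm M f)\<^sup>2 < (INF f\<in>C n. (L2_norm M f)\<^sup>2) + 1 / real (Suc n)"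
      using ne bdd by (subst (asm) cINF_less_iff) auto
    then have "(L2_norm M f)\<^sup>2 \<le> (L2_norm M h)\<^sup>2 + 1 / real (Suc n)" if "h \<in> C n" for h
      using cINF_lower[OF bdd that] by linarith
    then show ?thesis using \<open>f \<in> C n\<close> by blast
  qed
  then obtain F where F: "\<And>n. F n \<in> C n" "\<And>n h. h \<in> C n \<Longrightarrow> (L2_norm M (F n))\<^sup>2 \<le> (L2_norm M h)\<^sup>2 + 1 / real (Suc n)"
    by metis
  note cauchy = almost_minimal_Cauchy[OF Csub F(1) Csq bd F(2) conv]
  obtain f where lim: "L2_lim M F f"
    by (rule L2_complete[OF finite_M Csq[OF F(1)] cauchy])
  have FA: "adm t (F n)" for n using F(1)[of n] by (simp add: C_def)
  have f: "adm t f" by (rule adm_L2_limit[OF FA lim])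
  obtain u g where w: "wsol f u g" using wsol_exists[OF admD(6)[OF f]] .
  have "\<forall>n. \<exists>v k. wsol (F n) v k \<and> (\<forall>j\<le>n. ?low j n \<le> (average v x0 (?r j)))"
    using F(1) by (simp add: C_def)
  from choice[OF this] obtain U where "\<forall>n. \<exists>k. wsol (F n) (U n) k \<and>
    (\<forall>j\<le>n. ?low j n \<le> (average (U n) x0 (?r j)))" ..
  from choice[OF this] obtain G where UG: "\<forall>n. wsol (F n) (U n) (G n) \<and>
    (\<forall>j\<le>n. ?low j n \<le> (average (U n) x0 (?r j)))" ..
  have U: "wsol (F n) (U n) (G n)" for n using UG by blast
  have large: "?low j n \<le> (average (U n) x0 (?r j))"
    if "j \<le> n" for n j using UG that by blast
  have Ulim: "L2_lim M U u"
  proof -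
    have le: "norm (L2_norm M (\<lambda>x. U n x - u x)) \<le> Poincare_const\<^sup>2 * L2_norm M (\<lambda>x. F n x - f x)" for n
      using wsol_bound[OF wsol_linear[OF U[of n] w, of 1 "-1"]] by simp
    have "(\<lambda>n. L2_norm M (\<lambda>x. F n x - f x)) \<longlonglongrightarrow> 0" using lim by (simp add: L2_lim_def)
    then have "(\<lambda>n. Poincare_const\<^sup>2 * L2_norm M (\<lambda>x. F n x - f x)) \<longlonglongrightarrow> 0" by (rule tendsto_mult_right_zero)
    have "(\<lambda>n. L2_norm M (\<lambda>x. U n x - u x)) \<longlonglongrightarrow> 0"
      by (rule Lim_null_comparison[OF always_eventually \<open>(\<lambda>n. Poincare_const\<^sup>2 * L2_norm M (\<lambda>x. F n x - f x)) \<longlonglongrightarrow> 0\<close>])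
        (rule allI, rule le)
    then show ?thesis using wsol_sq_int(2)[OF U] wsol_sq_int(2)[OF w] by (simp add: L2_lim_def)
  qed
  note uL = adm_wsol_Linf[OF f w]
  have km: "0 < ?km" by (rule kmass_pos)
  have avg: "?s * ?km - ?om / 4 * (?r j)\<^sup>2 \<le> Linf_norm D u * ?km" for j
  proof -
    have "?s * ?km - ?om / 4 * (?r j)\<^sup>2 \<le> (average u x0 (?r j))"
    proof (rule LIMSEQ_le)
      show "(\<lambda>n. LINT y|M. U n y * ker x0 (?r j) y) \<longlonglongrightarrow> (average u x0 (?r j))"
        using L2_lim_inner[OF Ulim L2_lim_const[OF smooth_sq_int(1)[OF smooth_ker]]] by simp
      show "(\<lambda>n. ?low j n) \<longlonglongrightarrow> ?s * ?km - ?om / 4 * (?r j)\<^sup>2"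
        using tendsto_diff[OF tendsto_const LIMSEQ_Suc[OF lim_1_over_n], of "?s * ?km - ?om / 4 * (?r j)\<^sup>2"] by simp
      show "\<exists>N. \<forall>n\<ge>N. ?low j n \<le> (average (U n) x0 (?r j))"
        using large by blast
    qed
    also have "\<dots> \<le> Linf_norm D u * ?km"
    proof (rule ker_average_le[OF wsol_sq_int(2)[OF w] _ Linf_norm_nonneg[OF uL]])
      show "AE y in M. u y \<le> Linf_norm D u" using Linf_AE[OF uL] by eventually_elim simp
    qed simp
    finally show ?thesis .
  qed
  have "?s * ?km - ?om / 4 * 0\<^sup>2 \<le> Linf_norm D u * ?km"
  proof (rule LIMSEQ_le_const2)
    show "(\<lambda>j. ?s * ?km - ?om / 4 * (?r j)\<^sup>2) \<longlonglongrightarrow> ?s * ?km - ?om / 4 * 0\<^sup>2"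
      by (intro tendsto_intros LIMSEQ_Suc[OF lim_1_over_n])
  qed (use avg in blast)
  then have "?s \<le> Linf_norm D u" using km by simp
  then show ?thesis using opt_modulus_upper[OF f w] f w that by force
qed


text \<open>Lebesgue measure has no atoms: cover the domain by finitely many balls of measure at
  most \<open>t\<close>; one of them meets \<open>E\<close> in positive measure.\<close>
lemma small_subset:
  assumes E: "E \<in> sets M" "0 < measure M E" and t: "0 < t"
  obtains A where "A \<in> sets M" "A \<subseteq> E" "0 < measure M A" "measure M A \<le> t"
proof -
  let ?om = "unit_ball_vol (real CARD('n))"
  define \<rho> where "\<rho> = min 1 (t / (?om + 1))"
  have om: "0 < ?om" by simp
  have \<rho>: "0 < \<rho>" "\<rho> \<le> 1" "\<rho> \<le> t / (?om + 1)" using divide_pos_pos[OF t add_pos_pos[OF om zero_less_one]] by (simp_all add: \<rho>_def)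
  have "?om * \<rho> ^ CARD('n) \<le> ?om * \<rho>"
    using \<rho> om power_decreasing[of 1 "CARD('n)" \<rho>] by (intro mult_left_mono) auto
  also have "\<dots> \<le> (?om + 1) * (t / (?om + 1))" using \<rho> om by (intro mult_mono) simp_all
  also have "\<dots> = t"
  proof -
    have "?om + 1 \<noteq> 0" using om by linarith
    then show ?thesis by simp
  qed
  finally have small: "?om * \<rho> ^ CARD('n) \<le> t" .
  have "compact (closure D)" using bounded_D by (simp add: compact_closure)
  then obtain K where K: "finite K" "closure D \<subseteq> (\<Union>z\<in>K. ball z \<rho>)"
    using \<rho>(1) unfolding compact_eq_totally_bounded by metis
  have ball: "ball z \<rho> \<inter> D \<in> sets M" for z
    by (simp add: sets_restrict_space image_iff) (metis Int_commute borel_open lborelD open_ball sets_completionI_sets sets_lborel)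
  have "E \<subseteq> D" using sets.sets_into_space[OF E(1)] by simp
  have "\<exists>z\<in>K. 0 < measure M (E \<inter> (ball z \<rho> \<inter> D))"
  proof (rule ccontr)
    assume "\<not> ?thesis"
    then have z: "measure M (E \<inter> (ball z \<rho> \<inter> D)) = 0" if "z \<in> K" for z
      using that measure_nonneg[of M "E \<inter> (ball z \<rho> \<inter> D)"] by (meson antisym not_le)
    have eq: "E = (\<Union>z\<in>K. E \<inter> (ball z \<rho> \<inter> D))"
      using \<open>E \<subseteq> D\<close> K(2) closure_subset[of D] by blast
    have "measure M (\<Union>z\<in>K. E \<inter> (ball z \<rho> \<inter> D)) \<le> (\<Sum>z\<in>K. measure M (E \<inter> (ball z \<rho> \<inter> D)))"
      using E(1) ball by (intro finite_measure_subadditive_finite K(1)) auto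
    then show False using E(2) z eq by simp
  qed
  then obtain z where z: "z \<in> K" "0 < measure M (E \<inter> (ball z \<rho> \<inter> D))" by blast
  have "measure M (E \<inter> (ball z \<rho> \<inter> D)) \<le> measure M (ball z \<rho> \<inter> D)"
    using E(1) ball by (intro finite_measure_mono) auto
  also have "\<dots> = measure lebesgue (ball z \<rho> \<inter> D)" by (simp add: measure_restrict_space)
  also have "\<dots> \<le> measure lebesgue (ball z \<rho>)"
    by (intro measure_mono_fmeasurable) auto
  also have "\<dots> = ?om * \<rho> ^ CARD('n)" using \<rho>(1) by (simp add: content_ball)
  finally have "measure M (E \<inter> (ball z \<rho> \<inter> D)) \<le> t" using small by linarith
  then show ?thesis using that[of "E \<inter> (ball z \<rho> \<inter> D)"] z(2) E(1) ball by auto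
qed

text \<open>If a maximiser stays below a constant less than \<open>1\<close>, it is a proper convex combination of two
  competitors of the same mass, one of which equals \<open>1\<close> on a small set. By convexity of the norm,
  that one is a maximiser as well.\<close>
lemma opt_modulus_attained_norm_1:
  assumes t: "0 < t" "t \<le> measure lebesgue D"
  obtains f u g where "adm t f" "wsol f u g" "Linf_norm D u = opt_modulus t" "Linf_norm D f = 1"
proof -
  obtain f u g where f: "adm t f" and w: "wsol f u g" and opt: "Linf_norm D u = opt_modulus t"
    using opt_modulus_attained[OF less_imp_le[OF t(1)] t(2)] by blast
  note a = admD[OF f]
  have "AE x in M. \<bar>f x\<bar> \<le> 1" using a(2,3) by eventually_elim simp
  then have le1: "Linf_norm D f \<le> 1" by (intro Linf_I(2)[OF a(1)]) auto
  show ?thesis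
  proof (cases "Linf_norm D f = 1")
    case True
    then show ?thesis using that f w opt by blast
  next
    case False
    define \<kappa> where "\<kappa> = Linf_norm D f"
    have \<kappa>: "\<kappa> < 1" "0 \<le> \<kappa>" using False le1 Linf_norm_nonneg[OF a(5)] by (auto simp: \<kappa>_def)
    have f\<kappa>: "AE x in M. f x \<le> \<kappa>" using Linf_AE[OF a(5)] unfolding \<kappa>_def by eventually_elim simp
    have [measurable]: "f \<in> borel_measurable M" by (rule a(1))
    have "\<exists>k. 0 < measure M {x \<in> space M. 1 / real (Suc k) < f x}"
    proof (rule ccontr)
      assume "\<not> ?thesis"
      then have "measure M {x \<in> space M. 1 / real (Suc k) < f x} = 0" for k
        by (meson antisym measure_nonneg not_le)
      then have "emeasure M {x \<in> space M. 1 / real (Suc k) < f x} = 0" for k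
        by (simp only: emeasure_eq_measure ennreal_0)
      moreover have "{x \<in> space M. 1 / real (Suc k) < f x} \<in> sets M" for k by measurable
      ultimately have "{x \<in> space M. 1 / real (Suc k) < f x} \<in> null_sets M" for k by (rule null_setsI)
      then have "AE x in M. \<not> 1 / real (Suc k) < f x" for k by (intro AE_I'[of "{x \<in> space M. 1 / real (Suc k) < f x}"]) auto
      then have "AE x in M. \<forall>k. \<not> 1 / real (Suc k) < f x" 
        unfolding AE_all_countable by blast
      then have "AE x in M. f x \<le> 0"
      proof eventually_elim
        case (elim x)
        show ?case
        proof (rule ccontr)
          assume "\<not> f x \<le> 0"
          then obtain k where "inverse (real (Suc k)) < f x" using reals_Archimedean[of "f x"] by auto
          then show False using elim by (simp add: inverse_eq_divide)
        qed
      qed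
      then have "(LINT x|M. f x) \<le> (LINT x|M. 0)" by (intro integral_mono_AE a(7)) auto
      then show False using a(4) t(1) by simp
    qed
    then obtain k where k: "0 < measure M {x \<in> space M. 1 / real (Suc k) < f x}" by blast
    define \<epsilon> where "\<epsilon> = 1 / real (Suc k)"
    have \<epsilon>: "0 < \<epsilon>" by (simp add: \<epsilon>_def)
    obtain A where A: "A \<in> sets M" "A \<subseteq> {x \<in> space M. \<epsilon> < f x}" "0 < measure M A" "measure M A \<le> t"
    proof (rule small_subset[OF _ _ t(1)])
      show "{x \<in> space M. \<epsilon> < f x} \<in> sets M" by measurable
      show "0 < measure M {x \<in> space M. \<epsilon> < f x}" unfolding \<epsilon>_def by (rule k)
    qed (rule that)
    let ?I = "indicator A :: real^'n \<Rightarrow> real"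
    have [measurable]: "A \<in> sets M" by (rule A(1))
    have Ii: "integrable M ?I" by (intro integrable_real_indicator) (auto simp: emeasure_eq_measure A(1))
    have II: "(LINT x|M. ?I x) = measure M A" using A(1) sets.sets_into_space[OF A(1)] by (simp add: Int_absorb2)
    have fI: "integrable M (\<lambda>x. f x * ?I x)"
      using integrable_real_mult_indicator[OF A(1) a(7)] by simp
    define T where "T = (LINT x|M. f x * (1 - ?I x))"
    have fJ: "integrable M (\<lambda>x. f x * (1 - ?I x))"
      using a(7) fI by (simp add: right_diff_distrib)
    have T: "T = t - (LINT x|M. f x * ?I x)"
      using a(4,7) fI by (simp add: T_def right_diff_distrib)
    have "(LINT x|M. f x * ?I x) \<le> (LINT x|M. \<kappa> * ?I x)"
    proof (rule integral_mono_AE[OF fI])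
      show "integrable M (\<lambda>x. \<kappa> * ?I x)" using Ii by simp
      show "AE x in M. f x * ?I x \<le> \<kappa> * ?I x" using f\<kappa> by eventually_elim (simp add: mult_right_mono)
    qed
    also have "\<dots> = \<kappa> * measure M A" using II by simp
    also have "\<dots> < 1 * measure M A" using \<kappa> A(3) by (intro mult_strict_right_mono) auto
    finally have T': "t - measure M A < T" using T by simp
    \<comment> \<open>Raising \<open>f\<close> to \<open>1\<close> on \<open>A\<close> adds mass; the factor \<open>c\<close> on the complement of \<open>A\<close> removes it.\<close>
    define c where "c = (t - measure M A) / T"
    have Tpos: "0 < T" using T' A(4) by linarith
    have c: "0 \<le> c" "c \<le> 1" "c * T = t - measure M A"
      using T' Tpos A(4) by (simp_all add: c_def divide_le_eq_1)
    define f1 where "f1 x = ?I x + c * (f x * (1 - ?I x))" for x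
    have f1: "adm t f1"
      unfolding adm_def
    proof (intro conjI)
      show "f1 \<in> borel_measurable M" unfolding f1_def by measurable
      show "AE x in M. 0 \<le> f1 x" using a(2) by eventually_elim (use c in \<open>simp add: f1_def indicator_def\<close>)
      show "AE x in M. f1 x \<le> 1" using a(2,3)
        by eventually_elim (use c in \<open>simp add: f1_def indicator_def mult_le_one\<close>)
      have "(LINT x|M. f1 x) = measure M A + c * T"
        unfolding f1_def T_def using Ii fJ II by (simp add: Bochner_Integration.integral_add)
      then show "(LINT x|M. f1 x) = t" using c(3) by simp
    qed
    \<comment> \<open>\<open>s \<le> \<epsilon>\<close> keeps \<open>f2\<close> nonnegative on \<open>A\<close>, where \<open>f\<close> exceeds \<open>\<epsilon>\<close>; \<open>s \<le> 1 - \<kappa>\<close> keeps it below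
      \<open>1\<close> off \<open>A\<close>.\<close>
    define s where "s = min (min \<epsilon> (1 - \<kappa>)) (1 / 2)"
    have s: "0 < s" "s < 1" "s \<le> \<epsilon>" "s \<le> 1 - \<kappa>" using \<epsilon> \<kappa> by (auto simp: s_def)
    define f2 where "f2 x = 1 / (1 - s) * f x + - (s / (1 - s)) * f1 x" for x
    have f2eq: "f2 x = (f x - s * f1 x) / (1 - s)" for x
      by (simp add: f2_def diff_divide_distrib)
    have f2: "adm t f2"
      unfolding adm_def
    proof (intro conjI)
      show "f2 \<in> borel_measurable M" unfolding f2_def using admD(1)[OF f1] by measurable
      show "AE x in M. 0 \<le> f2 x" using a(2)
      proof eventually_elim
        case (elim x)
        have "s * f1 x \<le> f x"
        proof (cases "x \<in> A")
          case True
          then show ?thesis using A(2) s by (auto simp: f1_def)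
        next
          case False
          have "s * c \<le> 1" using s c by (intro mult_le_one) auto
          then have "s * c * f x \<le> 1 * f x" using elim by (intro mult_right_mono)
          then show ?thesis using False by (simp add: f1_def mult.assoc)
        qed
        then show ?case using s by (simp add: f2eq)
      qed
      show "AE x in M. f2 x \<le> 1" using a(2,3) f\<kappa>
      proof eventually_elim
        case (elim x)
        have "f x - s * f1 x \<le> 1 - s"
        proof (cases "x \<in> A")
          case True
          then show ?thesis using elim by (simp add: f1_def)
        next
          case False
          have "0 \<le> s * f1 x" using False s c elim by (simp add: f1_def)
          then show ?thesis using elim s by linarith
        qed
        then show ?case using s by (simp add: f2eq)
      qed
      have "(LINT x|M. f2 x) = 1 / (1 - s) * t + - (s / (1 - s)) * t"
        unfolding f2_def using a(4,7) admD(4,7)[OF f1]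
        by (subst Bochner_Integration.integral_add) (simp_all only: integrable_mult_right integral_mult_right_zero)
      also have "\<dots> = (1 / (1 - s) - s / (1 - s)) * t" by (simp add: left_diff_distrib)
      also have "1 / (1 - s) - s / (1 - s) = 1" using s by (simp add: diff_divide_distrib[symmetric])
      finally show "(LINT x|M. f2 x) = t" by simp
    qed
    obtain u1 g1 where w1: "wsol f1 u1 g1" using wsol_exists[OF admD(6)[OF f1]] .
    obtain u2 g2 where w2: "wsol f2 u2 g2" using wsol_exists[OF admD(6)[OF f2]] .
    note L1 = adm_wsol_Linf[OF f1 w1] and L2 = adm_wsol_Linf[OF f2 w2]
    have "AE x in M. u x = s * u1 x + (1 - s) * u2 x"
    proof (rule wsol_unique[OF w wsol_linear[OF w1 w2]])
      have "f x = s * f1 x + (1 - s) * f2 x" for x using s by (simp add: f2eq)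
      then show "AE x in M. f x = s * f1 x + (1 - s) * f2 x" by simp
    qed
    then have "AE x in M. \<bar>u x\<bar> \<le> \<bar>s\<bar> * Linf_norm D u1 + \<bar>1 - s\<bar> * Linf_norm D u2"
      using Linf_AE[OF Linf_linear(1)[OF L1 L2, of s "1 - s"]]
    proof eventually_elim
      case (elim x)
      then show ?case using Linf_linear(2)[OF L1 L2, of s "1 - s"] by simp
    qed
    then have "Linf_norm D u \<le> \<bar>s\<bar> * Linf_norm D u1 + \<bar>1 - s\<bar> * Linf_norm D u2"
      using Linf_norm_nonneg[OF L1] Linf_norm_nonneg[OF L2]
      by (intro Linf_I(2)[OF sq_int_measurable[OF wsol_sq_int(2)[OF w]]]) auto
    also have "\<dots> \<le> s * Linf_norm D u1 + (1 - s) * opt_modulus t"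
      using s opt_modulus_upper[OF f2 w2] by (simp add: mult_left_mono)
    finally have "s * opt_modulus t \<le> s * Linf_norm D u1" unfolding opt by (simp add: algebra_simps)
    then have "opt_modulus t \<le> Linf_norm D u1" using s by simp
    then have opt1: "Linf_norm D u1 = opt_modulus t" using opt_modulus_upper[OF f1 w1] by simp
    have "Linf_norm D f1 = 1"
    proof (rule antisym)
      have "AE x in M. \<bar>f1 x\<bar> \<le> 1" using admD(2)[OF f1] admD(3)[OF f1] by eventually_elim simp
      then show "Linf_norm D f1 \<le> 1" by (intro Linf_I(2)[OF admD(1)[OF f1]]) auto
      show "1 \<le> Linf_norm D f1"
      proof (rule ccontr)
        assume lt: "\<not> 1 \<le> Linf_norm D f1"
        have "AE x in M. x \<notin> A"
          using Linf_AE[OF admD(5)[OF f1]] by eventually_elim (use lt in \<open>auto simp: f1_def\<close>)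
        then have "A \<in> null_sets M" using A(1) by (simp add: AE_iff_null_sets)
        then show False using A(3) by (simp add: null_sets_def measure_def)
      qed
    qed
    then show ?thesis using that f1 w1 opt1 by blast
  qed
qed

lemma opt_modulus_sharp:
  assumes b: "0 < b" and a: "0 < a" "a \<le> b * measure lebesgue D"
  shows "\<exists>f u. f \<in> Linf D \<and> (AE x in M. f x \<ge> 0) \<and> L1_norm D f = a \<and> Linf_norm D f = b \<and>
    weak_solution D f u \<and> u \<in> Linf D \<and> Linf_norm D u = Linf_norm D f * opt_modulus (L1_norm D f / Linf_norm D f)"
proof -
  have t: "0 < a / b" "a / b \<le> measure lebesgue D" using a b by (simp_all add: divide_le_eq mult.commute)
  obtain f u g where f: "adm (a / b) f" and w: "wsol f u g" and
    opt: "Linf_norm D u = opt_modulus (a / b)" and f1: "Linf_norm D f = 1"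
    by (rule opt_modulus_attained_norm_1[OF t])
  let ?f = "\<lambda>x. b * f x" and ?u = "\<lambda>x. b * u x"
  note fl = Linf_scale[OF admD(5)[OF f], of b] and ul = Linf_scale[OF adm_wsol_Linf[OF f w], of b]
  have pos: "AE x in M. 0 \<le> ?f x" using admD(2)[OF f] by eventually_elim (use b in simp)
  have "L1_norm D ?f = (LINT x|M. b * f x)"
    unfolding L1_norm_def using pos admD(1)[OF f] by (intro integral_cong_AE) auto
  then have L1: "L1_norm D ?f = a" using admD(4)[OF f] b by simp
  have Linf: "Linf_norm D ?f = b" using fl(2) f1 b by simp
  have "weak_solution D ?f ?u"
    using weak_solution_iff_wsol[OF Linf_sq_int[OF fl(1)]] wsol_scale[OF w, of b] by blast
  moreover have "Linf_norm D ?u = Linf_norm D ?f * opt_modulus (L1_norm D ?f / Linf_norm D ?f)"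
    using ul(2) opt L1 Linf b by simp
  ultimately show ?thesis using fl(1) ul(1) pos L1 Linf by blast
qed

end

theorem theorem2p2:
  fixes D :: "(real^'n) set"
  assumes "bounded D" and "connected D" and "open D" and "lipschitz_boundary D"
  shows "\<exists>\<sigma> :: real \<Rightarrow> real. modulus_of_continuity_on (measure lebesgue D) \<sigma> \<and>
    (\<forall>f u. f \<in> Linf D \<and> Linf_norm D f > 0 \<and> weak_solution D f u \<longrightarrow>
       u \<in> Linf D \<and> Linf_norm D u \<le> Linf_norm D f * \<sigma> (L1_norm D f / Linf_norm D f)) \<and>
    (\<forall>a b :: real. b > 0 \<and> 0 < a \<and> a \<le> b * measure lebesgue D \<longrightarrow>
       (\<exists>f u. f \<in> Linf D \<and> (AE x in lebesgue_on D. f x \<ge> 0) \<and>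
          L1_norm D f = a \<and> Linf_norm D f = b \<and> weak_solution D f u \<and>
          u \<in> Linf D \<and> Linf_norm D u = Linf_norm D f * \<sigma> (L1_norm D f / Linf_norm D f)))"
proof -
  interpret bounded_domain D by unfold_locales (fact assms)+
  show ?thesis
  proof (intro exI[of _ opt_modulus] conjI allI impI)
    show "modulus_of_continuity_on (measure lebesgue D) opt_modulus" by (rule opt_modulus_modulus)
  next
    fix f u assume "f \<in> Linf D \<and> 0 < Linf_norm D f \<and> weak_solution D f u"
    then have f: "f \<in> Linf D" "0 < Linf_norm D f" "weak_solution D f u" by auto
    show "u \<in> Linf D" by (rule opt_modulus_estimate(1)[OF f])
    show "Linf_norm D u \<le> Linf_norm D f * opt_modulus (L1_norm D f / Linf_norm D f)"
      by (rule opt_modulus_estimate(2)[OF f])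
  next
    fix a b :: real assume "0 < b \<and> 0 < a \<and> a \<le> b * measure lebesgue D"
    then have ab: "0 < b" "0 < a" "a \<le> b * measure lebesgue D" by auto
    show "\<exists>f u. f \<in> Linf D \<and> (AE x in M. f x \<ge> 0) \<and> L1_norm D f = a \<and> Linf_norm D f = b \<and>
      weak_solution D f u \<and> u \<in> Linf D \<and> Linf_norm D u = Linf_norm D f * opt_modulus (L1_norm D f / Linf_norm D f)"
      by (rule opt_modulus_sharp[OF ab])
  qed
qed

end
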